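(* Let $\mathcal C$ be a class of graphs with an excluded minor. Then the restriction of Minimum Dominating Set to instances in $\mathcal C$ has a polynomial time approximation scheme (PTAS).
   Context: Graphs are finite, simple and undirected; $V^G$ and $E^G$ denote the vertex and edge sets of $G$. A minor of $G$ is a graph $H$ that can be obtained from a subgraph of $G$ by contracting edges; write $H\preceq G$. A class $\mathcal C$ of graphs has an excluded minor if there is a graph $H$ such that $H\not\preceq G$ for all $G\in\mathcal C$. Minimum Dominating Set: instances are graphs $G$; solutions are dominating sets, i.e. sets $X\subseteq V^G$ such that for every $v\in V^G\setminus X$ there is a $w\in X$ with $vw\in E^G$; the cost is $C(G,X):=|X|$; the goal is $\min$. Let $\mathrm{opt}(G)$ be the minimum cost of a solution for $G$. For $\epsilon>0$, a solution $X$ for $G$ is $\epsilon$-close if $(1-\epsilon)\,\mathrm{opt}(G)\le C(G,X)\le(1+\epsilon)\,\mathrm{opt}(G)$. A PTAS for the restriction to instances in $\mathcal C$ is a uniform family $(A_\epsilon)_{\epsilon>0}$, where $A_\epsilon$ is a polynomial time algorithm that, given $G\in\mathcal C$, computes an $\epsilon$-close solution for $G$; uniformity means that there is an algorithm that, given $\epsilon$, computes $A_\epsilon$. *)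

theory Defs
  imports "Graph_Theory.Graph_Theory" "HOL-Computational_Algebra.Polynomial"
begin

section \<open>Graphs and minors\<close>

text \<open>
  A finite simple undirected graph is a \<open>pair_graph\<close>: the edge \<open>vw\<close> is represented by the
  two arcs \<open>(v, w)\<close> and \<open>(w, v)\<close>.
\<close>

text \<open>
  Contracting the edge \<open>uv\<close>: the two ends are identified, and the new vertex is again
  called \<open>u\<close>. Loops are dropped; parallel edges merge because the arcs form a set.
\<close>

definition contract_edge :: "'a \<Rightarrow> 'a \<Rightarrow> 'a pair_pre_digraph \<Rightarrow> 'a pair_pre_digraph" where
  "contract_edge u v G =
     (let h = (\<lambda>x. if x = v then u else x)
      in \<lparr> pverts = h ` pverts G, parcs = map_prod h h ` parcs G - Id \<rparr>)"

inductive contracts_to :: "'a pair_pre_digraph \<Rightarrow> 'a pair_pre_digraph \<Rightarrow> bool" where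
  refl: "contracts_to G G"
| step: "contracts_to G K \<Longrightarrow> (u, v) \<in> parcs K \<Longrightarrow> contracts_to G (contract_edge u v K)"

definition is_minor :: "'b pair_pre_digraph \<Rightarrow> 'a pair_pre_digraph \<Rightarrow> bool" where
  "is_minor H G \<longleftrightarrow>
     (\<exists>S K. pair_graph S \<and> subgraph (with_proj S) (with_proj G) \<and> contracts_to S K \<and>
            digraph_iso (with_proj K) (with_proj H))"

text \<open>Every finite graph is isomorphic to one whose vertices are natural numbers.\<close>

definition has_excluded_minor :: "'a pair_pre_digraph set \<Rightarrow> bool" where
  "has_excluded_minor C \<longleftrightarrow>
     (\<exists>H :: nat pair_pre_digraph. pair_graph H \<and> (\<forall>G\<in>C. \<not> is_minor H G))"


section \<open>Minimum Dominating Set\<close>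

definition dominating_set :: "'a pair_pre_digraph \<Rightarrow> 'a set \<Rightarrow> bool" where
  "dominating_set G X \<longleftrightarrow>
     X \<subseteq> pverts G \<and> (\<forall>v \<in> pverts G - X. \<exists>w\<in>X. (v, w) \<in> parcs G)"

definition mds_opt :: "'a pair_pre_digraph \<Rightarrow> nat" where
  "mds_opt G = Min (card ` {X. dominating_set G X})"

definition mds_close :: "real \<Rightarrow> 'a pair_pre_digraph \<Rightarrow> 'a set \<Rightarrow> bool" where
  "mds_close \<epsilon> G X \<longleftrightarrow> dominating_set G X \<and>
     (1 - \<epsilon>) * real (mds_opt G) \<le> real (card X) \<and>
     real (card X) \<le> (1 + \<epsilon>) * real (mds_opt G)"


section \<open>Algorithms\<close>

text \<open>
  Algorithms are programs for a random access machine with addition and (truncated)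
  subtraction under the uniform cost measure. Control flow is structured instead of being
  given by jumps. In \<open>t\<close> steps the numbers gain at most \<open>t\<close> bits, so polynomial
  time on this machine is polynomial time on Turing machines. A program uses finitely many
  registers \<open>r\<close>; the memory \<open>m\<close> is addressed indirectly, by register contents.
\<close>

datatype prog =
    Skip
  | Const nat nat
  | Add nat nat nat
  | Sub nat nat nat
  | Load nat nat
  | Store nat nat
  | Seq prog prog
  | Cond nat prog prog
  | While nat prog

type_synonym ram_state = "(nat \<Rightarrow> nat) \<times> (nat \<Rightarrow> nat)"

text \<open>\<open>exec P s t s'\<close>: started in state \<open>s\<close>, the program \<open>P\<close> halts after exactly
  \<open>t\<close> steps in state \<open>s'\<close>.\<close>

inductive exec :: "prog \<Rightarrow> ram_state \<Rightarrow> nat \<Rightarrow> ram_state \<Rightarrow> bool" where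
  skip: "exec Skip s 1 s"
| const: "exec (Const i n) (r, m) 1 (r(i := n), m)"
| add: "exec (Add i j k) (r, m) 1 (r(i := r j + r k), m)"
| sub: "exec (Sub i j k) (r, m) 1 (r(i := r j - r k), m)"
| load: "exec (Load i j) (r, m) 1 (r(i := m (r j)), m)"
| store: "exec (Store i j) (r, m) 1 (r, m(r i := r j))"
| seq: "exec P s t s' \<Longrightarrow> exec Q s' t' s'' \<Longrightarrow> exec (Seq P Q) s (t + t') s''"
| if_true: "r i \<noteq> 0 \<Longrightarrow> exec P (r, m) t s' \<Longrightarrow> exec (Cond i P Q) (r, m) (1 + t) s'"
| if_false: "r i = 0 \<Longrightarrow> exec Q (r, m) t s' \<Longrightarrow> exec (Cond i P Q) (r, m) (1 + t) s'"
| while_stop: "r i = 0 \<Longrightarrow> exec (While i P) (r, m) 1 (r, m)"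
| while_loop: "r i \<noteq> 0 \<Longrightarrow> exec P (r, m) t s' \<Longrightarrow> exec (While i P) s' t' s'' \<Longrightarrow>
    exec (While i P) (r, m) (1 + t + t') s''"

inductive_cases exec_SkipE: "exec Skip s t s'"
  and exec_ConstE: "exec (Const i n) s t s'"
  and exec_AddE: "exec (Add i j k) s t s'"
  and exec_SubE: "exec (Sub i j k) s t s'"
  and exec_LoadE: "exec (Load i j) s t s'"
  and exec_StoreE: "exec (Store i j) s t s'"
  and exec_SeqE: "exec (Seq P Q) s t s'"
  and exec_CondE: "exec (Cond i P Q) s t s'"
  and exec_WhileE: "exec (While i P) s t s'"

lemma exec_deterministic:
  "exec P s t s' \<Longrightarrow> exec P s u s'' \<Longrightarrow> t = u \<and> s' = s''"
proof (induction arbitrary: u s'' rule: exec.induct)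
  case (seq P s t s1 Q t1 s2)
  from seq.prems obtain a x b where "exec P s a x" "exec Q x b s''" "u = a + b"
    by (rule exec_SeqE)
  with seq.IH show ?case by metis
next
  case (if_true r i P m t s' Q)
  from if_true.prems if_true.hyps(1) obtain a where "exec P (r, m) a s''" "u = 1 + a"
    by (auto elim: exec_CondE)
  with if_true.IH show ?case by metis
next
  case (if_false r i Q m t s' P)
  from if_false.prems if_false.hyps(1) obtain a where "exec Q (r, m) a s''" "u = 1 + a"
    by (auto elim: exec_CondE)
  with if_false.IH show ?case by metis
next
  case (while_loop r i P m t s1 t1 s2)
  from while_loop.prems while_loop.hyps(1) obtain a x b
    where "exec P (r, m) a x" "exec (While i P) x b s''" "u = 1 + a + b"
    by (auto elim: exec_WhileE)
  with while_loop.IH show ?case by metis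
next
  case (while_stop r i P m)
  from while_stop.prems while_stop.hyps show ?case by (auto elim: exec_WhileE)
qed (auto elim: exec_SkipE exec_ConstE exec_AddE exec_SubE exec_LoadE exec_StoreE)

type_synonym word = "bool list"

text \<open>
  Input and output are words over the binary alphabet; a word occupies the initial segment
  of the memory, and register \<open>0\<close> contains its length.
\<close>

definition input_state :: "word \<Rightarrow> ram_state" where
  "input_state w =
     ((\<lambda>_. 0)(0 := length w), \<lambda>i. if i < length w then of_bool (w ! i) else 0)"

definition has_output :: "ram_state \<Rightarrow> word \<Rightarrow> bool" where
  "has_output s y \<longleftrightarrow>
     fst s 0 = length y \<and> (\<forall>i < length y. snd s i = of_bool (y ! i))"

definition computes :: "prog \<Rightarrow> word \<Rightarrow> word \<Rightarrow> bool" where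
  "computes P w y \<longleftrightarrow> (\<exists>t s. exec P (input_state w) t s \<and> has_output s y)"

definition polynomial_time :: "prog \<Rightarrow> bool" where
  "polynomial_time P \<longleftrightarrow>
     (\<exists>p :: nat poly. \<forall>w. \<exists>t s. exec P (input_state w) t s \<and> t \<le> poly p (length w))"


section \<open>Encodings\<close>

text \<open>
  A graph is presented by its adjacency matrix, row by row, with respect to an enumeration
  of its vertices; a vertex set by its characteristic vector.
\<close>

definition graph_word :: "'a list \<Rightarrow> 'a pair_pre_digraph \<Rightarrow> word" where
  "graph_word vs G = concat (map (\<lambda>u. map (\<lambda>v. (u, v) \<in> parcs G) vs) vs)"

definition set_word :: "'a list \<Rightarrow> 'a set \<Rightarrow> word" where
  "set_word vs X = map (\<lambda>v. v \<in> X) vs"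

definition nat_word :: "nat \<Rightarrow> word" where
  "nat_word n = replicate n True @ [False]"

primrec prog_word :: "prog \<Rightarrow> word" where
  "prog_word Skip = nat_word 0"
| "prog_word (Const i n) = nat_word 1 @ nat_word i @ nat_word n"
| "prog_word (Add i j k) = nat_word 2 @ nat_word i @ nat_word j @ nat_word k"
| "prog_word (Sub i j k) = nat_word 3 @ nat_word i @ nat_word j @ nat_word k"
| "prog_word (Load i j) = nat_word 4 @ nat_word i @ nat_word j"
| "prog_word (Store i j) = nat_word 5 @ nat_word i @ nat_word j"
| "prog_word (Seq P Q) = nat_word 6 @ prog_word P @ prog_word Q"
| "prog_word (Cond i P Q) = nat_word 7 @ nat_word i @ prog_word P @ prog_word Q"
| "prog_word (While i P) = nat_word 8 @ nat_word i @ prog_word P"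

lemma nat_word_prefix_free: "nat_word m @ x = nat_word n @ y \<longleftrightarrow> m = n \<and> x = y"
proof (induction m arbitrary: n)
  case 0
  show ?case by (cases n) (auto simp: nat_word_def)
next
  case (Suc m)
  then show ?case by (cases n) (auto simp: nat_word_def)
qed

lemma prog_word_prefix_free: "prog_word P @ x = prog_word Q @ y \<longleftrightarrow> P = Q \<and> x = y"
proof (induction P arbitrary: Q x y)
  case Skip show ?case by (cases Q) (simp_all add: nat_word_prefix_free)
next
  case Const show ?case by (cases Q) (simp_all add: nat_word_prefix_free)
next
  case Add show ?case by (cases Q) (simp_all add: nat_word_prefix_free)
next
  case Sub show ?case by (cases Q) (simp_all add: nat_word_prefix_free)
next
  case Load show ?case by (cases Q) (simp_all add: nat_word_prefix_free)
next
  case Store show ?case by (cases Q) (simp_all add: nat_word_prefix_free)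
next
  case Seq then show ?case by (cases Q) (simp_all add: nat_word_prefix_free)
next
  case Cond then show ?case by (cases Q) (simp_all add: nat_word_prefix_free)
next
  case While then show ?case by (cases Q) (simp_all add: nat_word_prefix_free)
qed

lemma inj_prog_word: "inj prog_word"
  using prog_word_prefix_free[of _ "[]" _ "[]"] by (auto intro: injI)


section \<open>Polynomial time approximation schemes\<close>

text \<open>
  The algorithm must work for every enumeration of the vertices; the solution is returned
  with respect to the same enumeration.
\<close>

definition solves_mds_within :: "real \<Rightarrow> prog \<Rightarrow> 'a pair_pre_digraph set \<Rightarrow> bool" where
  "solves_mds_within \<epsilon> P C \<longleftrightarrow>
     (\<forall>G\<in>C. \<forall>vs. distinct vs \<and> set vs = pverts G \<longrightarrow>
        (\<exists>X. mds_close \<epsilon> G X \<and> computes P (graph_word vs G) (set_word vs X)))"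

text \<open>
  Only a rational \<open>\<epsilon>\<close> can be given to an algorithm; it is given by its reduced fraction
  \<open>p / q\<close>.
\<close>

definition uniform_family :: "(real \<Rightarrow> prog) \<Rightarrow> bool" where
  "uniform_family A \<longleftrightarrow>
     (\<exists>U. \<forall>p q :: nat. p > 0 \<and> q > 0 \<and> coprime p q \<longrightarrow>
        computes U (nat_word p @ nat_word q) (prog_word (A (real p / real q))))"

definition mds_has_ptas :: "'a pair_pre_digraph set \<Rightarrow> bool" where
  "mds_has_ptas C \<longleftrightarrow>
     (\<exists>A. uniform_family A \<and>
        (\<forall>\<epsilon>>0. polynomial_time (A \<epsilon>) \<and> solves_mds_within \<epsilon> (A \<epsilon>) C))"

end

theory Submission
  imports Defs
begin

text \<open>
  The scheme is local search: starting from all vertices, the current dominating set is replaced by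
  any smaller one that differs from it in at most \<open>k\<close> vertices. Let \<open>L\<close> be a local optimum and
  \<open>X\<close> an optimal dominating set. The exchange graph on \<open>L \<union> X\<close> is a minor of the given graph,
  so it has no large clique minor, and hence, by the separator theorem of Alon, Seymour and Thomas, it
  has a division into pieces of at most \<open>k\<close> vertices that overlap in only
  \<open>O(card (L \<union> X) / sqrt k)\<close> vertices. Exchanging \<open>L\<close> for \<open>X\<close> inside one piece is a local move,
  so it does not gain, and summing over all pieces yields \<open>card L \<le> (1 + O(1 / sqrt k)) * card X\<close>.
  Thus \<open>k = O(1 / \<epsilon>\<^sup>2)\<close> suffices. The program depends on \<open>\<epsilon>\<close> only through the constant \<open>k\<close>,
  which makes the family uniform.
\<close>

section \<open>Separators in graphs without a large clique minor\<close>

text \<open>Separators, clique models and the exchange graph occur only in the analysis: the program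
  computes no division and knows the excluded minor only through the constant \<open>k\<close>.
  Excluding a graph on \<open>h\<close> vertices excludes clique models of size \<open>h\<close>,
  because such a model yields every graph on \<open>h\<close> vertices as a minor once surplus arcs
  are deleted. A separator then has at most \<open>c * sqrt n\<close> vertices with
  \<open>c = 2 * (h + 1)^2\<close>; recursing down to pieces of size \<open>r\<close> creates an
  overlap of at most \<open>20 * c * n / sqrt r\<close>, and local optimality turns it into a loss
  of \<open>40 * c / sqrt r * (card L + card X)\<close>. With \<open>r = k = (120 * c * l)^2\<close>
  the ratio becomes \<open>1 + 1 / l\<close>. Uniformity is an obstacle of its own: the machine that
  prints the program for \<open>p / q\<close> must find an \<open>l\<close> with
  \<open>1 / l \<le> p / q\<close>, and it has only addition and subtraction. The length
  \<open>p + q + 2\<close> of its own input is such an \<open>l\<close>, so printing reduces to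
  nested loops over that length, while \<open>h\<close> is a constant of the class.\<close>

definition conn :: "('a \<times> 'a) set \<Rightarrow> 'a set \<Rightarrow> bool" where
  "conn E F \<longleftrightarrow> (\<forall>x\<in>F. \<forall>y\<in>F. (x, y) \<in> (E \<inter> F \<times> F)\<^sup>*)"

definition adj :: "('a \<times> 'a) set \<Rightarrow> 'a set \<Rightarrow> 'a set \<Rightarrow> bool" where
  "adj E A B \<longleftrightarrow> (\<exists>a\<in>A. \<exists>b\<in>B. (a, b) \<in> E)"

text \<open>A model of the complete graph on \<open>card \<C>\<close> vertices as a minor, given by
  its branch sets. Nonemptiness is asked for separately because \<open>conn\<close> holds of the
  empty set.\<close>

definition clique_model :: "('a \<times> 'a) set \<Rightarrow> 'a set \<Rightarrow> 'a set set \<Rightarrow> bool" where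
  "clique_model E V \<C> \<longleftrightarrow> finite \<C> \<and> (\<forall>C\<in>\<C>. C \<subseteq> V \<and> C \<noteq> {} \<and> conn E C) \<and>
     (\<forall>C\<in>\<C>. \<forall>D\<in>\<C>. C \<noteq> D \<longrightarrow> C \<inter> D = {} \<and> adj E C D)"

text \<open>For symmetric \<open>E\<close> this says that \<open>U\<close> is a union of components
  of the graph on \<open>V - S\<close>.\<close>

definition closed_off :: "('a \<times> 'a) set \<Rightarrow> 'a set \<Rightarrow> 'a set \<Rightarrow> 'a set \<Rightarrow> bool" where
  "closed_off E V S U \<longleftrightarrow> U \<subseteq> V - S \<and> (\<forall>u\<in>U. \<forall>w\<in>V. (u, w) \<in> E \<longrightarrow> w \<in> U \<union> S)"

text \<open>The usual two-thirds separation with separator \<open>A \<inter> B\<close>; the bounds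
  are multiplied by 3 to stay within the naturals.\<close>

definition balanced_separation ::
  "('a \<times> 'a) set \<Rightarrow> 'a set \<Rightarrow> nat \<Rightarrow> 'a set \<Rightarrow> 'a set \<Rightarrow> bool" where
  "balanced_separation E V s A B \<longleftrightarrow> A \<union> B = V \<and> (\<forall>a\<in>A - B. \<forall>b\<in>B - A. (a, b) \<notin> E) \<and>
     card (A \<inter> B) \<le> s \<and> 3 * card (A - B) \<le> 2 * card V \<and> 3 * card (B - A) \<le> 2 * card V"

section \<open>Connected sets and components\<close>

lemma rtrancl_restrict_mono:
  assumes "(x, y) \<in> (E \<inter> A \<times> A)\<^sup>*" "A \<subseteq> B" "E \<subseteq> E'"
  shows "(x, y) \<in> (E' \<inter> B \<times> B)\<^sup>*"
  using rtrancl_mono[of "E \<inter> A \<times> A" "E' \<inter> B \<times> B"] assms by blast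

lemma sym_rtrancl_restrict:
  assumes "sym E" "(x, y) \<in> (E \<inter> A \<times> A)\<^sup>*"
  shows "(y, x) \<in> (E \<inter> A \<times> A)\<^sup>*"
proof -
  have "sym (E \<inter> A \<times> A)" using assms(1) by (auto simp: sym_def)
  then show ?thesis using assms(2) by (meson symD sym_rtrancl)
qed

lemma conn_from_root:
  assumes "sym E" "x \<in> F" "\<And>y. y \<in> F \<Longrightarrow> (x, y) \<in> (E \<inter> F \<times> F)\<^sup>*"
  shows "conn E F"
  unfolding conn_def using assms sym_rtrancl_restrict[OF assms(1)] by (meson rtrancl_trans)

lemma conn_singleton: "conn E {x}"
  unfolding conn_def by auto

lemma conn_Un:
  assumes "sym E" "conn E A" "conn E B" "a \<in> A" "b \<in> B" "(a, b) \<in> E \<or> a = b"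
  shows "conn E (A \<union> B)"
proof (rule conn_from_root[OF assms(1), of a])
  let ?R = "(E \<inter> (A \<union> B) \<times> (A \<union> B))\<^sup>*"
  show "a \<in> A \<union> B" using assms(4) by blast
  fix y assume y: "y \<in> A \<union> B"
  have ab: "(a, b) \<in> ?R" using assms(4-6) by auto
  from y show "(a, y) \<in> ?R"
  proof
    assume "y \<in> A"
    then have "(a, y) \<in> (E \<inter> A \<times> A)\<^sup>*" using assms(2,4) unfolding conn_def by blast
    then show ?thesis by (rule rtrancl_restrict_mono) auto
  next
    assume "y \<in> B"
    then have "(b, y) \<in> (E \<inter> B \<times> B)\<^sup>*" using assms(3,5) unfolding conn_def by blast
    then have "(b, y) \<in> ?R" by (rule rtrancl_restrict_mono) auto
    with ab show ?thesis by (rule rtrancl_trans)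
  qed
qed

lemma conn_insert:
  assumes "sym E" "conn E A" "a \<in> A" "(a, b) \<in> E"
  shows "conn E (insert b A)"
  using conn_Un[OF assms(1,2) conn_singleton assms(3), of b b] assms(4) by simp

text \<open>Induction along a path inside \<open>F\<close>; the main device for confining a
  connected set.\<close>

lemma conn_subset_closed:
  assumes "conn E F" "x \<in> F" "x \<in> Q"
    and "\<And>u w. u \<in> Q \<inter> F \<Longrightarrow> w \<in> F \<Longrightarrow> (u, w) \<in> E \<Longrightarrow> w \<in> Q"
  shows "F \<subseteq> Q"
proof
  fix y assume "y \<in> F"
  then have "(x, y) \<in> (E \<inter> F \<times> F)\<^sup>*" using assms(1,2) unfolding conn_def by blast
  then show "y \<in> Q"
    by (induction rule: rtrancl_induct) (use assms in auto)
qed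

text \<open>\<open>K\<close> is the component of \<open>v\<close> in \<open>V - S\<close>. The last
  property holds because a closed-off set that meets the connected set \<open>K\<close> swallows it,
  and with it \<open>v\<close>; it lets unions of components grow without overlap.\<close>

lemma component_exists:
  assumes "sym E" "v \<in> V - S"
  obtains K where "v \<in> K" "conn E K" "closed_off E V S K"
    "\<And>Q. closed_off E V S Q \<Longrightarrow> v \<notin> Q \<Longrightarrow> Q \<inter> K = {}"
proof -
  let ?R = "(E \<inter> (V - S) \<times> (V - S))\<^sup>*"
  define K where "K = {w. (v, w) \<in> ?R}"
  have sub: "K \<subseteq> V - S"
  proof
    fix w assume "w \<in> K"
    then have "(v, w) \<in> ?R" by (simp add: K_def)
    then show "w \<in> V - S" by (induction rule: rtrancl_induct) (use assms in auto)
  qed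
  have v: "v \<in> K" by (simp add: K_def)
  have conn: "conn E K"
  proof (rule conn_from_root[OF assms(1) v])
    fix y assume "y \<in> K"
    then have "(v, y) \<in> ?R" by (simp add: K_def)
    then show "(v, y) \<in> (E \<inter> K \<times> K)\<^sup>*"
    proof (induction rule: rtrancl_induct)
      case base show ?case by simp
    next
      case (step y z)
      have "y \<in> K" "z \<in> K"
        using step.hyps by (auto simp: K_def intro: rtrancl_into_rtrancl)
      then show ?case using step by (meson IntD1 IntI SigmaI rtrancl.rtrancl_into_rtrancl)
    qed
  qed
  have closed: "closed_off E V S K"
    unfolding closed_off_def
  proof (intro conjI ballI impI)
    show "K \<subseteq> V - S" by (rule sub)
    fix u w assume *: "u \<in> K" "w \<in> V" "(u, w) \<in> E"
    show "w \<in> K \<union> S"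
    proof (cases "w \<in> S")
      case False
      then have "(u, w) \<in> E \<inter> (V - S) \<times> (V - S)" using * sub by blast
      then have "w \<in> K" using *(1) unfolding K_def by (auto intro: rtrancl_into_rtrancl)
      then show ?thesis by blast
    qed simp
  qed
  have "Q \<inter> K = {}" if Q: "closed_off E V S Q" "v \<notin> Q" for Q
  proof (rule ccontr)
    assume "Q \<inter> K \<noteq> {}"
    then obtain x where x: "x \<in> Q" "x \<in> K" by blast
    have "K \<subseteq> Q"
      by (rule conn_subset_closed[OF conn x(2,1)])
        (use Q(1) sub in \<open>auto simp: closed_off_def\<close>)
    then show False using v Q(2) by blast
  qed
  with v conn closed show ?thesis by (rule that)
qed

lemma balanced_separation_of_closed_off:
  assumes "finite V" "sym E" "S \<subseteq> V" "card S \<le> s" "closed_off E V S Q"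
    "3 * card Q \<le> 2 * card V" "3 * card (V - S - Q) \<le> 2 * card V"
  shows "balanced_separation E V s (S \<union> Q) (V - Q)"
proof -
  have Q: "Q \<subseteq> V - S" using assms(5) by (simp add: closed_off_def)
  have 1: "(S \<union> Q) \<inter> (V - Q) = S" "(S \<union> Q) - (V - Q) = Q" "(V - Q) - (S \<union> Q) = V - S - Q"
    using Q assms(3) by auto
  show ?thesis
    unfolding balanced_separation_def 1
    using assms Q by (auto simp: closed_off_def)
qed

text \<open>Take a union \<open>Q\<close> of components of \<open>V - S\<close> that is largest
  among those of at most two thirds of \<open>V\<close>. With a third or more it would separate, so
  it has less. One more component \<open>K\<close> overshoots two thirds by maximality, so
  \<open>K\<close> has more than a third; with at most two thirds it would separate on its
  own.\<close>

lemma big_component: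
  assumes "finite V" "sym E" "S \<subseteq> V" "card S \<le> s" "\<nexists>A B. balanced_separation E V s A B"
  obtains U where "conn E U" "closed_off E V S U" "2 * card V < 3 * card U"
proof (rule ccontr)
  assume "\<not> thesis"
  with that have small: "3 * card U \<le> 2 * card V" if "conn E U" "closed_off E V S U" for U
    using \<open>conn E U\<close> \<open>closed_off E V S U\<close> by (meson not_le)
  let ?P = "\<lambda>Q. closed_off E V S Q \<and> 3 * card Q \<le> 2 * card V"
  have "?P {}" by (simp add: closed_off_def)
  moreover have "\<forall>Q. ?P Q \<longrightarrow> card Q < Suc (card V)"
    using assms(1) by (auto simp: closed_off_def less_Suc_eq_le intro: card_mono)
  ultimately obtain Q where Q: "?P Q" and max: "\<And>Q'. ?P Q' \<Longrightarrow> card Q' \<le> card Q"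
    using ex_has_greatest_nat[of ?P "{}" card "Suc (card V)"] by blast
  have Qsub: "Q \<subseteq> V - S" and finQ: "finite Q"
    using Q assms(1) by (auto simp: closed_off_def intro: finite_subset)
  have fin: "finite (V - S)" using assms(1) by simp
  have cVS: "card (V - S) \<le> card V" using assms(1) by (simp add: card_mono)
  have no: False if "closed_off E V S Q'" "3 * card Q' \<le> 2 * card V" "card V \<le> 3 * card Q'" for Q'
  proof -
    have "card (V - S - Q') = card (V - S) - card Q'"
      using that(1) fin by (intro card_Diff_subset) (auto simp: closed_off_def intro: finite_subset)
    then have "3 * card (V - S - Q') \<le> 2 * card V" using that(3) cVS by linarith
    then show False
      using balanced_separation_of_closed_off[OF assms(1-4) that(1,2)] assms(5) by blast
  qed
  show False
  proof (cases "Q = V - S")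
    case True
    then show False
      using balanced_separation_of_closed_off[OF assms(1-4), of Q] Q assms(5) by auto
  next
    case False
    then obtain v where v: "v \<in> V - S" "v \<notin> Q" using Qsub by blast
    obtain K where K: "v \<in> K" "conn E K" "closed_off E V S K" "Q \<inter> K = {}"
      using component_exists[OF assms(2) v(1)] v(2) Q by metis
    have Ksub: "K \<subseteq> V - S" using K(3) by (simp add: closed_off_def)
    have finK: "finite K" using Ksub fin finite_subset by blast
    have cl: "closed_off E V S (Q \<union> K)"
      using K(3) Q by (auto simp: closed_off_def)
    have card: "card (Q \<union> K) = card Q + card K"
      using K(4) finQ finK by (simp add: card_Un_disjoint)
    have "0 < card K" using K(1) finK card_gt_0_iff by blast
    then have "2 * card V < 3 * (card Q + card K)"
      using max[of "Q \<union> K"] cl card by (metis add_le_same_cancel1 linorder_not_le)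
    moreover have "3 * card Q < card V" using no[of Q] Q by (meson not_le)
    ultimately have "card V \<le> 3 * card K" by (simp add: algebra_simps)
    then show False using no[OF K(3) small[OF K(2,3)]] by blast
  qed
qed

text \<open>The search runs in the copies \<open>{1..k} \<times> U\<close> of \<open>U\<close>, where being at \<open>(i, v)\<close> means that the
  sets \<open>A 0, \<dots>, A (i - 1)\<close> have been visited; some breadth-first layer yields \<open>Z\<close>.\<close>

lemma connector_or_separator:
  fixes A :: "nat \<Rightarrow> 'a set"
  assumes "finite U" "sym E" "U \<noteq> {}" "0 < M"
  shows "(\<exists>T\<subseteq>U. T \<noteq> {} \<and> conn E T \<and> card T \<le> M \<and> (\<forall>i<k. T \<inter> A i \<noteq> {})) \<or>
    (\<exists>Z\<subseteq>U. M * card Z \<le> k * card U \<and>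
       (\<forall>F. conn E F \<and> F \<subseteq> U - Z \<longrightarrow> (\<exists>i<k. F \<inter> A i = {})))"
proof (cases "k = 0")
  case True
  obtain u where "u \<in> U" using assms(3) by blast
  with True assms(4) show ?thesis
    by (intro disjI1 exI[of _ "{u}"]) (auto simp: conn_singleton)
next
  case False
  \<comment> \<open>\<open>R j\<close> is what at most \<open>j\<close> moves reach from level 1: a
    move follows an arc inside a level, or goes up from \<open>(i, v)\<close> to
    \<open>(Suc i, v)\<close> at a vertex \<open>v\<close> of \<open>A i\<close>.\<close>
  define R :: "nat \<Rightarrow> (nat \<times> 'a) set" where
    "R = rec_nat ({1} \<times> (A 0 \<inter> U))
       (\<lambda>_ Q. Q \<union> {(i, w). \<exists>v. (i, v) \<in> Q \<and> (v, w) \<in> E \<and> w \<in> U}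
                \<union> {(Suc i, v) |i v. (i, v) \<in> Q \<and> v \<in> A i \<and> i < k})"
  have R0: "R 0 = {1} \<times> (A 0 \<inter> U)" by (simp add: R_def)
  have RS: "R (Suc j) = R j \<union> {(i, w). \<exists>v. (i, v) \<in> R j \<and> (v, w) \<in> E \<and> w \<in> U}
                \<union> {(Suc i, v) |i v. (i, v) \<in> R j \<and> v \<in> A i \<and> i < k}" for j
    by (simp add: R_def)
  \<comment> \<open>The search path projects to a connected set. Moves between levels add no vertex,
    so \<open>j\<close> moves visit at most \<open>Suc j\<close> vertices; hence
    \<open>M - 1\<close> rounds for a bound of \<open>M\<close>.\<close>
  have inv: "1 \<le> i \<and> i \<le> k \<and>
      (\<exists>T\<subseteq>U. v \<in> T \<and> conn E T \<and> card T \<le> Suc j \<and> (\<forall>l<i. T \<inter> A l \<noteq> {}))"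
    if "(i, v) \<in> R j" for i v j
    using that
  proof (induction j arbitrary: i v)
    case 0
    then show ?case using False by (auto simp: R0 conn_singleton intro!: exI[of _ "{v}"])
  next
    case (Suc j)
    from Suc.prems consider "(i, v) \<in> R j"
      | u where "(i, u) \<in> R j" "(u, v) \<in> E" "v \<in> U"
      | l where "i = Suc l" "(l, v) \<in> R j" "v \<in> A l" "l < k"
      unfolding RS by blast
    then show ?case
    proof cases
      case 1
      from Suc.IH[OF 1] obtain T where "1 \<le> i" "i \<le> k" "T \<subseteq> U" "v \<in> T" "conn E T"
        "card T \<le> Suc j" "\<forall>l<i. T \<inter> A l \<noteq> {}"
        by (elim conjE exE)
      then show ?thesis by (intro conjI exI[of _ T]) auto
    next
      case 2
      from Suc.IH[OF 2(1)] obtain T where T: "1 \<le> i" "i \<le> k" "T \<subseteq> U" "u \<in> T" "conn E T"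
        "card T \<le> Suc j" "\<forall>l<i. T \<inter> A l \<noteq> {}"
        by (elim conjE exE)
      have "card (insert v T) \<le> Suc (Suc j)" using T(6) by (simp add: card_insert_le_m1)
      moreover have "conn E (insert v T)" using conn_insert[OF assms(2) T(5,4) 2(2)] .
      ultimately show ?thesis using T 2(3) by (intro conjI exI[of _ "insert v T"]) auto
    next
      case 3
      from Suc.IH[OF 3(2)] obtain T where T: "T \<subseteq> U" "v \<in> T" "conn E T" "card T \<le> Suc j"
        "\<forall>m<l. T \<inter> A m \<noteq> {}"
        by (elim conjE exE)
      with 3 show ?thesis by (auto simp: less_Suc_eq intro!: exI[of _ T])
    qed
  qed
  show ?thesis
  proof (cases "\<exists>v. (k, v) \<in> R (M - 1)")
    case True
    then obtain v where "(k, v) \<in> R (M - 1)" by blast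
    from inv[OF this] obtain T where "T \<subseteq> U" "v \<in> T" "conn E T" "card T \<le> Suc (M - 1)"
      "\<forall>l<k. T \<inter> A l \<noteq> {}"
      by (elim conjE exE)
    then show ?thesis using assms(4) by (intro disjI1 exI[of _ T]) auto
  next
    case noreach: False
    \<comment> \<open>\<open>P 0 = {}\<close> makes \<open>L j\<close> the \<open>j\<close>-th
      breadth-first layer, with \<open>L 0 = R 0\<close>.\<close>
    define P where "P j = (case j of 0 \<Rightarrow> {} | Suc i \<Rightarrow> R i)" for j
    define L where "L j = R j - P j" for j
    have mono: "R i \<subseteq> R j" if "i \<le> j" for i j
      using that by (induction rule: dec_induct) (auto simp: RS)
    have Rsub: "R j \<subseteq> {1..k} \<times> U" for j
    proof
      fix x assume "x \<in> R j"
      then show "x \<in> {1..k} \<times> U" using inv[of "fst x" "snd x" j] by (cases x) auto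
    qed
    have finR: "finite (R j)" for j
      using Rsub assms(1) by (meson finite_SigmaI finite_atLeastAtMost finite_subset)
    have cardR: "card (R j) = (\<Sum>i\<le>j. card (L i))" for j
    proof (induction j)
      case (Suc j)
      have "card (L (Suc j)) = card (R (Suc j)) - card (R j)"
        using mono[of j "Suc j"] finR by (simp add: L_def P_def card_Diff_subset)
      moreover have "card (R j) \<le> card (R (Suc j))"
        using mono[of j "Suc j"] finR by (simp add: card_mono)
      ultimately show ?case using Suc by simp
    qed (simp add: L_def P_def)
    \<comment> \<open>Averaging: the \<open>M\<close> layers are disjoint subsets of
      \<open>{1..k} \<times> U\<close>, so one of them has at most \<open>k * card U / M\<close>
      elements.\<close>
    have "\<exists>j\<le>M - 1. M * card (L j) \<le> k * card U"
    proof (rule ccontr)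
      assume "\<not> ?thesis"
      then have "\<And>j. j \<in> {..M - 1} \<Longrightarrow> k * card U < M * card (L j)" by force
      then have "(\<Sum>j\<le>M - 1. k * card U) < (\<Sum>j\<le>M - 1. M * card (L j))"
        by (intro sum_strict_mono) auto
      also have "\<dots> = M * card (R (M - 1))" by (simp add: cardR sum_distrib_left)
      also have "\<dots> \<le> M * card ({1..k} \<times> U)"
        using Rsub assms(1) by (intro mult_le_mono2 card_mono) auto
      finally show False using assms(4) by (simp add: card_cartesian_product)
    qed
    then obtain j where j: "j \<le> M - 1" "M * card (L j) \<le> k * card U" by blast
    define Z where "Z = snd ` L j"
    have ZU: "Z \<subseteq> U" using Rsub[of j] by (auto simp: Z_def L_def)
    have "card Z \<le> card (L j)" unfolding Z_def using finR by (intro card_image_le) (simp add: L_def)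
    then have cZ: "M * card Z \<le> k * card U" using j(2) by (meson le_trans mult_le_mono2)
    have "\<exists>i<k. F \<inter> A i = {}" if F: "conn E F" "F \<subseteq> U - Z" for F
    proof (rule ccontr)
      assume "\<not> ?thesis"
      then have meet: "F \<inter> A i \<noteq> {}" if "i < k" for i using that by blast
      \<comment> \<open>A vertex of \<open>F\<close> is outside \<open>Z\<close>, so at no level is
        it in layer \<open>j\<close>: if it is reached by round \<open>j\<close>, it was reached
        before.\<close>
      have stay: "(i, v) \<in> P j" if "(i, v) \<in> R j" "v \<in> F" for i v
        using that F(2) by (force simp: Z_def L_def)
      have nbr: "(i, w) \<in> R j" if "(i, v) \<in> P j" "(v, w) \<in> E" "w \<in> U" for i v w
        using that by (auto simp: P_def RS split: nat.splits)
      have cross: "(Suc i, v) \<in> R j" if "(i, v) \<in> P j" "v \<in> A i" "i < k" for i v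
        using that by (auto simp: P_def RS split: nat.splits)
      \<comment> \<open>Once a vertex of \<open>F\<close> is reached at some level,
        \<open>stay\<close> and connectedness spread this over all of \<open>F\<close> without
        further rounds; a vertex of \<open>F\<close> in the next set then lifts it one level. At
        level \<open>k\<close> this contradicts \<open>noreach\<close>.\<close>
      have "{Suc i} \<times> F \<subseteq> P j" if "i < k" for i
        using that
      proof (induction i)
        case 0
        obtain v where v: "v \<in> F" "v \<in> A 0" using meet[OF 0] by blast
        then have "(1, v) \<in> R j" using F(2) mono[of 0 j] by (auto simp: R0)
        then have "(1, v) \<in> P j" using stay v by blast
        then have "F \<subseteq> {w. (1, w) \<in> P j}"
          by (intro conn_subset_closed[OF F(1) v(1)]) (use F(2) nbr stay in auto)
        then show ?case by auto
      next
        case (Suc i)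
        obtain v where v: "v \<in> F" "v \<in> A (Suc i)" using meet[OF Suc.prems] by blast
        then have "(Suc (Suc i), v) \<in> P j" using cross[of "Suc i" v] stay Suc by auto
        then have "F \<subseteq> {w. (Suc (Suc i), w) \<in> P j}"
          by (intro conn_subset_closed[OF F(1) v(1)]) (use F(2) nbr stay in auto)
        then show ?case by auto
      qed
      from this[of "k - 1"] False have "{k} \<times> F \<subseteq> P j" by simp
      moreover have "F \<noteq> {}" using meet[of 0] False by blast
      moreover have "P j \<subseteq> R (M - 1)"
        using mono[of "j - 1" "M - 1"] j(1) by (auto simp: P_def split: nat.splits)
      ultimately show False using noreach by blast
    qed
    with ZU cZ show ?thesis by (intro disjI2 exI[of _ Z]) simp
  qed
qed

text \<open>Makes the big component for a new separator overlap the old one, so that it can be shown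
  to lie inside it.\<close>

lemma big_sets_meet:
  assumes "finite V" "U \<subseteq> V" "W \<subseteq> V" "2 * card V < 3 * card U" "2 * card V < 3 * card W"
  shows "U \<inter> W \<noteq> {}"
proof
  assume "U \<inter> W = {}"
  then have "card (U \<union> W) = card U + card W"
    using assms(1-3) by (meson card_Un_disjoint finite_subset)
  moreover have "card (U \<union> W) \<le> card V" using assms(1-3) by (simp add: card_mono)
  ultimately show False using assms(4,5) by linarith
qed

section \<open>Clique models and their modification\<close>

lemma clique_modelI:
  assumes "finite \<C>" "\<And>C. C \<in> \<C> \<Longrightarrow> C \<subseteq> V" "\<And>C. C \<in> \<C> \<Longrightarrow> C \<noteq> {}" "\<And>C. C \<in> \<C> \<Longrightarrow> conn E C"
    "\<And>C D. C \<in> \<C> \<Longrightarrow> D \<in> \<C> \<Longrightarrow> C \<noteq> D \<Longrightarrow> C \<inter> D = {}"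
    "\<And>C D. C \<in> \<C> \<Longrightarrow> D \<in> \<C> \<Longrightarrow> C \<noteq> D \<Longrightarrow> adj E C D"
  shows "clique_model E V \<C>"
  using assms unfolding clique_model_def by simp

lemma clique_modelD:
  assumes "clique_model E V \<C>"
  shows "finite \<C>" "\<And>C. C \<in> \<C> \<Longrightarrow> C \<subseteq> V" "\<And>C. C \<in> \<C> \<Longrightarrow> C \<noteq> {}" "\<And>C. C \<in> \<C> \<Longrightarrow> conn E C"
    "\<And>C D. C \<in> \<C> \<Longrightarrow> D \<in> \<C> \<Longrightarrow> C \<noteq> D \<Longrightarrow> C \<inter> D = {}"
    "\<And>C D. C \<in> \<C> \<Longrightarrow> D \<in> \<C> \<Longrightarrow> C \<noteq> D \<Longrightarrow> adj E C D"
  using assms unfolding clique_model_def by simp_all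

lemma clique_model_Union: "clique_model E V \<C> \<Longrightarrow> \<Union>\<C> \<subseteq> V"
  using clique_modelD(2) by blast

lemma clique_model_subset:
  assumes "clique_model E V \<C>" "\<D> \<subseteq> \<C>"
  shows "clique_model E V \<D>"
proof (rule clique_modelI)
  note D = clique_modelD[OF assms(1)]
  show "finite \<D>" using D(1) assms(2) finite_subset by blast
  fix C assume C: "C \<in> \<D>"
  with assms(2) have C': "C \<in> \<C>" by blast
  then show "C \<subseteq> V" "C \<noteq> {}" "conn E C" by (simp_all add: D)
  fix B assume B: "B \<in> \<D>" "C \<noteq> B"
  with assms(2) have "B \<in> \<C>" by blast
  then show "C \<inter> B = {}" "adj E C B" using D(5,6)[OF C' _ B(2)] by simp_all
qed

lemma clique_model_insert:
  assumes "clique_model E V \<C>" "sym E" "T \<subseteq> V" "T \<noteq> {}" "conn E T"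
    "\<And>C. C \<in> \<C> \<Longrightarrow> C \<inter> T = {} \<and> adj E C T"
  shows "clique_model E V (insert T \<C>)"
proof (rule clique_modelI)
  have adj: "adj E T C" if "adj E C T" for C
    using that assms(2) by (auto simp: adj_def sym_def)
  note D = clique_modelD[OF assms(1)]
  show "finite (insert T \<C>)" using D(1) by simp
  fix C assume C: "C \<in> insert T \<C>"
  show "C \<subseteq> V" "C \<noteq> {}" "conn E C" using C D(2-4) assms(3-5) by auto
  fix B assume B: "B \<in> insert T \<C>" "C \<noteq> B"
  show "C \<inter> B = {}" using C B D(5) assms(6) by (metis Int_commute insertE)
  show "adj E C B" using C B D(6) assms(6) adj by (metis insertE)
qed

text \<open>The argument of Alon, Seymour and Thomas: as long as the model of a covey has fewer than \<open>h\<close>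
  branch sets, the big component \<open>U\<close> can be shrunk, either by a new branch set inside \<open>U\<close> or by
  letting an old one grow into \<open>U\<close>; a branch set without neighbours in \<open>U\<close> is dropped.\<close>

definition covey ::
  "('a \<times> 'a) set \<Rightarrow> 'a set \<Rightarrow> nat \<Rightarrow> 'a set set \<Rightarrow> 'a set \<Rightarrow> 'a set \<Rightarrow> bool" where
  "covey E V M \<C> X U \<longleftrightarrow> clique_model E V \<C> \<and> X \<subseteq> \<Union>\<C> \<and> (\<forall>C\<in>\<C>. card (X \<inter> C) \<le> M) \<and>
     conn E U \<and> closed_off E V X U \<and> U \<inter> \<Union>\<C> = {} \<and> 2 * card V < 3 * card U"

lemma covey_card_le:
  assumes "clique_model E V \<C>" "X \<subseteq> \<Union>\<C>" "\<forall>C\<in>\<C>. card (X \<inter> C) \<le> M"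
  shows "card X \<le> card \<C> * M"
proof -
  have "X = (\<Union>C\<in>\<C>. X \<inter> C)" using assms(2) by blast
  then have "card X \<le> (\<Sum>C\<in>\<C>. card (X \<inter> C))"
    using card_UN_le[of \<C> "\<lambda>C. X \<inter> C"] assms(1) by (simp add: clique_model_def)
  also have "\<dots> \<le> (\<Sum>C\<in>\<C>. M)" using assms(3) by (intro sum_mono) auto
  finally show ?thesis by simp
qed

lemma conn_subset_closed_off:
  assumes "closed_off E V X U" "conn E W" "W \<subseteq> V - X" "W \<inter> U \<noteq> {}"
  shows "W \<subseteq> U"
proof -
  obtain x where x: "x \<in> W" "x \<in> U" using assms(4) by blast
  show ?thesis
    by (rule conn_subset_closed[OF assms(2) x]) (use assms(1,3) in \<open>auto simp: closed_off_def\<close>)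
qed

text \<open>Progress is lexicographic in \<open>(card U, card \<C>)\<close>: dropping a branch set
  keeps \<open>U\<close>, the two other moves shrink it. \<open>h * card V \<le> M * M\<close>
  bounds the set \<open>Z\<close> from \<open>connector_or_separator\<close> by \<open>M\<close>,
  and \<open>Suc h * M \<le> s\<close> leaves room for \<open>X\<close>, of size at most
  \<open>h * M\<close>, together with \<open>Z\<close> or a new branch set, so that
  \<open>big_component\<close> applies again.\<close>

lemma covey_step:
  assumes fin: "finite V" and sym: "sym E" and "0 < M" "h * card V \<le> M * M" "Suc h * M \<le> s"
    and nosep: "\<nexists>A B. balanced_separation E V s A B"
    and cov: "covey E V M \<C> X U" and less: "card \<C> < h"
  shows "\<exists>\<C>' X' U'. covey E V M \<C>' X' U' \<and> card \<C>' \<le> h \<and>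
    (card U' < card U \<or> card U' = card U \<and> card \<C>' < card \<C>)"
proof -
  have mod: "clique_model E V \<C>" and X: "X \<subseteq> \<Union>\<C>" and XC: "\<And>C. C \<in> \<C> \<Longrightarrow> card (X \<inter> C) \<le> M"
    and cU: "conn E U" and clU: "closed_off E V X U" and disj: "U \<inter> \<Union>\<C> = {}"
    and big: "2 * card V < 3 * card U"
    using cov by (auto simp: covey_def)
  note D = clique_modelD[OF mod]
  have fC: "finite \<C>" and ne: "\<And>C. C \<in> \<C> \<Longrightarrow> C \<noteq> {}" and sub: "\<And>C. C \<in> \<C> \<Longrightarrow> C \<subseteq> V"
    and conC: "\<And>C. C \<in> \<C> \<Longrightarrow> conn E C"
    and dj: "\<And>C D. C \<in> \<C> \<Longrightarrow> D \<in> \<C> \<Longrightarrow> C \<noteq> D \<Longrightarrow> C \<inter> D = {}"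
    and ad: "\<And>C D. C \<in> \<C> \<Longrightarrow> D \<in> \<C> \<Longrightarrow> C \<noteq> D \<Longrightarrow> adj E C D"
    using D(1) D(3) D(2) D(4) D(5) D(6) by simp_all
  have UV: "U \<subseteq> V - X" using clU by (simp add: closed_off_def)
  have XV: "X \<subseteq> V" using X clique_model_Union[OF mod] by blast
  have finU: "finite U" using UV fin finite_subset by blast
  have next_comp: "\<exists>U'. conn E U' \<and> closed_off E V X' U' \<and> 2 * card V < 3 * card U'"
    if "X' \<subseteq> V" "card X' \<le> s" for X'
    using big_component[OF fin sym that nosep] by blast
  show ?thesis
  proof (cases "\<exists>C\<in>\<C>. \<not> adj E C U")
    case True
    then obtain C where C: "C \<in> \<C>" "\<not> adj E C U" by blast
    \<comment> \<open>\<open>C\<close> has no neighbour in \<open>U\<close>, so its vertices can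
      leave the separator.\<close>
    have "closed_off E V (X - C) U"
      using C(2) clU sym by (auto simp: closed_off_def adj_def sym_def)
    moreover have "card ((X - C) \<inter> B) \<le> M" if "B \<in> \<C>" for B
      using card_mono[of "X \<inter> B" "(X - C) \<inter> B"] XC[OF that] finite_subset[OF XV fin] by force
    moreover have "X - C \<subseteq> \<Union>(\<C> - {C})" using X by blast
    ultimately have "covey E V M (\<C> - {C}) (X - C) U"
      unfolding covey_def using cU big disj clique_model_subset[OF mod, of "\<C> - {C}"] by blast
    moreover have "card (\<C> - {C}) < card \<C>" using C(1) fC by (meson card_Diff1_less)
    ultimately show ?thesis using less by (intro exI[of _ "\<C> - {C}"] exI[of _ "X - C"] exI[of _ U]) auto
  next
    case False
    obtain e where e: "bij_betw e {..<card \<C>} \<C>"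
      using fC ex_bij_betw_nat_finite[OF fC] by (auto simp: atLeast0LessThan)
    define nb where "nb C = {u \<in> U. \<exists>c\<in>C. (c, u) \<in> E}" for C
    have nb: "nb C \<noteq> {}" if "C \<in> \<C>" for C
    proof -
      have "adj E C U" using False that by simp
      then obtain c u where "c \<in> C" "u \<in> U" "(c, u) \<in> E" unfolding adj_def by (elim bexE)
      then show ?thesis unfolding nb_def by blast
    qed
    have U0: "U \<noteq> {}"
    proof
      assume "U = {}"
      with big show False by simp
    qed
    \<comment> \<open>Applied to the neighbourhoods in \<open>U\<close> of the branch sets: a
      connector is adjacent to all branch sets and becomes a new one.\<close>
    have conn_or: "(\<exists>T\<subseteq>U. T \<noteq> {} \<and> conn E T \<and> card T \<le> M \<and> (\<forall>i<card \<C>. T \<inter> nb (e i) \<noteq> {})) \<or>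
      (\<exists>Z\<subseteq>U. M * card Z \<le> card \<C> * card U \<and>
       (\<forall>F. conn E F \<and> F \<subseteq> U - Z \<longrightarrow> (\<exists>i<card \<C>. F \<inter> nb (e i) = {})))"
      by (rule connector_or_separator[OF finU sym U0 assms(3)])
    show ?thesis
      using conn_or
    proof (elim disjE exE conjE)
      fix T assume T: "T \<subseteq> U" "T \<noteq> {}" "conn E T" "card T \<le> M" "\<forall>i<card \<C>. T \<inter> nb (e i) \<noteq> {}"
      have TC: "T \<inter> nb C \<noteq> {}" if "C \<in> \<C>" for C
      proof -
        have "C \<in> e ` {..<card \<C>}" using that bij_betw_imp_surj_on[OF e] by simp
        then obtain i where "i < card \<C>" "C = e i" by auto
        then show ?thesis using T(5) by simp
      qed
      have Tdj: "C \<inter> T = {}" if "C \<in> \<C>" for C using T(1) disj that by blast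
      have mod': "clique_model E V (insert T \<C>)"
      proof (rule clique_model_insert[OF mod sym _ T(2,3)])
        show "T \<subseteq> V" using T(1) UV by blast
        show "C \<inter> T = {} \<and> adj E C T" if "C \<in> \<C>" for C
          using Tdj[OF that] TC[OF that] by (auto simp: adj_def nb_def)
      qed
      have TnC: "T \<notin> \<C>" using Tdj T(2) by blast
      have cC': "card (insert T \<C>) \<le> h" using less fC TnC by simp
      have X': "X \<union> T \<subseteq> \<Union>(insert T \<C>)" using X by blast
      have XT: "X \<inter> T = {}" using T(1) UV by blast
      have XC': "\<forall>C\<in>insert T \<C>. card ((X \<union> T) \<inter> C) \<le> M"
      proof
        fix C assume "C \<in> insert T \<C>"
        then show "card ((X \<union> T) \<inter> C) \<le> M"
        proof
          assume "C = T"
          then have "(X \<union> T) \<inter> C = T" by blast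
          with T(4) show ?thesis by simp
        next
          assume C: "C \<in> \<C>"
          then have "(X \<union> T) \<inter> C = X \<inter> C" using Tdj by blast
          with XC[OF C] show ?thesis by simp
        qed
      qed
      have "card (X \<union> T) \<le> card (insert T \<C>) * M" by (rule covey_card_le[OF mod' X' XC'])
      also have "\<dots> \<le> Suc h * M" using cC' by (intro mult_le_mono1) linarith
      finally have "card (X \<union> T) \<le> s" using assms(5) by linarith
      then obtain U' where U': "conn E U'" "closed_off E V (X \<union> T) U'" "2 * card V < 3 * card U'"
        using next_comp[of "X \<union> T"] XV T(1) UV by blast
      have U'V: "U' \<subseteq> V - (X \<union> T)" using U'(2) by (simp add: closed_off_def)
      \<comment> \<open>The new big component overlaps the old one and avoids \<open>X\<close>, so
        it lies in \<open>U\<close>; it also avoids the nonempty \<open>T\<close>, hence is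
        smaller.\<close>
      have "U' \<inter> U \<noteq> {}" using big_sets_meet[OF fin _ _ U'(3) big] U'V UV by blast
      then have "U' \<subseteq> U" using conn_subset_closed_off[OF clU U'(1)] U'V by blast
      then have "U' \<subset> U" using U'V T(1,2) by blast
      moreover from this have "U' \<inter> \<Union>(insert T \<C>) = {}" using disj U'V by blast
      ultimately have "covey E V M (insert T \<C>) (X \<union> T) U'" "card U' < card U"
        using mod' X' XC' U' finU by (auto simp: covey_def psubset_card_mono)
      then show ?thesis using cC' by (intro exI[of _ "insert T \<C>"] exI[of _ "X \<union> T"] exI[of _ U']) simp
    next
      fix Z assume Z: "Z \<subseteq> U" "M * card Z \<le> card \<C> * card U"
        "\<forall>F. conn E F \<and> F \<subseteq> U - Z \<longrightarrow> (\<exists>i<card \<C>. F \<inter> nb (e i) = {})"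
      have finZ: "finite Z" using Z(1) finU finite_subset by blast
      have "card U \<le> card V" using UV fin by (meson Diff_subset card_mono subset_trans)
      then have "card \<C> * card U \<le> h * card V" using less by (intro mult_le_mono) auto
      then have "M * card Z \<le> M * M" using Z(2) assms(4) by linarith
      then have cZ: "card Z \<le> M" using assms(3) by simp
      have cX: "card X \<le> h * M"
        using covey_card_le[OF mod X] XC less
        by (meson le_trans less_imp_le mult_le_mono1)
      have "card (X \<union> Z) \<le> Suc h * M" using cX cZ card_Un_le[of X Z] by simp
      then obtain W where W: "conn E W" "closed_off E V (X \<union> Z) W" "2 * card V < 3 * card W"
        using next_comp[of "X \<union> Z"] XV Z(1) UV assms(5) by (metis Diff_subset Un_least le_trans subset_trans)
      have WV: "W \<subseteq> V - (X \<union> Z)" using W(2) by (simp add: closed_off_def)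
      have "W \<inter> U \<noteq> {}" using big_sets_meet[OF fin _ _ W(3) big] WV UV by blast
      then have WU: "W \<subseteq> U" using conn_subset_closed_off[OF clU W(1)] WV by blast
      \<comment> \<open>\<open>W\<close> avoids \<open>Z\<close>, so it misses the neighbourhood of
        some branch set; that set can grow in \<open>U\<close> up to \<open>W\<close>.\<close>
      obtain i where i: "i < card \<C>" "W \<inter> nb (e i) = {}" using Z(3) W(1) WU WV by blast
      define C where "C = e i"
      have C: "C \<in> \<C>" "W \<inter> nb C = {}"
        using i bij_betwE[OF e] by (auto simp: C_def)
      \<comment> \<open>What \<open>C\<close> reaches inside \<open>U - W\<close>. It contains the
        nonempty \<open>nb C\<close>, so moving \<open>D\<close> from \<open>U\<close> into
        \<open>C\<close> shrinks \<open>U\<close>.\<close>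
      define D where "D = {y. \<exists>a\<in>nb C. (a, y) \<in> (E \<inter> (U - W) \<times> (U - W))\<^sup>*}"
      have nbD: "nb C \<subseteq> D" by (auto simp: D_def)
      have DU: "D \<subseteq> U - W"
      proof
        fix y assume "y \<in> D"
        then obtain a where "a \<in> nb C" "(a, y) \<in> (E \<inter> (U - W) \<times> (U - W))\<^sup>*"
          by (auto simp: D_def)
        from this(2,1) show "y \<in> U - W"
          by (induction rule: rtrancl_induct) (use C(2) in \<open>auto simp: nb_def\<close>)
      qed
      have Dcl: "w \<in> D" if "u \<in> D" "(u, w) \<in> E" "w \<in> U - W" for u w
        using that DU unfolding D_def
        by (smt (verit, ccfv_threshold) IntI SigmaI mem_Collect_eq rtrancl.simps subsetD D_def)
      define C' where "C' = C \<union> D"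
      have conC': "conn E C'"
      proof -
        obtain c where c: "c \<in> C" using ne[OF C(1)] by blast
        have "(c, y) \<in> (E \<inter> C' \<times> C')\<^sup>*" if y: "y \<in> C'" for y
        proof -
          have CC: "(c, y) \<in> (E \<inter> C' \<times> C')\<^sup>*" if "y \<in> C" for y
            using conC[OF C(1)] c that rtrancl_restrict_mono[of c y E C C' E]
            by (auto simp: conn_def C'_def)
          show ?thesis
          proof (cases "y \<in> C")
            case False
            then have "y \<in> D" using y by (simp add: C'_def)
            then obtain a where a: "a \<in> nb C" "(a, y) \<in> (E \<inter> (U - W) \<times> (U - W))\<^sup>*"
              by (auto simp: D_def)
            from a(2) have "(c, y) \<in> (E \<inter> C' \<times> C')\<^sup>* \<and> y \<in> D"
            proof (induction rule: rtrancl_induct)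
              case base
              obtain b where "b \<in> C" "(b, a) \<in> E" using a(1) by (auto simp: nb_def)
              then have "(b, a) \<in> E \<inter> C' \<times> C'" using a(1) nbD by (auto simp: C'_def)
              then show ?case using CC[OF \<open>b \<in> C\<close>] a(1) nbD
                by (meson rtrancl.rtrancl_into_rtrancl subsetD)
            next
              case (step y z)
              then have "z \<in> D" using Dcl by blast
              then have "(y, z) \<in> E \<inter> C' \<times> C'" using step by (auto simp: C'_def)
              then show ?case using step \<open>z \<in> D\<close> by (meson rtrancl.rtrancl_into_rtrancl)
            qed
            then show ?thesis by blast
          qed (rule CC)
        qed
        then show ?thesis using conn_from_root[OF sym, of c C'] c by (auto simp: C'_def)
      qed
      define \<C>' where "\<C>' = insert C' (\<C> - {C})"
      \<comment> \<open>\<open>C\<close> gives up its old share of the separator. The part of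
        \<open>Z\<close> inside \<open>D\<close> takes over, which keeps the share within
        \<open>M\<close>.\<close>
      define X' where "X' = (X - C) \<union> (Z \<inter> D)"
      have mod': "clique_model E V \<C>'"
        unfolding \<C>'_def
      proof (rule clique_model_insert[OF clique_model_subset[OF mod] sym _ _ conC'])
        show "\<C> - {C} \<subseteq> \<C>" by blast
        show "C' \<subseteq> V" using sub[OF C(1)] DU UV by (auto simp: C'_def)
        show "C' \<noteq> {}" using ne[OF C(1)] by (auto simp: C'_def)
        fix B assume "B \<in> \<C> - {C}"
        then have B: "B \<in> \<C>" "B \<noteq> C" by auto
        have "B \<inter> D = {}" using B(1) disj DU by blast
        then show "B \<inter> C' = {} \<and> adj E B C'"
          using dj[OF B(1) C(1) B(2)] ad[OF B(1) C(1) B(2)] by (auto simp: C'_def adj_def)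
      qed
      have "C' \<notin> \<C> - {C}"
      proof
        assume "C' \<in> \<C> - {C}"
        then have "C \<inter> C' = {}" using dj[OF C(1), of C'] by blast
        then show False using ne[OF C(1)] unfolding C'_def by blast
      qed
      then have cC': "card \<C>' = card \<C>"
        using fC card_Suc_Diff1[OF fC C(1)] by (simp add: \<C>'_def)
      have X': "X' \<subseteq> \<Union>\<C>'" using X unfolding X'_def \<C>'_def C'_def by blast
      have XC': "\<forall>B\<in>\<C>'. card (X' \<inter> B) \<le> M"
      proof
        fix B assume "B \<in> \<C>'"
        then consider "B = C'" | "B \<in> \<C>" "B \<noteq> C" unfolding \<C>'_def by blast
        then show "card (X' \<inter> B) \<le> M"
        proof cases
          case 1
          have "X' \<inter> C' \<subseteq> Z" using DU UV unfolding X'_def C'_def by blast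
          with 1 show ?thesis using cZ card_mono[OF finZ] by (meson le_trans)
        next
          case 2
          then have "C \<inter> B = {}" "D \<inter> B = {}" using dj[OF C(1) 2(1)] 2 disj DU by blast+
          then have "X' \<inter> B = X \<inter> B" unfolding X'_def by blast
          then show ?thesis using XC[OF 2(1)] by simp
        qed
      qed
      have "card X' \<le> h * M"
        using covey_card_le[OF mod' X' XC'] mult_le_mono1[OF less_imp_le[OF less], of M]
        unfolding cC' by (rule le_trans)
      then have "card X' \<le> s" using assms(5) by simp
      then obtain U' where U': "conn E U'" "closed_off E V X' U'" "2 * card V < 3 * card U'"
        using next_comp[of X'] X' clique_model_Union[OF mod'] by blast
      have U'V: "U' \<subseteq> V - X'" using U'(2) by (simp add: closed_off_def)
      have "U' \<inter> W \<noteq> {}" using big_sets_meet[OF fin _ _ U'(3) W(3)] U'V WV by blast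
      then obtain x where x: "x \<in> U'" "x \<in> W" by blast
      \<comment> \<open>From a common vertex with \<open>W\<close>, the set \<open>U'\<close> cannot
        get out of \<open>U - D\<close>. Leaving \<open>U\<close> would lead into \<open>X\<close>,
        hence into \<open>C\<close>, from a vertex of \<open>nb C\<close>, but these lie in
        \<open>D\<close>. Entering \<open>D\<close> is possible only from \<open>W\<close>, hence at
        a vertex of \<open>Z \<inter> D\<close>, which is part of \<open>X'\<close>.\<close>
      have U'D: "U' \<subseteq> U - D"
      proof (rule conn_subset_closed[OF U'(1) x(1)])
        show "x \<in> U - D" using x(2) WU DU by blast
        fix u w assume u: "u \<in> (U - D) \<inter> U'" and w: "w \<in> U'" and uw: "(u, w) \<in> E"
        have wV: "w \<in> V" "w \<notin> X'" using w U'V by auto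
        then have "w \<in> U \<union> X" using u uw clU by (auto simp: closed_off_def)
        moreover have "w \<notin> X"
        proof
          assume "w \<in> X"
          then have "w \<in> C" using wV by (auto simp: X'_def)
          then have "u \<in> nb C" using u uw sym by (auto simp: nb_def sym_def)
          then show False using u nbD by blast
        qed
        ultimately have wU: "w \<in> U" by blast
        moreover have "w \<notin> D"
        proof
          assume wD: "w \<in> D"
          have "u \<in> W"
          proof (rule ccontr)
            assume "u \<notin> W"
            then have "u \<in> D" using Dcl[OF wD] u uw sym by (auto simp: sym_def)
            then show False using u by blast
          qed
          then have "w \<in> W \<union> (X \<union> Z)" using W(2) uw wV by (auto simp: closed_off_def)
          then have "w \<in> Z" using wD DU \<open>w \<notin> X\<close> by blast
          then show False using wV wD by (auto simp: X'_def)
        qed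
        ultimately show "w \<in> U - D" by blast
      qed
      have "U' \<subset> U" using U'D nb[OF C(1)] nbD DU by blast
      then have "card U' < card U" using finU by (simp add: psubset_card_mono)
      moreover have "U' \<inter> \<Union>\<C>' = {}"
        using U'D disj C(1) by (auto simp: \<C>'_def C'_def)
      ultimately show ?thesis
        using mod' X' XC' U' cC' less
        by (intro exI[of _ \<C>'] exI[of _ X'] exI[of _ U']) (auto simp: covey_def)
    qed
  qed
qed

text \<open>Starts from the empty model, with a big component for the empty separator as
  \<open>U\<close>, and repeats \<open>covey_step\<close> until the model has \<open>h\<close>
  branch sets. The parameter \<open>M\<close>, meant to be about \<open>sqrt (h * card V)\<close>,
  keeps roots out of the argument.\<close>

theorem clique_model_or_balanced_separation:
  assumes "finite V" "sym E" "0 < M" "h * card V \<le> M * M" "Suc h * M \<le> s"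
    and nosep: "\<nexists>A B. balanced_separation E V s A B"
  shows "\<exists>\<C>. clique_model E V \<C> \<and> card \<C> = h"
proof -
  have ind: "\<exists>\<C>. clique_model E V \<C> \<and> card \<C> = h" if "covey E V M \<C> X U" "card \<C> \<le> h" for \<C> X U
    using that
  proof (induction "(card U, card \<C>)" arbitrary: \<C> X U rule: wf_induct_rule[OF wf_lex_prod[OF wf_less wf_less]])
    case 1
    show ?case
    proof (cases "card \<C> = h")
      case True
      then show ?thesis using 1(2) by (auto simp: covey_def)
    next
      case False
      then have "card \<C> < h" using 1(3) by simp
      from covey_step[OF assms 1(2) this] obtain \<C>' X' U' where
        *: "covey E V M \<C>' X' U'" "card \<C>' \<le> h"
        "card U' < card U \<or> card U' = card U \<and> card \<C>' < card \<C>"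
        by (elim exE conjE)
      show ?thesis by (rule 1(1)[OF _ *(1,2)]) (use *(3) in simp)
    qed
  qed
  obtain U where "conn E U" "closed_off E V {} U" "2 * card V < 3 * card U"
    using big_component[OF assms(1,2) _ _ nosep, of "{}"] by auto
  then have "covey E V M {} {} U" by (simp add: covey_def clique_model_def)
  from ind[OF this] show ?thesis by simp
qed

section \<open>Divisions into small pieces\<close>

text \<open>The pieces form a list so that the sum of their sizes counts repeated pieces repeatedly;
  its excess over \<open>card V\<close> measures the overlap.\<close>

definition division :: "('a \<times> 'a) set \<Rightarrow> 'a set \<Rightarrow> nat \<Rightarrow> 'a set list \<Rightarrow> bool" where
  "division E V r \<P> \<longleftrightarrow> (\<forall>P\<in>set \<P>. P \<subseteq> V \<and> card P \<le> r) \<and> \<Union>(set \<P>) = V \<and>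
     (\<forall>u\<in>V. \<forall>v\<in>V. (u, v) \<in> E \<longrightarrow> (\<exists>P\<in>set \<P>. u \<in> P \<and> v \<in> P))"

lemma division_append:
  assumes "division E A r \<P>" "division E B r \<Q>" "balanced_separation E V s A B" "sym E"
  shows "division E V r (\<P> @ \<Q>)"
proof -
  have V: "A \<union> B = V" and no: "\<And>a b. a \<in> A - B \<Longrightarrow> b \<in> B - A \<Longrightarrow> (a, b) \<notin> E"
    using assms(3) by (auto simp: balanced_separation_def)
  have "\<exists>P\<in>set (\<P> @ \<Q>). u \<in> P \<and> v \<in> P" if "u \<in> V" "v \<in> V" and uv: "(u, v) \<in> E" for u v
  proof -
    have "(v, u) \<in> E" using uv assms(4) by (auto simp: sym_def)
    then have "u \<in> A \<and> v \<in> A \<or> u \<in> B \<and> v \<in> B" using no[of u v] no[of v u] that V by blast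
    then show ?thesis
    proof
      assume "u \<in> A \<and> v \<in> A"
      then obtain P where "P \<in> set \<P>" "u \<in> P" "v \<in> P"
        using assms(1) uv unfolding division_def by blast
      then show ?thesis by auto
    next
      assume "u \<in> B \<and> v \<in> B"
      then obtain P where "P \<in> set \<Q>" "u \<in> P" "v \<in> P"
        using assms(2) uv unfolding division_def by blast
      then show ?thesis by auto
    qed
  qed
  moreover have "\<Union>(set (\<P> @ \<Q>)) = V" using assms(1,2) V unfolding division_def by simp
  moreover have "\<forall>P\<in>set (\<P> @ \<Q>). P \<subseteq> V \<and> card P \<le> r"
    using assms(1,2) V unfolding division_def by fastforce
  ultimately show ?thesis unfolding division_def by simp
qed

text \<open>From \<open>(a - n/4) * (b - n/4) \<ge> 0\<close> comes
  \<open>sqrt (a * b) \<ge> n/4\<close>, so the square of the right-hand side is at least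
  \<open>3/2 * n\<close>; \<open>6/5\<close> is a rational below \<open>sqrt (3/2)\<close>.\<close>

lemma sqrt_split_gain:
  fixes a b n :: real
  assumes "n / 4 \<le> a" "n / 4 \<le> b" "n \<le> a + b" "0 \<le> n"
  shows "6 / 5 * sqrt n \<le> sqrt a + sqrt b"
proof -
  have a: "0 \<le> a" and b: "0 \<le> b" using assms by linarith+
  have "0 \<le> (a - n / 4) * (b - n / 4)" using assms(1,2) by (intro mult_nonneg_nonneg) linarith+
  then have "n / 4 * (a + b) - n\<^sup>2 / 16 \<le> a * b" by (simp add: algebra_simps power2_eq_square)
  moreover have "n / 4 * n \<le> n / 4 * (a + b)" using assms by (intro mult_left_mono) auto
  ultimately have "n\<^sup>2 / 16 \<le> a * b" using zero_le_square[of n] unfolding power2_eq_square by linarith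
  then have "(n / 4)\<^sup>2 \<le> (sqrt (a * b))\<^sup>2" using a b by (simp add: power_divide)
  then have "n / 4 \<le> sqrt a * sqrt b"
    using a b by (metis power2_le_imp_le real_sqrt_ge_0_iff real_sqrt_mult mult_nonneg_nonneg)
  then have "n + n / 2 \<le> (sqrt a + sqrt b)\<^sup>2" using assms(3) a b by (simp add: power2_sum)
  then have "(6 / 5 * sqrt n)\<^sup>2 \<le> (sqrt a + sqrt b)\<^sup>2" using assms(4) by (simp add: power_mult_distrib power_divide)
  then show ?thesis using a b by (intro power2_le_imp_le[of "6 / 5 * sqrt n"]) auto
qed

text \<open>The term \<open>- 10 * c * sqrt (card V)\<close> makes the induction work: it pays for the
  separators, because \<open>sqrt\<close> is strictly concave.\<close>

lemma division_from_separations: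
  fixes c :: real
  assumes "0 < c" "sym E" "400 * c\<^sup>2 \<le> real r"
    and sep: "\<And>W. W \<subseteq> V \<Longrightarrow> W \<noteq> {} \<Longrightarrow>
      \<exists>s A B. balanced_separation E W s A B \<and> real s \<le> c * sqrt (card W)"
    and "W \<subseteq> V" "finite V" "r \<le> 4 * card W"
  shows "\<exists>\<P>. division E W r \<P> \<and>
    real (\<Sum>P\<leftarrow>\<P>. card P) \<le> card W + 20 * c * card W / sqrt r - 10 * c * sqrt (card W)"
  using assms(5,7)
proof (induction "card W" arbitrary: W rule: less_induct)
  case less
  define n where "n = real (card W)"
  have finW: "finite W" using less.prems assms(6) finite_subset by blast
  have rpos: "0 < real r" using assms(1,3) by (smt (verit) zero_less_power2 mult_pos_pos)
  have r4: "real r \<le> 4 * n" using less.prems(2) unfolding n_def by linarith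
  have sr: "20 * c \<le> sqrt r"
    using real_sqrt_le_mono[OF assms(3)] assms(1) by (simp add: real_sqrt_mult)
  have npos: "0 < n" using r4 rpos by linarith
  have sqn: "sqrt n * sqrt n = n" using npos by simp
  show ?case
  proof (cases "card W \<le> r")
    case True
    \<comment> \<open>A single piece has no overlap, but the linear term must still cover
      \<open>10 * c * sqrt n\<close>; this is where \<open>r \<le> 4 * card W\<close>
      enters.\<close>
    have "sqrt r \<le> 2 * sqrt n" using real_sqrt_le_mono[OF r4] by (simp add: real_sqrt_mult)
    then have "10 * c * sqrt n * sqrt r \<le> 10 * c * sqrt n * (2 * sqrt n)"
      using assms(1) npos by (intro mult_left_mono) auto
    then have "10 * c * sqrt n \<le> 20 * c * n / sqrt r"
      using rpos sqn by (simp add: field_simps)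
    moreover have "division E W r [W]" using True by (auto simp: division_def)
    ultimately show ?thesis unfolding n_def by (intro exI[of _ "[W]"]) auto
  next
    case False
    then have rn: "real r < n" by (simp add: n_def)
    have W0: "W \<noteq> {}" using npos by (auto simp: n_def)
    obtain s A B where AB: "balanced_separation E W s A B" and s: "real s \<le> c * sqrt n"
      using sep[OF less.prems(1) W0] unfolding n_def by blast
    have W: "A \<union> B = W" and cs: "card (A \<inter> B) \<le> s"
      and cA: "3 * card (A - B) \<le> 2 * card W" and cB: "3 * card (B - A) \<le> 2 * card W"
      using AB by (auto simp: balanced_separation_def)
    have finA: "finite A" and finB: "finite B" using finW W by auto
    define a b where "a = real (card A)" and "b = real (card B)"
    have dA: "card A = card (A - B) + card (A \<inter> B)" and dB: "card B = card (B - A) + card (A \<inter> B)"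
      using finA finB by (metis card_Diff_subset_Int card_Int_Diff finite_Int Int_commute add.commute)+
    have "card W = card (A - B) + card B"
      using finA finB W card_Un_disjoint[of "A - B" B] by (simp add: Un_Diff_cancel2 Un_commute Diff_disjoint Int_commute)
    then have ab: "n \<le> a + b" "a + b \<le> n + s" using dA cs unfolding n_def a_def b_def by linarith+
    \<comment> \<open>\<open>n > r \<ge> (20 * c)^2\<close> keeps the separator within
      \<open>n / 20\<close>. Both sides are then smaller than \<open>W\<close> and have at least
      \<open>n / 4 > r / 4\<close> vertices, as the induction hypothesis demands.\<close>
    have "20 * c \<le> sqrt n" using sr real_sqrt_le_mono[of r n] rn by linarith
    then have "20 * c * sqrt n \<le> sqrt n * sqrt n" using npos by (intro mult_right_mono) auto
    then have s': "20 * real s \<le> n" using s sqn by linarith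
    have a4: "n / 4 \<le> a" and b4: "n / 4 \<le> b" and an: "a < n" and bn: "b < n"
      using cA cB dA dB cs ab s' npos unfolding n_def a_def b_def by linarith+
    have "card A < card W" "card B < card W" using an bn unfolding n_def a_def b_def by linarith+
    moreover have "A \<subseteq> V" "B \<subseteq> V" using W less.prems(1) by auto
    moreover have "r \<le> 4 * card A" "r \<le> 4 * card B"
      using a4 b4 rn unfolding n_def a_def b_def by linarith+
    ultimately obtain \<P> \<Q> where P: "division E A r \<P>" "division E B r \<Q>"
      and sP: "real (\<Sum>P\<leftarrow>\<P>. card P) \<le> a + 20 * c * a / sqrt r - 10 * c * sqrt a"
      and sQ: "real (\<Sum>P\<leftarrow>\<Q>. card P) \<le> b + 20 * c * b / sqrt r - 10 * c * sqrt b"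
      using less.hyps[of A] less.hyps[of B] unfolding a_def b_def by blast
    \<comment> \<open>Of the \<open>12 * c * sqrt n\<close> gained, 10 parts restore the claim, one
      pays for the at most \<open>c * sqrt n\<close> duplicated vertices, and one for their share in
      the linear term, since \<open>20 * c / sqrt r \<le> 1\<close>.\<close>
    have "10 * c * (6 / 5 * sqrt n) \<le> 10 * c * (sqrt a + sqrt b)"
      using sqrt_split_gain[OF a4 b4 ab(1)] npos assms(1) by (intro mult_left_mono) auto
    then have gain: "12 * c * sqrt n \<le> 10 * c * sqrt a + 10 * c * sqrt b"
      by (simp add: algebra_simps)
    have "20 * c * (a + b) \<le> 20 * c * (n + c * sqrt n)"
      using ab s assms(1) by (intro mult_left_mono) auto
    then have "20 * c * (a + b) / sqrt r \<le> 20 * c * (n + c * sqrt n) / sqrt r"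
      using rpos by (intro divide_right_mono) auto
    also have "\<dots> = 20 * c * n / sqrt r + 20 * c / sqrt r * (c * sqrt n)"
      by (simp add: field_simps add_divide_distrib)
    also have "\<dots> \<le> 20 * c * n / sqrt r + 1 * (c * sqrt n)"
      using sr rpos npos assms(1) by (intro add_left_mono mult_right_mono) auto
    finally have "20 * c * a / sqrt r + 20 * c * b / sqrt r \<le> 20 * c * n / sqrt r + c * sqrt n"
      by (simp add: ring_distribs add_divide_distrib)
    then have "real (\<Sum>P\<leftarrow>\<P> @ \<Q>. card P) \<le> n + 20 * c * n / sqrt r - 10 * c * sqrt n"
      using sP sQ gain ab s by simp
    then show ?thesis using division_append[OF P AB assms(2)] unfolding n_def by blast
  qed
qed

definition has_clique_model :: "('a \<times> 'a) set \<Rightarrow> 'a set \<Rightarrow> nat \<Rightarrow> bool" where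
  "has_clique_model E V h \<longleftrightarrow> (\<exists>\<C>. clique_model E V \<C> \<and> card \<C> = h)"

text \<open>\<open>M\<close> is \<open>sqrt (h * card V)\<close> rounded up, plus 1 to be positive
  even for \<open>h = 0\<close>. The product \<open>(h + 1) * M\<close> is then estimated crudely by
  \<open>sqrt h \<le> h\<close> and \<open>1 \<le> sqrt (card V)\<close>.\<close>

lemma separation_of_no_clique_model:
  assumes "finite V" "sym E" "\<not> has_clique_model E V h" "V \<noteq> {}"
  shows "\<exists>s A B. balanced_separation E V s A B \<and> real s \<le> 2 * (real h + 1)\<^sup>2 * sqrt (card V)"
proof -
  define M where "M = nat \<lceil>sqrt (real h * card V)\<rceil> + 1"
  have Ms: "sqrt (real h * card V) \<le> real M" by (simp add: M_def) linarith
  have "real h * card V = (sqrt (real h * card V))\<^sup>2" by simp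
  also have "\<dots> \<le> (real M)\<^sup>2" using Ms by (intro power_mono) auto
  finally have "real (h * card V) \<le> real (M * M)" by (simp add: power2_eq_square)
  then have hM: "h * card V \<le> M * M" by linarith
  have n1: "1 \<le> sqrt (card V)" using assms(1,4) by (simp add: Suc_le_eq card_gt_0_iff)
  have "real M \<le> sqrt (real h * card V) + 2" by (simp add: M_def) linarith
  also have "\<dots> = sqrt h * sqrt (card V) + 2" by (simp add: real_sqrt_mult)
  also have "\<dots> \<le> real h * sqrt (card V) + 2 * sqrt (card V)"
  proof (intro add_mono mult_right_mono)
    show "sqrt h \<le> real h"
      by (cases "h = 0") (auto intro!: real_le_lsqrt simp: power2_eq_square real_sqrt_le_iff)
  qed (use n1 in auto)
  also have "\<dots> \<le> 2 * (real h + 1) * sqrt (card V)" using n1 by (simp add: algebra_simps)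
  finally have "(real h + 1) * real M \<le> (real h + 1) * (2 * (real h + 1) * sqrt (card V))"
    by (intro mult_left_mono) auto
  then have "real (Suc h * M) \<le> 2 * (real h + 1)\<^sup>2 * sqrt (card V)"
    by (simp add: power2_eq_square algebra_simps)
  moreover have "0 < M" by (simp add: M_def)
  ultimately show ?thesis
    using clique_model_or_balanced_separation[OF assms(1,2) _ hM order_refl] assms(3)
    unfolding has_clique_model_def by blast
qed

lemma clique_model_mono:
  assumes "clique_model E W \<C>" "W \<subseteq> V"
  shows "clique_model E V \<C>"
proof -
  have "\<forall>C\<in>\<C>. C \<subseteq> V" using clique_modelD(2)[OF assms(1)] assms(2) by blast
  then show ?thesis using assms(1) unfolding clique_model_def by simp
qed

text \<open>Absence of a clique model passes to subsets of \<open>V\<close>, so each nonempty one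
  has a small separator. If \<open>r > 4 * card V\<close>, a single piece does.\<close>

theorem division_of_no_clique_model:
  fixes h :: nat
  defines "c \<equiv> 2 * (real h + 1)\<^sup>2"
  assumes "finite V" "sym E" "\<not> has_clique_model E V h" "400 * c\<^sup>2 \<le> real r"
  shows "\<exists>\<P>. division E V r \<P> \<and> real (\<Sum>P\<leftarrow>\<P>. card P) \<le> card V + 20 * c / sqrt r * card V"
proof (cases "r \<le> 4 * card V")
  case True
  have c: "0 < c" by (simp add: c_def)
  have "\<exists>s A B. balanced_separation E W s A B \<and> real s \<le> c * sqrt (card W)"
    if "W \<subseteq> V" "W \<noteq> {}" for W
  proof -
    have "\<not> has_clique_model E W h"
      using assms(4) clique_model_mono[OF _ that(1)] unfolding has_clique_model_def by blast
    then show ?thesis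
      using separation_of_no_clique_model[of W E h] that assms(2,3) finite_subset
      unfolding c_def by blast
  qed
  from division_from_separations[OF c assms(3,5) this order_refl assms(2) True]
  obtain \<P> where "division E V r \<P>"
    "real (\<Sum>P\<leftarrow>\<P>. card P) \<le> card V + 20 * c * card V / sqrt r - 10 * c * sqrt (card V)"
    by blast
  moreover have "0 \<le> 10 * c * sqrt (card V)" using c by simp
  ultimately show ?thesis by (intro exI[of _ \<P>]) auto
next
  case False
  then have "division E V r [V]" by (auto simp: division_def)
  then show ?thesis by (intro exI[of _ "[V]"]) (auto simp: c_def)
qed

section \<open>From clique models to minors\<close>

text \<open>A stage on the way from a subgraph to \<open>H\<close>. Adjacency of branch sets is an
  equivalence rather than an implication, so that singleton branch sets leave a copy of
  \<open>H\<close> without surplus arcs.\<close>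

definition branch_sets :: "'a pair_pre_digraph \<Rightarrow> 'b pair_pre_digraph \<Rightarrow> ('b \<Rightarrow> 'a set) \<Rightarrow> bool" where
  "branch_sets K H B \<longleftrightarrow>
     finite (pverts K) \<and> pverts K = \<Union>(B ` pverts H) \<and>
     parcs K \<subseteq> pverts K \<times> pverts K \<and> irrefl (parcs K) \<and>
     (\<forall>x\<in>pverts H. B x \<noteq> {} \<and> conn (parcs K) (B x)) \<and>
     (\<forall>x\<in>pverts H. \<forall>y\<in>pverts H. x \<noteq> y \<longrightarrow>
        B x \<inter> B y = {} \<and> (adj (parcs K) (B x) (B y) \<longleftrightarrow> (x, y) \<in> parcs H))"

text \<open>An arc inside a fibre of \<open>f\<close> becomes a loop and is removed, but there the
  image path just stays in place.\<close>

lemma conn_image: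
  assumes "conn E F"
  shows "conn (map_prod f f ` E - Id) (f ` F)"
  unfolding conn_def
proof (intro ballI)
  fix x y assume "x \<in> f ` F" "y \<in> f ` F"
  then obtain u v where uv: "x = f u" "y = f v" "u \<in> F" "v \<in> F" by blast
  then have "(u, v) \<in> (E \<inter> F \<times> F)\<^sup>*" using assms unfolding conn_def by blast
  then have "(f u, f v) \<in> ((map_prod f f ` E - Id) \<inter> f ` F \<times> f ` F)\<^sup>*"
  proof (induction rule: rtrancl_induct)
    case (step y z)
    then have "(f y, f z) \<in> map_prod f f ` E" "f y \<in> f ` F" "f z \<in> f ` F" by force+
    then have "f y = f z \<or> (f y, f z) \<in> (map_prod f f ` E - Id) \<inter> f ` F \<times> f ` F" by blast
    then show ?case using step.IH by (metis rtrancl.rtrancl_into_rtrancl)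
  qed simp
  then show "(x, y) \<in> ((map_prod f f ` E - Id) \<inter> f ` F \<times> f ` F)\<^sup>*" using uv by simp
qed

text \<open>Only \<open>a\<close> and \<open>b\<close> are identified, and both lie in
  \<open>B x\<close>; so distinct branch sets stay disjoint and arcs between them keep their sides
  (\<open>inB\<close>).\<close>

lemma branch_sets_contract_edge:
  assumes mod: "branch_sets K H B" and x: "x \<in> pverts H" and ab: "a \<in> B x" "b \<in> B x"
  shows "branch_sets (contract_edge a b K) H (\<lambda>y. (\<lambda>z. if z = b then a else z) ` B y)"
proof -
  define f where "f = (\<lambda>z. if z = b then a else z)"
  have K: "contract_edge a b K = \<lparr>pverts = f ` pverts K, parcs = map_prod f f ` parcs K - Id\<rparr>"
    unfolding contract_edge_def f_def Let_def ..
  have fin: "finite (pverts K)" and V: "pverts K = \<Union>(B ` pverts H)"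
    and E: "parcs K \<subseteq> pverts K \<times> pverts K"
    and B: "\<And>y. y \<in> pverts H \<Longrightarrow> B y \<noteq> {}" "\<And>y. y \<in> pverts H \<Longrightarrow> conn (parcs K) (B y)"
    and dj: "\<And>y z. y \<in> pverts H \<Longrightarrow> z \<in> pverts H \<Longrightarrow> y \<noteq> z \<Longrightarrow> B y \<inter> B z = {}"
    and ad: "\<And>y z. y \<in> pverts H \<Longrightarrow> z \<in> pverts H \<Longrightarrow> y \<noteq> z \<Longrightarrow>
      adj (parcs K) (B y) (B z) \<longleftrightarrow> (y, z) \<in> parcs H"
    using mod unfolding branch_sets_def by blast+
  have inB: "z \<in> B y" if y: "y \<in> pverts H" and z: "f z \<in> f ` B y" for y z
  proof -
    obtain w where w: "w \<in> B y" "f z = f w" using z by blast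
    have "z = w \<or> z \<in> {a, b} \<and> w \<in> {a, b}"
      using w(2) unfolding f_def by (cases "z = b"; cases "w = b"; simp)
    then show ?thesis
    proof
      assume zw: "z \<in> {a, b} \<and> w \<in> {a, b}"
      then have "w \<in> B x" using ab by blast
      then have "x = y" using dj[OF x y] w(1) by blast
      then show ?thesis using zw ab by blast
    qed (use w in simp)
  qed
  have dj': "f ` B y \<inter> f ` B z = {}" if "y \<in> pverts H" "z \<in> pverts H" "y \<noteq> z" for y z
    using inB[OF that(1)] inB[OF that(2)] dj[OF that] by blast
  have ad': "adj (map_prod f f ` parcs K - Id) (f ` B y) (f ` B z) \<longleftrightarrow> (y, z) \<in> parcs H"
    if yz: "y \<in> pverts H" "z \<in> pverts H" "y \<noteq> z" for y z
  proof -
    have "adj (map_prod f f ` parcs K - Id) (f ` B y) (f ` B z) \<longleftrightarrow> adj (parcs K) (B y) (B z)"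
    proof
      assume "adj (map_prod f f ` parcs K - Id) (f ` B y) (f ` B z)"
      then obtain s t where st: "s \<in> f ` B y" "t \<in> f ` B z" "(s, t) \<in> map_prod f f ` parcs K - Id"
        unfolding adj_def by (elim bexE)
      from DiffD1[OF st(3)] obtain p q where "s = f p" "t = f q" "(p, q) \<in> parcs K" by auto
      moreover from this have "p \<in> B y" "q \<in> B z"
        using inB[OF yz(1), of p] inB[OF yz(2), of q] st(1,2) by simp_all
      ultimately show "adj (parcs K) (B y) (B z)" unfolding adj_def by (intro bexI)
    next
      assume "adj (parcs K) (B y) (B z)"
      then obtain p q where pq: "p \<in> B y" "q \<in> B z" "(p, q) \<in> parcs K" unfolding adj_def by blast
      then have "f p \<noteq> f q" using dj'[OF yz] by (metis disjoint_iff imageI)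
      moreover have "(f p, f q) \<in> map_prod f f ` parcs K" using pq(3) by force
      ultimately show "adj (map_prod f f ` parcs K - Id) (f ` B y) (f ` B z)"
        using pq unfolding adj_def by blast
    qed
    then show ?thesis using ad[OF yz] by simp
  qed
  have "map_prod f f ` parcs K - Id \<subseteq> f ` pverts K \<times> f ` pverts K" using E by auto
  moreover have "irrefl (map_prod f f ` parcs K - Id)" by (auto simp: irrefl_def)
  moreover have img: "f ` pverts K = \<Union>((\<lambda>y. f ` B y) ` pverts H)" unfolding V by blast
  moreover have "finite (\<Union>((\<lambda>y. f ` B y) ` pverts H))"
    unfolding img[symmetric] using fin by (rule finite_imageI)
  ultimately show ?thesis
    unfolding branch_sets_def K f_def[symmetric] pair_pre_digraph.simps
    using fin B(1) conn_image[OF B(2)] dj' ad' by (intro conjI ballI impI) simp_all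
qed

text \<open>A connected branch set with two vertices contains an arc, and contracting it removes a
  vertex; so the process ends with singletons.\<close>

lemma branch_sets_contract:
  assumes "branch_sets K H B" "contracts_to S K"
  shows "\<exists>K' B'. contracts_to S K' \<and> branch_sets K' H B' \<and> (\<forall>x\<in>pverts H. is_singleton (B' x))"
  using assms
proof (induction "card (pverts K)" arbitrary: K B rule: less_induct)
  case less
  show ?case
  proof (cases "\<forall>x\<in>pverts H. is_singleton (B x)")
    case False
    then obtain x where x: "x \<in> pverts H" "\<not> is_singleton (B x)" by blast
    have Bx: "B x \<noteq> {}" "conn (parcs K) (B x)" "B x \<subseteq> pverts K" and irr: "irrefl (parcs K)"
      and fin: "finite (pverts K)"
      using less.prems(1) x(1) by (auto simp: branch_sets_def)
    obtain u where u: "u \<in> B x" using Bx(1) by blast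
    obtain v where v: "v \<in> B x" "v \<noteq> u"
      using x(2) u is_singletonI'[of "B x"] by blast
    have "(u, v) \<in> (parcs K \<inter> B x \<times> B x)\<^sup>*" using Bx(2) u v unfolding conn_def by blast
    then obtain w where w: "(u, w) \<in> parcs K" "w \<in> B x"
      using v(2) by (auto elim: converse_rtranclE)
    have uw: "u \<noteq> w" using w(1) irr by (auto simp: irrefl_def)
    let ?K = "contract_edge u w K"
    have "pverts ?K = pverts K - {w}"
      using u uw Bx(3) by (auto simp: contract_edge_def Let_def)
    then have "card (pverts ?K) < card (pverts K)"
      using w(2) Bx(3) fin by (metis card_Diff1_less subsetD)
    then show ?thesis
      using less.hyps[OF _ branch_sets_contract_edge[OF less.prems(1) x(1) u w(2)]
        contracts_to.step[OF less.prems(2) w(1)]] by blast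
  qed (use less.prems in blast)
qed

lemma digraph_iso_of_singletons:
  assumes mod: "branch_sets K H B" and single: "\<forall>x\<in>pverts H. is_singleton (B x)" and "pair_graph H"
  shows "digraph_iso (with_proj K) (with_proj H)"
proof -
  interpret H: pair_graph H by fact
  define b where "b x = the_elem (B x)" for x
  have b: "B x = {b x}" if "x \<in> pverts H" for x
    using single that unfolding b_def by (simp add: is_singleton_the_elem)
  have V: "pverts K = b ` pverts H" using mod b by (auto simp: branch_sets_def)
  have inj: "inj_on b (pverts H)"
    using mod b by (intro inj_onI) (metis branch_sets_def disjoint_insert(1) insertI1)
  have E: "(b x, b y) \<in> parcs K \<longleftrightarrow> (x, y) \<in> parcs H" if "x \<in> pverts H" "y \<in> pverts H" for x y
  proof (cases "x = y")
    case True
    then show ?thesis using mod H.no_loops' by (auto simp: branch_sets_def irrefl_def)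
  next
    case False
    then have "adj (parcs K) (B x) (B y) \<longleftrightarrow> (x, y) \<in> parcs H"
      using mod that by (simp add: branch_sets_def)
    then show ?thesis using b that by (simp add: adj_def)
  qed
  have wfK: "parcs K \<subseteq> pverts K \<times> pverts K" using mod unfolding branch_sets_def by blast
  define g where "g = the_inv_into (pverts H) b"
  have gb: "g (b x) = x" if "x \<in> pverts H" for x using that inj by (simp add: g_def the_inv_into_f_f)
  have gV: "g ` pverts K = pverts H" using gb by (force simp: V image_image)
  have ginj: "inj_on g (pverts K)" using gb by (auto simp: V inj_on_def)
  have gE: "map_prod g g ` parcs K = parcs H"
  proof (intro equalityI subsetI)
    fix e assume "e \<in> map_prod g g ` parcs K"
    then obtain p q where pq: "e = (g p, g q)" "(p, q) \<in> parcs K" by auto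
    then have "p \<in> b ` pverts H" "q \<in> b ` pverts H" using wfK V by auto
    then show "e \<in> parcs H" using pq gb E by auto
  next
    fix e assume e: "e \<in> parcs H"
    obtain x y where xy: "e = (x, y)" by (cases e)
    have "x \<in> pverts H" "y \<in> pverts H" using e xy H.wellformed' by auto
    then have "(b x, b y) \<in> parcs K" "e = map_prod g g (b x, b y)" using e xy gb E by auto
    then show "e \<in> map_prod g g ` parcs K" by (rule rev_image_eqI)
  qed
  have ginj2: "inj_on (map_prod g g) (parcs K)"
    using map_prod_inj_on[OF ginj ginj] wfK by (rule inj_on_subset)
  define f where "f = \<lparr>iso_verts = g, iso_arcs = map_prod g g, iso_head = snd, iso_tail = fst\<rparr>"
  have "wf_digraph (with_proj K)" using wfK by unfold_locales auto
  then have "pre_digraph.digraph_isomorphism (with_proj K) f"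
    using ginj ginj2 by (auto simp: pre_digraph.digraph_isomorphism_def f_def)
  moreover have "with_proj H = app_iso f (with_proj K)"
    using gV gE by (simp add: app_iso_def f_def with_proj_def)
  ultimately show ?thesis unfolding digraph_iso_def by blast
qed

text \<open>Assign the branch sets to the vertices of \<open>H\<close> by any bijection and delete
  the arcs between sets whose vertices are not adjacent in \<open>H\<close>. Contracting each set to
  a point leaves \<open>H\<close>.\<close>

theorem is_minor_of_clique_model:
  assumes "pair_graph G" "pair_graph H" "has_clique_model (parcs G) (pverts G) (card (pverts H))"
  shows "is_minor H G"
proof -
  interpret G: pair_graph G by fact
  interpret H: pair_graph H by fact
  obtain \<C> where mod: "clique_model (parcs G) (pverts G) \<C>" and card: "card \<C> = card (pverts H)"
    using assms(3) by (auto simp: has_clique_model_def)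
  note D = clique_modelD[OF mod]
  obtain B where bij: "bij_betw B (pverts H) \<C>"
    using finite_same_card_bij[OF H.pair_finite_verts D(1)] card by auto
  have BC: "B x \<in> \<C>" if "x \<in> pverts H" for x using bij_betwE[OF bij] that by blast
  have Bne: "B x \<noteq> B y" if "x \<in> pverts H" "y \<in> pverts H" "x \<noteq> y" for x y
    using bij that by (auto simp: bij_betw_def inj_on_def)
  have dj: "B x \<inter> B y = {}" if "x \<in> pverts H" "y \<in> pverts H" "x \<noteq> y" for x y
    using D(5)[OF BC[OF that(1)] BC[OF that(2)] Bne[OF that]] .
  define S where "S = \<lparr>pverts = \<Union>(B ` pverts H), parcs = {(u, v) \<in> parcs G. \<exists>x\<in>pverts H. \<exists>y\<in>pverts H.
    u \<in> B x \<and> v \<in> B y \<and> (x = y \<or> (x, y) \<in> parcs H)}\<rparr>"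
  have sub: "pverts S \<subseteq> pverts G" "parcs S \<subseteq> parcs G"
    using D(2) BC by (auto simp: S_def)
  have wf: "parcs S \<subseteq> pverts S \<times> pverts S" by (auto simp: S_def)
  have fin: "finite (pverts S)" "finite (parcs S)"
    using sub G.pair_finite_verts G.pair_finite_arcs finite_subset by blast+
  have nol: "u \<noteq> v" if "(u, v) \<in> parcs S" for u v using sub that G.no_loops' by blast
  have "sym (parcs S)"
    unfolding sym_def
  proof (intro allI impI)
    fix u v assume "(u, v) \<in> parcs S"
    then obtain x y where "(u, v) \<in> parcs G" "x \<in> pverts H" "y \<in> pverts H" "u \<in> B x" "v \<in> B y"
      "x = y \<or> (x, y) \<in> parcs H"
      unfolding S_def by auto
    moreover from this have "(v, u) \<in> parcs G" "y = x \<or> (y, x) \<in> parcs H"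
      using G.arcs_symmetric H.arcs_symmetric by blast+
    ultimately show "(v, u) \<in> parcs S" unfolding S_def by auto
  qed
  then have pgS: "pair_graph S"
    using wf fin nol by unfold_locales (auto simp: symmetric_def)
  have sg: "subgraph (with_proj S) (with_proj G)"
  proof -
    interpret S: pair_graph S by fact
    show ?thesis
      using sub by (simp add: subgraph_def compatible_def G.wf_digraph_axioms S.wf_digraph_axioms)
  qed
  have "branch_sets S H B"
    unfolding branch_sets_def
  proof (intro conjI ballI impI)
    show "finite (pverts S)" "parcs S \<subseteq> pverts S \<times> pverts S" by fact+
    show "pverts S = \<Union>(B ` pverts H)" by (simp add: S_def)
    show "irrefl (parcs S)" using nol by (auto simp: irrefl_def)
    fix x assume x: "x \<in> pverts H"
    show "B x \<noteq> {}" using D(3)[OF BC[OF x]] .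
    have "parcs G \<inter> B x \<times> B x = parcs S \<inter> B x \<times> B x"
      using x by (auto simp: S_def)
    then show "conn (parcs S) (B x)" using D(4)[OF BC[OF x]] by (simp add: conn_def)
    fix y assume y: "y \<in> pverts H" and ne: "x \<noteq> y"
    show "B x \<inter> B y = {}" using dj[OF x y ne] .
    show "adj (parcs S) (B x) (B y) \<longleftrightarrow> (x, y) \<in> parcs H"
    proof
      assume "adj (parcs S) (B x) (B y)"
      then obtain u v x' y' where "u \<in> B x" "v \<in> B y" "x' \<in> pverts H" "y' \<in> pverts H"
        "u \<in> B x'" "v \<in> B y'" "x' = y' \<or> (x', y') \<in> parcs H"
        by (auto simp: adj_def S_def)
      moreover from this have "x' = x" "y' = y" using dj x y by blast+
      ultimately show "(x, y) \<in> parcs H" using ne by blast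
    next
      assume "(x, y) \<in> parcs H"
      moreover have "adj (parcs G) (B x) (B y)" using D(6)[OF BC[OF x] BC[OF y] Bne[OF x y ne]] .
      ultimately show "adj (parcs S) (B x) (B y)" using x y unfolding adj_def S_def by auto
    qed
  qed
  from branch_sets_contract[OF this contracts_to.refl] obtain K B' where
    "contracts_to S K" "branch_sets K H B'" "\<forall>x\<in>pverts H. is_singleton (B' x)" by blast
  then show ?thesis
    unfolding is_minor_def using pgS sg digraph_iso_of_singletons[OF _ _ assms(2)] by blast
qed

section \<open>Locally optimal dominating sets\<close>

definition dominates :: "('a \<times> 'a) set \<Rightarrow> 'a set \<Rightarrow> 'a set \<Rightarrow> bool" where
  "dominates E V X \<longleftrightarrow> X \<subseteq> V \<and> (\<forall>v\<in>V - X. \<exists>w\<in>X. (v, w) \<in> E)"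

text \<open>Each \<open>v\<close> is thought of as contracted into \<open>c v\<close>. An arc
  requires a vertex of one cell adjacent to the other representative itself, so up to loops this is
  a subgraph of the full contraction; it suffices to witness domination.\<close>

definition quotient :: "('a \<times> 'a) set \<Rightarrow> 'a set \<Rightarrow> ('a \<Rightarrow> 'a) \<Rightarrow> 'a set \<Rightarrow> ('a \<times> 'a) set" where
  "quotient E V c S = {(x, y) \<in> S \<times> S. \<exists>v\<in>V. c v = x \<and> (v, y) \<in> E \<or> c v = y \<and> (v, x) \<in> E}"

lemma sym_quotient: "sym (quotient E V c S)"
  by (auto simp: quotient_def sym_def)

text \<open>A branch set is pulled back to the union of its cells. A cell is spanned by a star
  around its representative, hence connected, and a quotient arc comes from an arc joining the two
  cells.\<close>

lemma clique_model_of_quotient: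
  assumes "sym E" "S \<subseteq> V" and cS: "\<And>s. s \<in> S \<Longrightarrow> c s = s"
    and cE: "\<And>v. v \<in> V - S \<Longrightarrow> c v \<in> S \<and> (v, c v) \<in> E"
    and mod: "clique_model (quotient E V c S) S \<C>"
  shows "\<exists>\<D>. clique_model E V \<D> \<and> card \<D> = card \<C>"
proof -
  note D = clique_modelD[OF mod]
  define p where "p C = {v \<in> V. c v \<in> C}" for C
  have sub: "C \<subseteq> p C" if "C \<in> \<C>" for C
  proof
    fix x assume x: "x \<in> C"
    then have "x \<in> S" using D(2)[OF that] by blast
    then show "x \<in> p C" using cS[of x] x assms(2) unfolding p_def by auto
  qed
  have disj: "p C \<inter> p B = {}" if "C \<in> \<C>" "B \<in> \<C>" "C \<noteq> B" for B C
    using D(5)[OF that] unfolding p_def by blast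
  have ne: "p C \<noteq> {}" if "C \<in> \<C>" for C using sub[OF that] D(3)[OF that] by blast
  have inj: "inj_on p \<C>"
    using disj ne by (intro inj_onI) (metis Int_absorb)
  have step: "adj E (p B) (p C)" if BC: "B \<in> \<C>" "C \<in> \<C>" "B \<noteq> C" for B C
  proof -
    obtain x y where xy: "x \<in> B" "y \<in> C" "(x, y) \<in> quotient E V c S"
      using D(6)[OF BC] unfolding adj_def by blast
    then obtain v where v: "v \<in> V" "c v = x \<and> (v, y) \<in> E \<or> c v = y \<and> (v, x) \<in> E"
      unfolding quotient_def by blast
    from v(2) show ?thesis
    proof
      assume *: "c v = x \<and> (v, y) \<in> E"
      then have "v \<in> p B" "y \<in> p C" using v(1) xy sub[OF BC(2)] unfolding p_def by auto
      with * show ?thesis unfolding adj_def by blast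
    next
      assume *: "c v = y \<and> (v, x) \<in> E"
      then have "v \<in> p C" "x \<in> p B" using v(1) xy sub[OF BC(1)] unfolding p_def by auto
      moreover have "(x, v) \<in> E" using * assms(1) by (auto simp: sym_def)
      ultimately show ?thesis unfolding adj_def by blast
    qed
  qed
  have conn: "conn E (p C)" if C: "C \<in> \<C>" for C
  proof -
    obtain x0 where x0: "x0 \<in> C" using D(3)[OF C] by blast
    let ?R = "(E \<inter> p C \<times> p C)\<^sup>*"
    have CS: "C \<subseteq> S" using D(2)[OF C] .
    have cell: "(c v, v) \<in> ?R \<and> (v, c v) \<in> ?R" if "v \<in> p C" for v
    proof (cases "v \<in> S")
      case False
      then have "(v, c v) \<in> E" "c v \<in> p C"
        using that cE[of v] sub[OF C] unfolding p_def by auto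
      then have "(v, c v) \<in> E \<inter> p C \<times> p C" "(c v, v) \<in> E \<inter> p C \<times> p C"
        using that assms(1) unfolding sym_def by auto
      then show ?thesis by blast
    qed (simp add: cS)
    have reach: "(x0, x) \<in> ?R" if "x \<in> C" for x
    proof -
      have "(x0, x) \<in> (quotient E V c S \<inter> C \<times> C)\<^sup>*"
        using D(4)[OF C] x0 that unfolding conn_def by blast
      then show ?thesis
      proof (induction rule: rtrancl_induct)
        case (step y z)
        then have yz: "y \<in> C" "z \<in> C" "y \<in> p C" "z \<in> p C" using sub[OF C] by auto
        from step obtain v where v: "v \<in> V" "c v = y \<and> (v, z) \<in> E \<or> c v = z \<and> (v, y) \<in> E"
          unfolding quotient_def by blast
        then have vp: "v \<in> p C" using yz unfolding p_def by auto
        have "(y, z) \<in> ?R" using v(2)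
        proof
          assume *: "c v = y \<and> (v, z) \<in> E"
          then have "(v, z) \<in> ?R" using vp yz by auto
          then show ?thesis using cell[OF vp] * by (metis rtrancl_trans)
        next
          assume *: "c v = z \<and> (v, y) \<in> E"
          then have "(y, v) \<in> ?R" using vp yz assms(1) by (auto simp: sym_def)
          then show ?thesis using cell[OF vp] * by (metis rtrancl_trans)
        qed
        then show ?case using step.IH by (metis rtrancl_trans)
      qed simp
    qed
    show ?thesis
    proof (rule conn_from_root[OF assms(1)])
      show "x0 \<in> p C" using x0 sub[OF C] by blast
      fix y assume y: "y \<in> p C"
      then have "c y \<in> C" by (simp add: p_def)
      then show "(x0, y) \<in> ?R" using reach cell[OF y] by (metis rtrancl_trans)
    qed
  qed
  have "clique_model E V (p ` \<C>)"
  proof (rule clique_modelI)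
    show "finite (p ` \<C>)" using D(1) by simp
    fix B assume "B \<in> p ` \<C>"
    then obtain B' where B: "B = p B'" "B' \<in> \<C>" by blast
    show "B \<subseteq> V" unfolding B p_def by blast
    show "B \<noteq> {}" using ne[OF B(2)] B(1) by simp
    show "conn E B" using conn[OF B(2)] B(1) by simp
    fix C assume "C \<in> p ` \<C>" "B \<noteq> C"
    then obtain C' where C: "C = p C'" "C' \<in> \<C>" "B' \<noteq> C'" using B by blast
    show "B \<inter> C = {}" using disj[OF B(2) C(2,3)] B C by simp
    show "adj E B C" using step[OF B(2) C(2,3)] B C by simp
  qed
  then show ?thesis using card_image[OF inj] by blast
qed

section \<open>Double counting and the exchange argument\<close>

lemma card_Int_Collect_eq_sum:
  assumes "finite B"
  shows "card (B \<inter> {x. Q x}) = (\<Sum>x\<in>B. if Q x then 1 else 0)"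
  using sum.inter_restrict[OF assms, of "\<lambda>_. 1 :: nat" "{x. Q x}"] by simp

lemma sum_card_Int_pieces:
  fixes n :: nat
  assumes "finite A"
  shows "(\<Sum>i<n. card (A \<inter> p i)) = (\<Sum>v\<in>A. card {i. i < n \<and> v \<in> p i})"
proof -
  have "(\<Sum>i<n. card (A \<inter> p i)) = (\<Sum>i<n. \<Sum>v\<in>A. if v \<in> p i then 1 else 0)"
    using card_Int_Collect_eq_sum[OF assms, of "\<lambda>v. v \<in> p _"] by (intro sum.cong) auto
  also have "\<dots> = (\<Sum>v\<in>A. \<Sum>i<n. if v \<in> p i then 1 else 0)" by (rule sum.swap)
  also have "\<dots> = (\<Sum>v\<in>A. card {i. i < n \<and> v \<in> p i})"
    using card_Int_Collect_eq_sum[OF finite_lessThan[of n], of "\<lambda>i. _ \<in> p i"]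
    by (simp add: Int_def)
  finally show ?thesis .
qed

text \<open>Both dominating sets are compared in the exchange graph on \<open>L \<union> X\<close>, a minor of the given graph
  in which every vertex \<open>v\<close> of the given graph is witnessed by an edge (or a common vertex)
  between a dominator of \<open>v\<close> in \<open>L\<close> and one in \<open>X\<close>. A piece \<open>P\<close> of a division yields
  the exchange of those vertices of \<open>L\<close> that lie in no other piece for \<open>X \<inter> P\<close>.\<close>

theorem local_optimum_dominating:
  fixes h :: nat
  defines "c \<equiv> 2 * (real h + 1)\<^sup>2"
  assumes fin: "finite V" and sym: "sym E" and noh: "\<not> has_clique_model E V h"
    and r: "400 * c\<^sup>2 \<le> real r" and L: "dominates E V L" and X: "dominates E V X"
    and opt: "\<And>Y. dominates E V Y \<Longrightarrow> card ((L - Y) \<union> (Y - L)) \<le> r \<Longrightarrow> card L \<le> card Y"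
  shows "real (card L) \<le> card X + 40 * c / sqrt r * (card L + card X)"
proof -
  define S where "S = L \<union> X"
  have LV: "L \<subseteq> V" and XV: "X \<subseteq> V" using L X by (auto simp: dominates_def)
  then have SV: "S \<subseteq> V" by (auto simp: S_def)
  have finS: "finite S" "finite L" "finite X" using SV LV XV fin by (auto intro: finite_subset)
  \<comment> \<open>Each vertex outside \<open>L \<union> X\<close> is contracted into one of its
    dominators in \<open>L\<close>.\<close>
  define f where "f v = (if v \<in> S then v else SOME l. l \<in> L \<and> (v, l) \<in> E)" for v
  have fS: "f s = s" if "s \<in> S" for s using that by (simp add: f_def)
  have fE: "f v \<in> L \<and> (v, f v) \<in> E" if "v \<in> V - S" for v
  proof -
    have "\<exists>l. l \<in> L \<and> (v, l) \<in> E" using L that unfolding dominates_def S_def by blast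
    from someI_ex[OF this] show ?thesis using that by (simp add: f_def)
  qed
  define F where "F = quotient E V f S"
  have edge: "\<exists>l\<in>L. \<exists>x\<in>X. (l = v \<or> (v, l) \<in> E) \<and> (x = v \<or> (v, x) \<in> E) \<and> (l = x \<or> (l, x) \<in> F)"
    if v: "v \<in> V" for v
  proof -
    obtain l where l: "l \<in> L" "l = v \<or> (v, l) \<in> E" using L v unfolding dominates_def by blast
    obtain x where x: "x \<in> X" "x = v \<or> (v, x) \<in> E" using X v unfolding dominates_def by blast
    have xS: "x \<in> S" and lS: "l \<in> S" using x l by (auto simp: S_def)
    consider "v \<in> L" "v \<in> X" | "v \<in> L" "v \<notin> X" | "v \<notin> L" "v \<in> X" | "v \<notin> S" by (auto simp: S_def)
    then show ?thesis
    proof cases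
      case 2
      then have vS: "v \<in> S" "(v, x) \<in> E" using x by (auto simp: S_def)
      then have "(v, x) \<in> F" using fS[of v] v xS unfolding F_def quotient_def by blast
      then show ?thesis using 2 x by blast
    next
      case 3
      then have vS: "v \<in> S" "(v, l) \<in> E" using l by (auto simp: S_def)
      then have "(l, v) \<in> F" using fS[of v] v lS unfolding F_def quotient_def by blast
      then show ?thesis using 3 l by blast
    next
      \<comment> \<open>As dominator in \<open>L\<close> the representative \<open>f v\<close> is
        taken: then \<open>v\<close> itself witnesses the arc from \<open>f v\<close> to its
        dominator in \<open>X\<close>.\<close>
      case 4
      then have fv: "f v \<in> L" "(v, f v) \<in> E" using fE[of v] v by auto
      moreover have "(v, x) \<in> E" using 4 x(2) xS by blast
      moreover from this have "(f v, x) \<in> F"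
        using v xS fv unfolding F_def quotient_def S_def by blast
      ultimately show ?thesis using x(1) by blast
    qed blast
  qed
  have "\<not> has_clique_model F S h"
  proof
    assume "has_clique_model F S h"
    then obtain \<C> where "clique_model F S \<C>" "card \<C> = h" unfolding has_clique_model_def by blast
    moreover have "f v \<in> S \<and> (v, f v) \<in> E" if "v \<in> V - S" for v
      using fE[OF that] by (simp add: S_def)
    ultimately show False
      using clique_model_of_quotient[OF sym SV fS] noh unfolding F_def has_clique_model_def by metis
  qed
  then obtain \<P> where div: "division F S r \<P>"
    and sumP: "real (\<Sum>P\<leftarrow>\<P>. card P) \<le> card S + 20 * c / sqrt r * card S"
    using division_of_no_clique_model[OF finS(1) _ _ r[unfolded c_def], of F] sym_quotient
    unfolding F_def c_def by blast
  define n where "n = length \<P>"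
  define p where "p i = \<P> ! i" for i
  have pr: "p i \<subseteq> S" "card (p i) \<le> r" if "i < n" for i
    using div that nth_mem[of i \<P>] unfolding division_def n_def p_def by blast+
  have cover: "\<exists>i<n. v \<in> p i" if "v \<in> S" for v
    using div that unfolding division_def n_def p_def by (metis UnionE in_set_conv_nth)
  have pedge: "\<exists>i<n. u \<in> p i \<and> v \<in> p i" if "(u, v) \<in> F" for u v
  proof -
    have "u \<in> S" "v \<in> S" using that unfolding F_def quotient_def by auto
    with div that have "\<exists>P\<in>set \<P>. u \<in> P \<and> v \<in> P" by (simp add: division_def)
    then show ?thesis unfolding n_def p_def in_set_conv_nth Bex_def by blast
  qed
  define m where "m v = card {i. i < n \<and> v \<in> p i}" for v
  have m1: "1 \<le> m v" if v: "v \<in> S" for v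
  proof -
    have "{i. i < n \<and> v \<in> p i} \<noteq> {}" using cover[OF v] by blast
    then show ?thesis unfolding m_def by (simp add: Suc_le_eq card_gt_0_iff)
  qed
  \<comment> \<open>Only vertices lying in a single piece are ever given up; the number of the
    others is bounded by the overlap.\<close>
  define L1 where "L1 = {v \<in> L. m v = 1}"
  have exch: "card (L1 \<inter> p i) \<le> card (X \<inter> p i)" if i: "i < n" for i
  proof -
    define Y where "Y = (L - L1 \<inter> p i) \<union> (X \<inter> p i)"
    have YV: "Y \<subseteq> V" using LV XV by (auto simp: Y_def)
    have "\<exists>w\<in>Y. w = v \<or> (v, w) \<in> E" if v: "v \<in> V" for v
    proof -
      obtain l x where lx: "l \<in> L" "x \<in> X" "l = v \<or> (v, l) \<in> E" "x = v \<or> (v, x) \<in> E"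
        "l = x \<or> (l, x) \<in> F"
        using edge[OF v] by blast
      show ?thesis
      proof (cases "l \<in> L1 \<inter> p i")
        case True
        \<comment> \<open>The removed \<open>l\<close> lies in no other piece, so the piece
          containing its arc to \<open>x\<close> is \<open>p i\<close>, and \<open>x\<close> is
          among the inserted vertices.\<close>
        have "x \<in> p i"
        proof (cases "l = x")
          case False
          then obtain j where j: "j < n" "l \<in> p j" "x \<in> p j" using pedge lx(5) by blast
          have "card {i. i < n \<and> l \<in> p i} = 1" using True by (simp add: L1_def m_def)
          then obtain k where "{i. i < n \<and> l \<in> p i} = {k}" by (rule card_1_singletonE)
          then have "i = j" using True i j by (metis (mono_tags, lifting) IntD2 mem_Collect_eq singletonD)
          with j show ?thesis by simp
        qed (use True in auto)
        then show ?thesis using lx unfolding Y_def by blast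
      next
        case False
        then show ?thesis using lx unfolding Y_def by blast
      qed
    qed
    then have "dominates E V Y" using YV unfolding dominates_def by blast
    moreover have "card ((L - Y) \<union> (Y - L)) \<le> card (p i)"
      using pr[OF i] finS(1) by (intro card_mono) (auto simp: Y_def intro: finite_subset)
    ultimately have "card L \<le> card Y" using opt pr(2)[OF i] by simp
    also have "\<dots> \<le> card (L - L1 \<inter> p i) + card (X \<inter> p i)" unfolding Y_def by (rule card_Un_le)
    also have "card (L - L1 \<inter> p i) = card L - card (L1 \<inter> p i)"
      using finS(2) by (intro card_Diff_subset) (auto simp: L1_def)
    finally have "card L \<le> card L - card (L1 \<inter> p i) + card (X \<inter> p i)" .
    moreover have "card (L1 \<inter> p i) \<le> card L"
      using finS(2) by (intro card_mono) (auto simp: L1_def)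
    ultimately show ?thesis by linarith
  qed
  have finL1: "finite L1" using finS(2) by (simp add: L1_def)
  \<comment> \<open>Summed over all pieces, a vertex of \<open>L1\<close> counts once and a vertex
    \<open>v\<close> of \<open>X\<close> counts \<open>m v\<close> times.\<close>
  have "card L1 = (\<Sum>v\<in>L1. m v)" by (simp add: L1_def)
  also have "\<dots> = (\<Sum>i<n. card (L1 \<inter> p i))" unfolding m_def by (rule sum_card_Int_pieces[OF finL1, symmetric])
  also have "\<dots> \<le> (\<Sum>i<n. card (X \<inter> p i))" using exch by (intro sum_mono) auto
  also have "\<dots> = (\<Sum>v\<in>X. m v)" unfolding m_def by (rule sum_card_Int_pieces[OF finS(3)])
  finally have L1X: "card L1 \<le> (\<Sum>v\<in>X. m v)" .
  \<comment> \<open>Excess multiplicity. Its total is the overlap of the division and bounds both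
    the overcount of \<open>X\<close> and \<open>card (L - L1)\<close>; hence
    \<open>40 = 2 * 20\<close>.\<close>
  define e where "e v = m v - 1" for v
  have me: "m v = 1 + e v" if "v \<in> S" for v using m1[OF that] by (simp add: e_def)
  have "(\<Sum>P\<leftarrow>\<P>. card P) = (\<Sum>i<n. card (p i))"
    by (simp add: sum_list_sum_nth n_def p_def atLeast0LessThan)
  also have "\<dots> = (\<Sum>i<n. card (S \<inter> p i))"
    using pr(1) by (intro sum.cong) (auto simp: Int_absorb1)
  also have "\<dots> = (\<Sum>v\<in>S. m v)" unfolding m_def by (rule sum_card_Int_pieces[OF finS(1)])
  also have "\<dots> = (\<Sum>v\<in>S. 1 + e v)" using me by (intro sum.cong) auto
  also have "\<dots> = card S + (\<Sum>v\<in>S. e v)" by (simp only: sum.distrib) simp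
  finally have eS: "real (\<Sum>v\<in>S. e v) \<le> 20 * c / sqrt r * card S" using sumP by simp
  have "(\<Sum>v\<in>X. m v) = (\<Sum>v\<in>X. 1 + e v)" using me by (intro sum.cong) (auto simp: S_def)
  also have "\<dots> = card X + (\<Sum>v\<in>X. e v)" by (simp only: sum.distrib) simp
  also have "\<dots> \<le> card X + (\<Sum>v\<in>S. e v)"
    using finS(1) by (intro add_left_mono sum_mono2) (auto simp: S_def)
  finally have XeS: "card L1 \<le> card X + (\<Sum>v\<in>S. e v)" using L1X by linarith
  have "card (L - L1) = (\<Sum>v\<in>L - L1. 1)" by simp
  also have "\<dots> \<le> (\<Sum>v\<in>L - L1. e v)"
  proof (intro sum_mono)
    fix v assume v: "v \<in> L - L1"
    then have "m v \<noteq> 1" "1 \<le> m v" using m1[of v] by (auto simp: L1_def S_def)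
    then show "1 \<le> e v" by (simp add: e_def)
  qed
  also have "\<dots> \<le> (\<Sum>v\<in>S. e v)" using finS(1) by (intro sum_mono2) (auto simp: S_def)
  finally have LL1: "card (L - L1) \<le> (\<Sum>v\<in>S. e v)" .
  have "card L = card L1 + card (L - L1)"
    using finL1 finS(2) by (metis (no_types, lifting) L1_def add_diff_inverse_nat card_Diff_subset card_mono mem_Collect_eq not_le subsetI)
  then have "real (card L) \<le> card X + 2 * real (\<Sum>v\<in>S. e v)" using LL1 XeS by linarith
  also have "\<dots> \<le> card X + 2 * (20 * c / sqrt r * card S)" using eS by linarith
  also have "\<dots> \<le> card X + 2 * (20 * c / sqrt r * (card L + card X))"
    using card_Un_le[of L X] by (intro add_left_mono mult_left_mono) (auto simp: S_def c_def)
  finally show ?thesis by (simp add: algebra_simps)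
qed

text \<open>Since \<open>2 * d \<le> t/3\<close>, the hypothesis gives
  \<open>(1 - t/3) * l \<le> (1 + t/3) * x\<close>, and
  \<open>(1 - t/3) * (1 + t) \<ge> 1 + t/3\<close> for \<open>t\<close> between 0 and 1.\<close>

lemma near_optimal_ratio:
  fixes l x d t :: real
  assumes "l \<le> x + 2 * d * (l + x)" "0 \<le> x" "0 \<le> l" "6 * d \<le> t" "0 \<le> d" "t \<le> 1"
  shows "l \<le> (1 + t) * x"
proof -
  have t: "0 \<le> t" using assms(4,5) by linarith
  have "2 * d * (l + x) \<le> t / 3 * (l + x)" using assms by (intro mult_right_mono) auto
  then have "(1 - t / 3) * l \<le> (1 + t / 3) * x" using assms(1) by (simp add: algebra_simps)
  also have "\<dots> \<le> ((1 - t / 3) * (1 + t)) * x"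
  proof (intro mult_right_mono)
    have "t * t \<le> t * 1" using t assms(6) by (intro mult_left_mono) auto
    moreover have "(1 - t / 3) * (1 + t) = 1 + t * 2 / 3 - t * t / 3" by (simp add: field_simps)
    ultimately show "1 + t / 3 \<le> (1 - t / 3) * (1 + t)" by linarith
  qed (rule assms(2))
  finally have "(1 - t / 3) * l \<le> (1 - t / 3) * ((1 + t) * x)" by (simp only: mult.assoc)
  then show ?thesis using assms(6) by (simp add: mult_le_cancel_left)
qed

section \<open>Local search on index sets\<close>

definition flip :: "nat \<Rightarrow> nat set \<Rightarrow> nat set" where
  "flip d X = (X - {d}) \<union> ({d} - X)"

text \<open>A number \<open>c\<close> below \<open>b ^ k\<close> with \<open>b = Suc n\<close> encodes a set of at most \<open>k\<close> indices by its digits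
  in base \<open>b\<close>; toggling the digit \<open>n\<close> has no effect below \<open>n\<close>, so shorter lists can be padded.\<close>

primrec toggle_digits :: "nat \<Rightarrow> nat \<Rightarrow> nat \<Rightarrow> nat set \<Rightarrow> nat set" where
  "toggle_digits b 0 c X = X"
| "toggle_digits b (Suc j) c X = flip (c div b ^ j mod b) (toggle_digits b j c X)"

text \<open>\<open>a\<close> is the input memory, which holds the adjacency matrix row by
  row.\<close>

definition closed_nbr :: "(nat \<Rightarrow> nat) \<Rightarrow> nat \<Rightarrow> nat \<Rightarrow> nat \<Rightarrow> bool" where
  "closed_nbr a n v w \<longleftrightarrow> v = w \<or> a (v * n + w) \<noteq> 0"

definition dominates_below :: "(nat \<Rightarrow> nat) \<Rightarrow> nat \<Rightarrow> nat set \<Rightarrow> bool" where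
  "dominates_below a n X \<longleftrightarrow> (\<forall>v<n. \<exists>w<n. w \<in> X \<and> closed_nbr a n v w)"

text \<open>The set kept by the search may contain the dummy index \<open>n\<close>, which must not
  count.\<close>

definition card_below :: "nat \<Rightarrow> nat set \<Rightarrow> nat" where
  "card_below n X = card (X \<inter> {..<n})"

definition improve :: "(nat \<Rightarrow> nat) \<Rightarrow> nat \<Rightarrow> nat \<Rightarrow> nat \<Rightarrow> nat set \<Rightarrow> nat set" where
  "improve a n k c X =
     (let Y = toggle_digits (Suc n) k c X in if dominates_below a n Y \<and> card_below n Y < card_below n X then Y else X)"

text \<open>Codes are tried in descending order, as the loops of the machine count down.\<close>

primrec improves :: "(nat \<Rightarrow> nat) \<Rightarrow> nat \<Rightarrow> nat \<Rightarrow> nat \<Rightarrow> nat set \<Rightarrow> nat set" where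
  "improves a n k 0 X = X"
| "improves a n k (Suc j) X = improve a n k (Suc n ^ k - Suc j) (improves a n k j X)"

definition local_search :: "(nat \<Rightarrow> nat) \<Rightarrow> nat \<Rightarrow> nat \<Rightarrow> nat set" where
  "local_search a n k = (improves a n k (Suc n ^ k) ^^ Suc n) {..<n}"

lemma toggle_digits_iff:
  "x \<in> toggle_digits b k c X \<longleftrightarrow> (x \<in> X) \<noteq> (x \<in> toggle_digits b k c {})"
  by (induction k) (auto simp: flip_def)

lemma toggle_digits_involution: "toggle_digits b k c (toggle_digits b k c X) = X"
proof (rule set_eqI)
  fix x
  show "x \<in> toggle_digits b k c (toggle_digits b k c X) \<longleftrightarrow> x \<in> X"
    using toggle_digits_iff[of x b k c X] toggle_digits_iff[of x b k c "toggle_digits b k c X"] by blast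
qed

text \<open>Splits off the lowest digit, whereas the recursion of \<open>toggle_digits\<close>
  splits off the highest.\<close>

lemma toggle_digits_cong_mult:
  "0 < b \<Longrightarrow> d < b \<Longrightarrow> toggle_digits b (Suc k) (d + b * c) {} = flip d (toggle_digits b k c {})"
proof (induction k)
  case (Suc k)
  have "(d + b * c) div b ^ Suc k = c div b ^ k"
    using Suc.prems by (simp add: div_mult2_eq)
  then show ?case using Suc by (auto simp: flip_def)
qed simp

text \<open>Induction on \<open>k\<close> with an element of \<open>D\<close> as lowest digit; once
  \<open>D\<close> is exhausted the digit is \<open>n\<close>.\<close>

lemma toggle_digits_surj:
  assumes "D \<subseteq> {..<n}" "card D \<le> k"
  shows "\<exists>c < Suc n ^ k. toggle_digits (Suc n) k c {} \<inter> {..<n} = D"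
  using assms
proof (induction k arbitrary: D)
  case 0
  then have "D = {}" using finite_subset[of D "{..<n}"] by auto
  then show ?case by simp
next
  case (Suc k)
  have finD: "finite D" using Suc.prems(1) finite_subset by blast
  have bound: "d + Suc n * c < Suc n ^ Suc k" if "d < Suc n" "c < Suc n ^ k" for c d
  proof -
    have "d + Suc n * c < Suc n * Suc c" using that(1) by simp
    also have "\<dots> \<le> Suc n * Suc n ^ k" using that(2) by (intro mult_le_mono2) simp
    finally show ?thesis by simp
  qed
  show ?case
  proof (cases "D = {}")
    case True
    from Suc.IH[of "{}"] obtain c where c: "c < Suc n ^ k" "toggle_digits (Suc n) k c {} \<inter> {..<n} = {}"
      by auto
    have "toggle_digits (Suc n) (Suc k) (n + Suc n * c) {} \<inter> {..<n} = {}"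
      using toggle_digits_cong_mult[of "Suc n" n k c] c(2) by (auto simp: flip_def)
    then show ?thesis using bound[of n c] c(1) True by blast
  next
    case False
    then obtain d where d: "d \<in> D" by blast
    have "card (D - {d}) \<le> k" using Suc.prems(2) d finD by simp
    with Suc.IH[of "D - {d}"] Suc.prems(1) obtain c where
      c: "c < Suc n ^ k" "toggle_digits (Suc n) k c {} \<inter> {..<n} = D - {d}" by blast
    have dn: "d < n" using d Suc.prems(1) by blast
    have "toggle_digits (Suc n) (Suc k) (d + Suc n * c) {} = flip d (toggle_digits (Suc n) k c {})"
      using toggle_digits_cong_mult[of "Suc n" d k c] dn by simp
    moreover have "flip d (toggle_digits (Suc n) k c {}) \<inter> {..<n} = D"
      using c(2) d dn unfolding flip_def by blast
    ultimately show ?thesis using bound[of d c] c(1) dn by (metis less_Suc_eq)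
  qed
qed

lemma card_below_improve: "improve a n k c X = X \<or> card_below n (improve a n k c X) < card_below n X"
  by (auto simp: improve_def Let_def)

lemma card_below_improves_mono: "card_below n (improves a n k j X) \<le> card_below n X"
proof (induction j)
  case (Suc j)
  then show ?case using card_below_improve[of a n k "Suc n ^ k - Suc j" "improves a n k j X"] by auto
qed simp

text \<open>Every accepted exchange lowers \<open>card_below\<close>, so equal sizes at both ends
  mean that no round changed the set.\<close>

lemma improves_fixed:
  assumes "card_below n (improves a n k j X) = card_below n X" "i \<le> j"
  shows "improves a n k i X = X"
  using assms
proof (induction j arbitrary: i)
  case (Suc j)
  let ?Y = "improves a n k j X"
  have "card_below n ?Y \<le> card_below n X" by (rule card_below_improves_mono)
  moreover have "improves a n k (Suc j) X = ?Y \<or> card_below n (improves a n k (Suc j) X) < card_below n ?Y"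
    using card_below_improve by simp
  ultimately have "improves a n k (Suc j) X = ?Y" "card_below n ?Y = card_below n X" using Suc.prems(1) by auto
  then show ?case using Suc.IH[of i] Suc.IH[of j] Suc.prems(2) by (cases "i = Suc j") simp_all
qed simp

lemma dominates_below_local_search: "dominates_below a n (local_search a n k)"
proof -
  have "dominates_below a n (improves a n k j X)" if "dominates_below a n X" for j X
    using that by (induction j) (auto simp: improve_def Let_def)
  then have "dominates_below a n ((improves a n k (Suc n ^ k) ^^ j) {..<n})" for j
    by (induction j) (auto simp: dominates_below_def closed_nbr_def)
  then show ?thesis by (simp only: local_search_def)
qed

text \<open>The size starts at \<open>n\<close> and drops in every pass that changes the set, so one
  of the \<open>Suc n\<close> passes changes nothing; from then on the set stays the same.\<close>

lemma local_search_fixed: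
  "\<exists>X. local_search a n k = X \<and> card_below n (improves a n k (Suc n ^ k) X) = card_below n X"
proof -
  let ?f = "improves a n k (Suc n ^ k)"
  have *: "card_below n ((?f ^^ j) {..<n}) + j \<le> n \<or> (\<exists>i<j. card_below n (?f ((?f ^^ i) {..<n})) = card_below n ((?f ^^ i) {..<n}))"
    for j
  proof (induction j)
    case (Suc j)
    let ?X = "(?f ^^ j) {..<n}"
    have "card_below n (?f ?X) \<le> card_below n ?X" by (rule card_below_improves_mono)
    then show ?case using Suc less_Suc_eq by (auto simp del: improves.simps)
  qed (simp add: card_below_def)
  from *[of "Suc n"] obtain i where i: "i < Suc n" "card_below n (?f ((?f ^^ i) {..<n})) = card_below n ((?f ^^ i) {..<n})"
    by auto
  define X where "X = (?f ^^ i) {..<n}"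
  have fX: "?f X = X" using improves_fixed[OF i(2)] unfolding X_def by blast
  have "(?f ^^ (i + d)) {..<n} = X" for d
    using fX by (induction d) (simp_all add: X_def del: improves.simps)
  from this[of "Suc n - i"] have "local_search a n k = X" using i(1) by (simp add: local_search_def del: improves.simps funpow.simps)
  then show ?thesis using fX by (intro exI[of _ X]) simp
qed

text \<open>A pass that leaves \<open>X\<close> fixed has tried every code on \<open>X\<close>
  itself, among them the code of the difference between \<open>X\<close> and a smaller
  \<open>Y\<close>; that exchange would have been accepted.\<close>

theorem local_search_optimal:
  assumes "dominates_below a n Y" "card (((local_search a n k - Y) \<union> (Y - local_search a n k)) \<inter> {..<n}) \<le> k"
  shows "card_below n (local_search a n k) \<le> card_below n Y"
proof (rule ccontr)
  define X where "X = local_search a n k"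
  assume "\<not> ?thesis"
  then have less: "card_below n Y < card_below n X" by (simp add: X_def)
  have eq: "card_below n (improves a n k (Suc n ^ k) X) = card_below n X"
    using local_search_fixed[of a n k] by (auto simp: X_def)
  obtain c where c: "c < Suc n ^ k"
    "toggle_digits (Suc n) k c {} \<inter> {..<n} = ((X - Y) \<union> (Y - X)) \<inter> {..<n}"
    using toggle_digits_surj[of "((X - Y) \<union> (Y - X)) \<inter> {..<n}" n k] assms(2) unfolding X_def by blast
  define Z where "Z = toggle_digits (Suc n) k c X"
  have "x \<in> Z \<longleftrightarrow> x \<in> Y" if "x < n" for x
    using toggle_digits_iff[of x "Suc n" k c X] c(2) that unfolding Z_def by auto
  then have Z: "Z \<inter> {..<n} = Y \<inter> {..<n}" by auto
  then have "dominates_below a n Z" using assms(1) unfolding dominates_below_def by (metis IntI IntD1 lessThan_iff)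
  moreover have "card_below n Z < card_below n X" using less Z by (simp add: card_below_def)
  ultimately have ne: "improve a n k c X = Z" "Z \<noteq> X" by (auto simp: improve_def Z_def Let_def)
  define j where "j = Suc n ^ k - Suc c"
  have j: "Suc j \<le> Suc n ^ k" "Suc n ^ k - Suc j = c" using c(1) by (auto simp: j_def)
  have "improves a n k (Suc j) X = X" "improves a n k j X = X"
    using improves_fixed[OF eq] j(1) by (auto simp del: improves.simps)
  then show False using ne j(2) by simp
qed

section \<open>Weakest preconditions for the random access machine\<close>

text \<open>Termination is included, and the postcondition also receives the number of steps, so
  that correctness and running time are proved together.\<close>

definition wp :: "prog \<Rightarrow> (nat \<Rightarrow> (nat \<Rightarrow> nat) \<Rightarrow> (nat \<Rightarrow> nat) \<Rightarrow> bool) \<Rightarrow>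
    (nat \<Rightarrow> nat) \<Rightarrow> (nat \<Rightarrow> nat) \<Rightarrow> bool" where
  "wp P Q r m \<longleftrightarrow> (\<exists>t r' m'. exec P (r, m) t (r', m') \<and> Q t r' m')"

lemma exec_Skip_iff: "exec Skip s t s' \<longleftrightarrow> t = 1 \<and> s' = s"
  using exec.skip[of s] by (auto elim: exec_SkipE)

lemma exec_Const_iff: "exec (Const i n) (r, m) t s' \<longleftrightarrow> t = 1 \<and> s' = (r(i := n), m)"
  using exec.const[of i n r m] by (auto elim: exec_ConstE)

lemma exec_Add_iff: "exec (Add i j k) (r, m) t s' \<longleftrightarrow> t = 1 \<and> s' = (r(i := r j + r k), m)"
  using exec.add[of i j k r m] by (auto elim: exec_AddE)

lemma exec_Sub_iff: "exec (Sub i j k) (r, m) t s' \<longleftrightarrow> t = 1 \<and> s' = (r(i := r j - r k), m)"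
  using exec.sub[of i j k r m] by (auto elim: exec_SubE)

lemma exec_Load_iff: "exec (Load i j) (r, m) t s' \<longleftrightarrow> t = 1 \<and> s' = (r(i := m (r j)), m)"
  using exec.load[of i j r m] by (auto elim: exec_LoadE)

lemma exec_Store_iff: "exec (Store i j) (r, m) t s' \<longleftrightarrow> t = 1 \<and> s' = (r, m(r i := r j))"
  using exec.store[of i j r m] by (auto elim: exec_StoreE)

lemma wp_Skip: "wp Skip Q r m \<longleftrightarrow> Q 1 r m"
  and wp_Const: "wp (Const i n) Q r m \<longleftrightarrow> Q 1 (r(i := n)) m"
  and wp_Add: "wp (Add i j k) Q r m \<longleftrightarrow> Q 1 (r(i := r j + r k)) m"
  and wp_Sub: "wp (Sub i j k) Q r m \<longleftrightarrow> Q 1 (r(i := r j - r k)) m"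
  and wp_Load: "wp (Load i j) Q r m \<longleftrightarrow> Q 1 (r(i := m (r j))) m"
  and wp_Store: "wp (Store i j) Q r m \<longleftrightarrow> Q 1 r (m(r i := r j))"
  unfolding wp_def exec_Skip_iff exec_Const_iff exec_Add_iff exec_Sub_iff exec_Load_iff exec_Store_iff
  by blast+

lemma wp_Seq: "wp (Seq P R) Q r m \<longleftrightarrow> wp P (\<lambda>t. wp R (\<lambda>t'. Q (t + t'))) r m"
proof
  assume "wp (Seq P R) Q r m"
  then obtain t r' m' where "exec (Seq P R) (r, m) t (r', m')" and Q: "Q t r' m'"
    unfolding wp_def by blast
  then obtain t1 s t2 where e: "exec P (r, m) t1 s" "exec R s t2 (r', m')" "t = t1 + t2"
    by (blast elim: exec_SeqE)
  obtain r2 m2 where "s = (r2, m2)" by (cases s)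
  with e Q show "wp P (\<lambda>t. wp R (\<lambda>t'. Q (t + t'))) r m"
    unfolding wp_def by blast
next
  assume "wp P (\<lambda>t. wp R (\<lambda>t'. Q (t + t'))) r m"
  then show "wp (Seq P R) Q r m" unfolding wp_def by (blast intro: exec.seq)
qed

lemma wp_Cond:
  "wp (Cond i P R) Q r m \<longleftrightarrow> (if r i \<noteq> 0 then wp P (\<lambda>t. Q (1 + t)) r m else wp R (\<lambda>t. Q (1 + t)) r m)"
proof (cases "r i = 0")
  case True
  then have "exec (Cond i P R) (r, m) t (r2, m2) \<longleftrightarrow> (\<exists>t'. t = 1 + t' \<and> exec R (r, m) t' (r2, m2))" for t r2 m2
    using exec.if_false[where i = i and r = r and m = m] by (auto elim: exec_CondE)
  then show ?thesis using True unfolding wp_def by auto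
next
  case False
  then have "exec (Cond i P R) (r, m) t (r2, m2) \<longleftrightarrow> (\<exists>t'. t = 1 + t' \<and> exec P (r, m) t' (r2, m2))" for t r2 m2
    using exec.if_true[where i = i and r = r and m = m] by (auto elim: exec_CondE)
  then show ?thesis using False unfolding wp_def by auto
qed

lemma wp_mono: "wp P Q r m \<Longrightarrow> (\<And>t r' m'. Q t r' m' \<Longrightarrow> Q' t r' m') \<Longrightarrow> wp P Q' r m"
  unfolding wp_def by blast

lemma wp_conseq:
  "wp P Q r m \<Longrightarrow> r = r2 \<Longrightarrow> (\<And>t r' m'. Q t r' m' \<Longrightarrow> Q' t r' m') \<Longrightarrow> wp P Q' r2 m"
  using wp_mono by blast

fun block :: "prog list \<Rightarrow> prog" where
  "block [] = Skip"
| "block [P] = P"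
| "block (P # Ps) = Seq P (block Ps)"

text \<open>Register 1 is assumed to contain the number 1.\<close>

definition For :: "nat \<Rightarrow> prog \<Rightarrow> prog" where
  "For i P = While i (Seq P (Sub i i 1))"

lemmas wp_simps = wp_Skip wp_Const wp_Add wp_Sub wp_Load wp_Store wp_Seq wp_Cond block.simps

lemma wp_While_stop: "r i = 0 \<Longrightarrow> Q 1 r m \<Longrightarrow> wp (While i P) Q r m"
  unfolding wp_def by (blast intro: exec.while_stop)

lemma wp_While_loop:
  assumes "r i \<noteq> 0" "wp P (\<lambda>t. wp (While i P) (\<lambda>t'. Q (1 + t + t'))) r m"
  shows "wp (While i P) Q r m"
  using assms unfolding wp_def by (blast intro: exec.while_loop)

text \<open>The counter runs down from \<open>N\<close>, and \<open>I\<close> is indexed by the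
  number of finished rounds. The body must preserve the counter and the 1 in register 1, and must
  establish \<open>I\<close> for the state after the decrement. Test and decrement add 2 to each
  round, the failing test adds the final 1.\<close>

lemma wp_For:
  assumes init: "r i = N" "I 0 r m"
    and body: "\<And>j r m. j < N \<Longrightarrow> r i = N - j \<Longrightarrow> I j r m \<Longrightarrow>
      wp P (\<lambda>t r' m'. t \<le> T \<and> r' i = N - j \<and> r' 1 = 1 \<and> I (Suc j) (r'(i := N - Suc j)) m') r m"
    and fin: "\<And>t r' m'. t \<le> N * (T + 2) + 1 \<Longrightarrow> r' i = 0 \<Longrightarrow> I N r' m' \<Longrightarrow> Q t r' m'"
  shows "wp (For i P) Q r m"
proof -
  have "wp (For i P) (\<lambda>t r' m'. t \<le> (N - j) * (T + 2) + 1 \<and> r' i = 0 \<and> I N r' m') r m"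
    if "j \<le> N" "r i = N - j" "I j r m" for j r m
    using that
  proof (induction "N - j" arbitrary: j r m)
    case 0
    then show ?case unfolding For_def by (intro wp_While_stop) auto
  next
    case (Suc d)
    then have j: "j < N" by simp
    show ?case
      unfolding For_def
    proof (rule wp_While_loop)
      show "r i \<noteq> 0" using Suc.prems j by simp
      show "wp (Seq P (Sub i i 1)) (\<lambda>t. wp (While i (Seq P (Sub i i 1)))
          (\<lambda>t' r' m'. 1 + t + t' \<le> (N - j) * (T + 2) + 1 \<and> r' i = 0 \<and> I N r' m')) r m"
        unfolding wp_Seq wp_Sub
      proof (rule wp_mono[OF body[OF j Suc.prems(2,3)]])
        fix t r' m'
        assume *: "t \<le> T \<and> r' i = N - j \<and> r' 1 = 1 \<and> I (Suc j) (r'(i := N - Suc j)) m'"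
        have "wp (For i P) (\<lambda>t r' m'. t \<le> (N - Suc j) * (T + 2) + 1 \<and> r' i = 0 \<and> I N r' m')
            (r'(i := N - Suc j)) m'"
          using Suc.hyps(2) j * by (intro Suc.hyps(1)) auto
        then show "wp (While i (Seq P (Sub i i 1)))
            (\<lambda>t' r' m'. 1 + (t + 1) + t' \<le> (N - j) * (T + 2) + 1 \<and> r' i = 0 \<and> I N r' m')
            (r'(i := r' i - r' 1)) m'"
        proof -
          assume w: "wp (For i P) (\<lambda>t r' m'. t \<le> (N - Suc j) * (T + 2) + 1 \<and> r' i = 0 \<and> I N r' m')
            (r'(i := N - Suc j)) m'"
          have e: "r'(i := r' i - r' 1) = r'(i := N - Suc j)" using * by simp
          have "N - j = Suc (N - Suc j)" using j by simp
          then have "(N - j) * (T + 2) = (N - Suc j) * (T + 2) + T + 2" by (simp only: mult_Suc)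
          then have "1 + (t + 1) + t' \<le> (N - j) * (T + 2) + 1" if "t' \<le> (N - Suc j) * (T + 2) + 1" for t'
            using that * by linarith
          then show ?thesis unfolding e by (intro wp_mono[OF w[unfolded For_def]]) blast
        qed
      qed
    qed
  qed
  from this[of 0, OF _ _ init(2)] init(1)
  have "wp (For i P) (\<lambda>t r' m'. t \<le> N * (T + 2) + 1 \<and> r' i = 0 \<and> I N r' m') r m" by simp
  then show ?thesis by (rule wp_mono) (use fin in blast)
qed

section \<open>The local search program\<close>

text \<open>The input stays in the cells below \<open>N\<close>. The current set occupies the cells from \<open>N\<close> on, including
  the cell \<open>N + n\<close> for the dummy index \<open>n\<close>. Register 20 is never written and contains 0.\<close>

definition mem_ok :: "(nat \<Rightarrow> nat) \<Rightarrow> nat \<Rightarrow> nat \<Rightarrow> nat set \<Rightarrow> (nat \<Rightarrow> nat) \<Rightarrow> bool" where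
  "mem_ok a N n X m \<longleftrightarrow> (\<forall>i<N. m i = a i) \<and> (\<forall>i\<le>n. m (N + i) = of_bool (i \<in> X))"

text \<open>The constants that all parts of the search share. As the machine cannot multiply,
  \<open>n * n\<close> and the base \<open>Suc n\<close> are kept ready.\<close>

definition regs_ok :: "nat \<Rightarrow> nat \<Rightarrow> nat \<Rightarrow> (nat \<Rightarrow> nat) \<Rightarrow> bool" where
  "regs_ok N n k r \<longleftrightarrow>
     r 0 = N \<and> r 1 = 1 \<and> r 2 = k \<and> r 3 = n \<and> r 4 = Suc n \<and> r 20 = 0 \<and> r 25 = n * n"

text \<open>A frame condition: \<open>A\<close> lists the registers that may have changed.\<close>

definition eq_off :: "nat set \<Rightarrow> (nat \<Rightarrow> nat) \<Rightarrow> (nat \<Rightarrow> nat) \<Rightarrow> bool" where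
  "eq_off A r r' \<longleftrightarrow> (\<forall>x. x \<notin> A \<longrightarrow> r' x = r x)"

lemma eq_offD: "eq_off A r r' \<Longrightarrow> x \<notin> A \<Longrightarrow> r' x = r x"
  by (simp add: eq_off_def)

lemma eq_off_trans: "eq_off A r r' \<Longrightarrow> eq_off B r' r'' \<Longrightarrow> A \<subseteq> C \<Longrightarrow> B \<subseteq> C \<Longrightarrow> eq_off C r r''"
  unfolding eq_off_def by (metis subsetD)

lemma eq_off_refl: "eq_off A r r"
  by (simp add: eq_off_def)

text \<open>Division by repeated subtraction. Register 12 holds a truncated difference that is
  nonzero exactly if the remainder still exceeds \<open>n\<close>.\<close>

definition divmod_prog :: prog where
  "divmod_prog = block [Const 11 0, Sub 12 9 3,
     While 12 (block [Sub 9 9 4, Add 11 11 1, Sub 12 9 3])]"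

lemma wp_divmod_prog:
  assumes r: "r 1 = 1" "r 3 = n" "r 4 = Suc n"
    and Q: "\<And>t r'. t \<le> 4 * r 9 + 3 \<Longrightarrow> r' 9 = r 9 mod Suc n \<Longrightarrow> r' 11 = r 9 div Suc n \<Longrightarrow>
      eq_off {9, 11, 12} r r' \<Longrightarrow> Q t r' m"
  shows "wp divmod_prog Q r m"
proof -
  define W where "W = While 12 (block [Sub 9 9 4, Add 11 11 1, Sub 12 9 3])"
  have step: "wp W Q' r m"
    if "r 12 \<noteq> 0" "wp (block [Sub 9 9 4, Add 11 11 1, Sub 12 9 3]) (\<lambda>t. wp W (\<lambda>t'. Q' (1 + t + t'))) r m"
    for Q' r
    using wp_While_loop[of r 12] that unfolding W_def by blast
  have W: "wp W (\<lambda>t r' m'. t \<le> 4 * r 9 + 1 \<and> r' 9 = r 9 mod Suc n \<and> r' 11 = r 11 + r 9 div Suc n \<and>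
      eq_off {9, 11, 12} r r' \<and> m' = m) r m"
    if "r 1 = 1" "r 3 = n" "r 4 = Suc n" "r 12 = r 9 - n" for r
    using that
  proof (induction "r 9" arbitrary: r rule: less_induct)
    case less
    show ?case
    proof (cases "r 9 \<le> n")
      case True
      then show ?thesis
        using less.prems unfolding W_def by (intro wp_While_stop) (simp_all add: eq_off_refl)
    next
      case False
      define r2 where "r2 = r(9 := r 9 - Suc n, 11 := Suc (r 11), 12 := r 9 - Suc n - n)"
      have IH: "wp W (\<lambda>t r' m'. t \<le> 4 * r2 9 + 1 \<and> r' 9 = r2 9 mod Suc n \<and>
          r' 11 = r2 11 + r2 9 div Suc n \<and> eq_off {9, 11, 12} r2 r' \<and> m' = m) r2 m"
        using False less.prems by (intro less.hyps) (simp_all add: r2_def)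
      have md: "r 9 mod Suc n = r2 9 mod Suc n" "r 9 div Suc n = Suc (r2 9 div Suc n)"
        using False by (simp_all add: r2_def le_mod_geq le_div_geq)
      have t: "4 * r2 9 + 4 \<le> 4 * r 9" using False by (simp add: r2_def)
      have off: "eq_off {9, 11, 12} r r'" if "eq_off {9, 11, 12} r2 r'" for r'
        using that by (auto simp: r2_def eq_off_def)
      have r11: "r2 11 = Suc (r 11)" by (simp add: r2_def)
      show ?thesis
      proof (rule step)
        show "r 12 \<noteq> 0" using False less.prems by simp
        show "wp (block [Sub 9 9 4, Add 11 11 1, Sub 12 9 3]) (\<lambda>t. wp W (\<lambda>t' r' m'.
          1 + t + t' \<le> 4 * r 9 + 1 \<and> r' 9 = r 9 mod Suc n \<and> r' 11 = r 11 + r 9 div Suc n \<and>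
          eq_off {9, 11, 12} r r' \<and> m' = m)) r m"
          unfolding block.simps wp_Seq wp_Sub wp_Add
          by (rule wp_conseq[OF IH]) (use less.prems md t off r11 in \<open>auto simp: r2_def\<close>)
      qed
    qed
  qed
  show ?thesis
    unfolding divmod_prog_def block.simps wp_Seq wp_Sub wp_Const W_def[unfolded block.simps, symmetric]
    by (rule wp_mono[OF W], use r in simp_all, rule Q) (auto simp: eq_off_def)
qed

text \<open>A bit is flipped by subtracting it from 1. Adding register 20, which is 0, amounts to
  copying; here it passes the quotient on to the next digit.\<close>

definition digit_prog :: prog where
  "digit_prog = block [divmod_prog, Add 13 9 0, Load 14 13, Sub 14 1 14, Store 13 14, Add 9 11 20]"

lemma wp_digit_prog:
  assumes r: "regs_ok N n k r" and m: "mem_ok a N n X m"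
    and Q: "\<And>t r' m'. t \<le> 4 * r 9 + 8 \<Longrightarrow> r' 9 = r 9 div Suc n \<Longrightarrow> eq_off {9, 11, 12, 13, 14} r r' \<Longrightarrow>
      mem_ok a N n (flip (r 9 mod Suc n) X) m' \<Longrightarrow> Q t r' m'"
  shows "wp digit_prog Q r m"
  unfolding digit_prog_def block.simps wp_Seq
proof (rule wp_divmod_prog)
  show "r 1 = 1" "r 3 = n" "r 4 = Suc n" using r by (simp_all add: regs_ok_def)
  fix t r'
  assume t: "t \<le> 4 * r 9 + 3" and r': "r' 9 = r 9 mod Suc n" "r' 11 = r 9 div Suc n"
    and off: "eq_off {9, 11, 12} r r'"
  let ?d = "r 9 mod Suc n"
  have c: "r' 0 = N" "r' (Suc 0) = 1" "r' 20 = 0"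
    using r eq_offD[OF off] by (simp_all add: regs_ok_def)
  have d: "?d \<le> n" using mod_less_divisor[of "Suc n" "r 9"] by simp
  then have mem: "mem_ok a N n (flip ?d X) (m(N + ?d := 1 - m (N + ?d)))"
    using m by (auto simp: mem_ok_def flip_def)
  show "wp (Add 13 9 0) (\<lambda>t'. wp (Load 14 13) (\<lambda>t'a. wp (Sub 14 1 14) (\<lambda>t'b. wp (Store 13 14)
      (\<lambda>t'c. wp (Add 9 11 20) (\<lambda>t'd. Q (t + (t' + (t'a + (t'b + (t'c + t'd))))))))))
      r' m"
    apply (simp add: wp_simps c r' add.commute[of _ N])
    apply (rule Q)
    subgoal using t by simp
    subgoal by simp
    subgoal using off by (auto simp: eq_off_def)
    subgoal using mem by simp
    done
qed

text \<open>Register 8 is the counter of the enclosing loop and runs down to 1, so the current code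
  is one less.\<close>

definition toggle_prog :: prog where
  "toggle_prog = block [Sub 9 8 1, Add 10 2 20, For 10 digit_prog]"

lemma wp_toggle_prog:
  assumes r: "regs_ok N n k r" and m: "mem_ok a N n X m"
    and Q: "\<And>t r' m'. t \<le> k * (4 * r 8 + 10) + 3 \<Longrightarrow> eq_off {9, 10, 11, 12, 13, 14} r r' \<Longrightarrow>
      mem_ok a N n (toggle_digits (Suc n) k (r 8 - 1) X) m' \<Longrightarrow> Q t r' m'"
  shows "wp toggle_prog Q r m"
proof -
  define c where "c = r 8 - 1"
  define I where "I j r' m' \<longleftrightarrow> eq_off {9, 10, 11, 12, 13, 14} r r' \<and> r' 9 = c div Suc n ^ j \<and>
    mem_ok a N n (toggle_digits (Suc n) j c X) m'" for j r' m'
  have reg: "regs_ok N n k r'" if "eq_off {9, 10, 11, 12, 13, 14} r r'" for r'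
    using r eq_offD[OF that] by (simp add: regs_ok_def)
  have "r 1 = 1" "r 2 = k" "r 20 = 0" using r by (simp_all add: regs_ok_def)
  then show ?thesis
    unfolding toggle_prog_def
    apply (simp add: wp_simps)
    apply (rule wp_For[where N = k and I = I and T = "4 * r 8 + 8"])
    subgoal by simp
    subgoal using m by (simp add: I_def c_def eq_off_def)
    subgoal premises p for j r' m'
    proof (rule wp_digit_prog[OF reg])
      show off: "eq_off {9, 10, 11, 12, 13, 14} r r'" using p by (simp add: I_def)
      show "mem_ok a N n (toggle_digits (Suc n) j c X) m'" using p by (simp add: I_def)
      fix t r2 m2
      assume t: "t \<le> 4 * r' 9 + 8" and r2: "r2 9 = r' 9 div Suc n"
        and off2: "eq_off {9, 11, 12, 13, 14} r' r2"
        and m2: "mem_ok a N n (flip (r' 9 mod Suc n) (toggle_digits (Suc n) j c X)) m2"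
      have r9: "r' 9 = c div Suc n ^ j" using p by (simp add: I_def)
      have "c div Suc n ^ j \<le> c" by (rule div_le_dividend)
      moreover have "c \<le> r 8" by (simp add: c_def)
      ultimately have "r' 9 \<le> r 8" unfolding r9 by (rule le_trans)
      moreover have "r2 10 = k - j" "r2 1 = 1"
        using p off off2 \<open>r 1 = 1\<close> by (auto simp: eq_off_def)
      moreover have "r2 9 = c div Suc n ^ Suc j" by (simp only: r2 r9 div_mult2_eq[symmetric] power_Suc2)
      moreover have "eq_off {9, 10, 11, 12, 13, 14} r (r2(10 := k - Suc j))"
        using off off2 by (auto simp: eq_off_def)
      ultimately show "t \<le> 4 * r 8 + 8 \<and> r2 10 = k - j \<and> r2 1 = 1 \<and> I (Suc j) (r2(10 := k - Suc j)) m2"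
        using t m2 by (simp add: I_def r9)
    qed
    subgoal for t r' m'
      by (rule Q) (simp_all add: I_def c_def algebra_simps)
    done
qed

text \<open>Registers 17 and 21 are loop counters with values \<open>v + 1\<close> and
  \<open>w + 1\<close>. The sum of the two truncated differences is 0 exactly if
  \<open>v = w\<close>. Register 19 is only compared with 0, so additions to it act as
  disjunctions.\<close>

definition entry_prog :: prog where
  "entry_prog = block [Sub 22 21 1, Add 13 0 22, Load 14 13,
     Cond 14 (block [Add 13 18 22, Load 14 13, Add 19 19 14,
       Sub 23 21 17, Sub 24 17 21, Add 23 23 24, Cond 23 Skip (Add 19 19 1)]) Skip]"

text \<open>Register 15 flags an undominated vertex, register 16 counts the set. The row offset
  \<open>v * n\<close> in register 18 is obtained by subtracting \<open>n\<close> per row, starting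
  from \<open>n * n\<close>.\<close>

definition row_prog :: prog where
  "row_prog = block [Sub 18 18 3, Const 19 0, Add 21 3 20, For 21 entry_prog,
     Cond 19 Skip (Const 15 1), Sub 13 17 1, Add 13 13 0, Load 14 13, Add 16 16 14]"

definition check_prog :: prog where
  "check_prog = block [Const 15 0, Const 16 0, Add 17 3 20, Add 18 25 20, For 17 row_prog]"

lemma wp_entry_prog:
  assumes r: "regs_ok N n k r" and m: "mem_ok a N n X m" and nN: "n * n \<le> N"
    and v: "r 17 = Suc v" "r 18 = v * n" "v < n" and w: "r 21 = Suc w" "w < n"
    and Q: "\<And>t r'. t \<le> 12 \<Longrightarrow> (r' 19 \<noteq> 0 \<longleftrightarrow> r 19 \<noteq> 0 \<or> w \<in> X \<and> closed_nbr a n v w) \<Longrightarrow>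
      eq_off {13, 14, 19, 22, 23, 24} r r' \<Longrightarrow> Q t r' m"
  shows "wp entry_prog Q r m"
proof -
  have "v * n + w < Suc v * n" using w by simp
  also have "\<dots> \<le> n * n" using v(3) by (intro mult_le_mono1) simp
  finally have "v * n + w < N" using nN by linarith
  then have a: "m (v * n + w) = a (v * n + w)" and x: "m (N + w) = of_bool (w \<in> X)"
    using m w by (simp_all add: mem_ok_def)
  have c: "r 0 = N" "r (Suc 0) = 1" using r by (simp_all add: regs_ok_def)
  show ?thesis
    unfolding entry_prog_def
    by (simp add: wp_simps c v w a x; intro conjI impI; rule Q; auto simp: eq_off_def closed_nbr_def)
qed

lemma wp_row_prog:
  assumes r: "regs_ok N n k r" and m: "mem_ok a N n X m" and nN: "n * n \<le> N"
    and v: "r 17 = Suc v" "r 18 = Suc v * n" "v < n"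
    and Q: "\<And>t r'. t \<le> n * 14 + 10 \<Longrightarrow> r' 18 = v * n \<Longrightarrow>
      (r' 15 = 0 \<longleftrightarrow> r 15 = 0 \<and> (\<exists>w<n. w \<in> X \<and> closed_nbr a n v w)) \<Longrightarrow>
      r' 16 = r 16 + of_bool (v \<in> X) \<Longrightarrow>
      eq_off {13, 14, 15, 16, 18, 19, 21, 22, 23, 24} r r' \<Longrightarrow> Q t r' m"
  shows "wp row_prog Q r m"
proof -
  define I where "I j r' m' \<longleftrightarrow> m' = m \<and> r' 18 = v * n \<and>
    eq_off {13, 14, 18, 19, 21, 22, 23, 24} r r' \<and>
    (r' 19 \<noteq> 0 \<longleftrightarrow> (\<exists>w<n. n - j \<le> w \<and> w \<in> X \<and> closed_nbr a n v w))" for j :: nat and r' m'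
  have c: "r 0 = N" "r (Suc 0) = 1" "r 3 = n" "r 20 = 0" using r by (simp_all add: regs_ok_def)
  have mv: "m (v + N) = of_bool (v \<in> X)" using m v by (simp add: mem_ok_def add.commute[of v N])
  show ?thesis
    unfolding row_prog_def
    apply (simp add: wp_simps c)
    apply (rule wp_For[where N = n and I = I and T = 12])
    subgoal by simp
    subgoal using v by (auto simp: I_def eq_off_def)
    subgoal premises p for j r' m'
    proof -
      define w where "w = n - Suc j"
      have off: "eq_off {13, 14, 18, 19, 21, 22, 23, 24} r r'" and m': "m' = m"
        using p by (simp_all add: I_def)
      have reg: "regs_ok N n k r'" using r eq_offD[OF off] by (simp add: regs_ok_def)
      have w: "n - j = Suc w" "w < n" "n - Suc j = w" using p(1) by (auto simp: w_def)
      show ?thesis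
        unfolding m'
      proof (rule wp_entry_prog[OF reg m nN])
        show "r' 17 = Suc v" using eq_offD[OF off] v by simp
        show "r' 18 = v * n" using p by (simp add: I_def)
        show "r' 21 = Suc w" using p w by simp
        show "v < n" "w < n" by fact+
        fix t r2
        assume *: "t \<le> 12" "r2 19 \<noteq> 0 \<longleftrightarrow> r' 19 \<noteq> 0 \<or> w \<in> X \<and> closed_nbr a n v w"
          "eq_off {13, 14, 19, 22, 23, 24} r' r2"
        have "r' 19 \<noteq> 0 \<longleftrightarrow> (\<exists>w'<n. Suc w \<le> w' \<and> w' \<in> X \<and> closed_nbr a n v w')"
          using p(3) w(1) by (simp add: I_def)
        then have "r2 19 \<noteq> 0 \<longleftrightarrow> (\<exists>w'<n. w \<le> w' \<and> w' \<in> X \<and> closed_nbr a n v w')"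
          using *(2) w(2) by (metis Suc_le_eq le_eq_less_or_eq)
        moreover have "eq_off {13, 14, 18, 19, 21, 22, 23, 24} r (r2(21 := w))"
          using off *(3) by (auto simp: eq_off_def)
        moreover have "r2 18 = v * n" "r2 21 = Suc w" "r2 1 = 1"
          using *(3) p w(1) reg by (auto simp: eq_off_def I_def regs_ok_def)
        ultimately show "t \<le> 12 \<and> r2 21 = n - j \<and> r2 1 = 1 \<and> I (Suc j) (r2(21 := n - Suc j)) m"
          using *(1) w by (simp add: I_def)
      qed
    qed
    subgoal premises p for t r' m'
    proof -
      have off: "eq_off {13, 14, 18, 19, 21, 22, 23, 24} r r'" and m': "m' = m"
        and r18: "r' 18 = v * n" and r19: "r' 19 \<noteq> 0 \<longleftrightarrow> (\<exists>w<n. w \<in> X \<and> closed_nbr a n v w)"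
        using p(3) by (simp_all add: I_def)
      have c': "r' 0 = N" "r' (Suc 0) = 1" "r' 17 = Suc v" "r' 15 = r 15" "r' 16 = r 16"
        using eq_offD[OF off] c v by simp_all
      show ?thesis
        using p(1) off r18 r19
        by (simp add: wp_simps m' c' mv; intro conjI impI; intro Q; auto simp: eq_off_def)
    qed
    done
qed

lemma wp_check_prog:
  assumes r: "regs_ok N n k r" and m: "mem_ok a N n X m" and nN: "n * n \<le> N"
    and Q: "\<And>t r'. t \<le> n * (n * 14 + 12) + 5 \<Longrightarrow> (r' 15 = 0 \<longleftrightarrow> dominates_below a n X) \<Longrightarrow>
      r' 16 = card_below n X \<Longrightarrow>
      eq_off {13, 14, 15, 16, 17, 18, 19, 21, 22, 23, 24} r r' \<Longrightarrow> Q t r' m"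
  shows "wp check_prog Q r m"
proof -
  define I where "I j r' m' \<longleftrightarrow> m' = m \<and> r' 18 = (n - j) * n \<and>
    eq_off {13, 14, 15, 16, 17, 18, 19, 21, 22, 23, 24} r r' \<and>
    (r' 15 = 0 \<longleftrightarrow> (\<forall>v<n. n - j \<le> v \<longrightarrow> (\<exists>w<n. w \<in> X \<and> closed_nbr a n v w))) \<and>
    r' 16 = card (X \<inter> {n - j..<n})" for j :: nat and r' m'
  have c: "r 0 = N" "r (Suc 0) = 1" "r 3 = n" "r 20 = 0" "r 25 = n * n" using r by (simp_all add: regs_ok_def)
  show ?thesis
    unfolding check_prog_def
    apply (simp add: wp_simps c)
    apply (rule wp_For[where N = n and I = I and T = "n * 14 + 10"])
    subgoal by simp
    subgoal by (auto simp: I_def eq_off_def)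
    subgoal premises p for j r' m'
    proof -
      define v where "v = n - Suc j"
      have off: "eq_off {13, 14, 15, 16, 17, 18, 19, 21, 22, 23, 24} r r'" and m': "m' = m"
        and r15: "r' 15 = 0 \<longleftrightarrow> (\<forall>v<n. n - j \<le> v \<longrightarrow> (\<exists>w<n. w \<in> X \<and> closed_nbr a n v w))"
        and r16: "r' 16 = card (X \<inter> {n - j..<n})"
        using p(3) by (simp_all add: I_def)
      have reg: "regs_ok N n k r'" using r eq_offD[OF off] by (simp add: regs_ok_def)
      have v: "n - j = Suc v" "v < n" "n - Suc j = v" using p(1) by (auto simp: v_def)
      show ?thesis
        unfolding m'
      proof (rule wp_row_prog[OF reg m nN])
        show "r' 17 = Suc v" using p(2) v by simp
        show "r' 18 = Suc v * n" using p(3) v by (simp add: I_def)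
        show "v < n" by fact
        fix t r2
        assume *: "t \<le> n * 14 + 10" "r2 18 = v * n"
          "r2 15 = 0 \<longleftrightarrow> r' 15 = 0 \<and> (\<exists>w<n. w \<in> X \<and> closed_nbr a n v w)"
          "r2 16 = r' 16 + of_bool (v \<in> X)"
          "eq_off {13, 14, 15, 16, 18, 19, 21, 22, 23, 24} r' r2"
        have "r2 15 = 0 \<longleftrightarrow> (\<forall>v'<n. v \<le> v' \<longrightarrow> (\<exists>w<n. w \<in> X \<and> closed_nbr a n v' w))"
          using *(3) r15 v by (metis Suc_le_eq le_eq_less_or_eq)
        moreover have "r2 16 = card (X \<inter> {v..<n})"
        proof -
          have "{v..<n} = insert v {Suc v..<n}" using v(2) by auto
          then show ?thesis using *(4) r16 v(1) by (cases "v \<in> X") simp_all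
        qed
        moreover have "eq_off {13, 14, 15, 16, 17, 18, 19, 21, 22, 23, 24} r (r2(17 := v))"
          using off *(5) by (auto simp: eq_off_def)
        moreover have "r2 17 = Suc v" "r2 1 = 1"
          using *(5) p(2) v(1) reg by (auto simp: eq_off_def regs_ok_def)
        ultimately show "t \<le> n * 14 + 10 \<and> r2 17 = n - j \<and> r2 1 = 1 \<and> I (Suc j) (r2(17 := n - Suc j)) m"
          using *(1,2) v by (simp add: I_def)
      qed
    qed
    subgoal premises p for t r' m'
    proof -
      have "X \<inter> {0..<n} = X \<inter> {..<n}" by auto
      moreover have "r' 15 = 0 \<longleftrightarrow> dominates_below a n X" using p(3) unfolding I_def dominates_below_def by simp
      moreover have "m' = m" using p(3) by (simp add: I_def)
      ultimately show ?thesis using p unfolding I_def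
        by (simp only:) (rule Q; simp add: card_below_def algebra_simps)
    qed
    done
qed

text \<open>A move is taken back by repeating it, because toggling is an involution.\<close>

definition try_prog :: prog where
  "try_prog = block [toggle_prog, check_prog, Sub 12 6 16, Cond 15 (Const 12 0) Skip,
     Cond 12 (Add 6 16 20) toggle_prog]"

text \<open>Register 12 is the truncated difference of old and new size, cleared if domination
  fails; it is nonzero exactly if the move is accepted.\<close>

lemma wp_try_prog:
  assumes r: "regs_ok N n k r" and m: "mem_ok a N n X m" and nN: "n * n \<le> N" and r6: "r 6 = card_below n X"
    and Q: "\<And>t r' m'. t \<le> 2 * (k * (4 * r 8 + 10)) + n * (n * 14 + 12) + 16 \<Longrightarrow>
      eq_off {6, 9, 10, 11, 12, 13, 14, 15, 16, 17, 18, 19, 21, 22, 23, 24} r r' \<Longrightarrow>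
      r' 6 = card_below n (improve a n k (r 8 - 1) X) \<Longrightarrow>
      mem_ok a N n (improve a n k (r 8 - 1) X) m' \<Longrightarrow> Q t r' m'"
  shows "wp try_prog Q r m"
proof -
  define Y where "Y = toggle_digits (Suc n) k (r 8 - 1) X"
  let ?A = "{6, 9, 10, 11, 12, 13, 14, 15, 16, 17, 18, 19, 21, 22, 23, 24} :: nat set"
  show ?thesis
    unfolding try_prog_def block.simps wp_Seq
    apply (rule wp_toggle_prog[OF r m])
    subgoal premises p1 for t1 r1 m1
    proof -
      have reg1: "regs_ok N n k r1" using r eq_offD[OF p1(2)] by (simp add: regs_ok_def)
      have mem1: "mem_ok a N n Y m1" using p1(3) by (simp add: Y_def)
      show ?thesis
        apply (rule wp_check_prog[OF reg1 mem1 nN])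
        subgoal premises p2 for t2 r2
        proof -
          have off: "eq_off ?A r r2" by (rule eq_off_trans[OF p1(2) p2(4)]) auto
          have reg2: "regs_ok N n k r2" using r eq_offD[OF off] by (simp add: regs_ok_def)
          have r2: "r2 6 = card_below n X" "r2 16 = card_below n Y" "r2 8 = r 8" "r2 20 = 0"
            using r6 eq_offD[OF p1(2)] eq_offD[OF p2(4)] p2(3) reg2 by (simp_all add: regs_ok_def)
          show ?thesis
          proof (cases "dominates_below a n Y \<and> card_below n Y < card_below n X")
            case True
            then have Z: "improve a n k (r 8 - 1) X = Y" by (simp add: improve_def Y_def Let_def)
            have r15: "r2 15 = 0" using True p2(2) by simp
            show ?thesis
              using True apply (simp add: wp_simps r2 r15)
              apply (rule Q)
              subgoal using p1(1) p2(1) by simp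
              subgoal using off by (auto simp: eq_off_def)
              subgoal by (simp add: Z[simplified])
              subgoal using mem1 by (simp add: Z[simplified])
              done
          next
            case False
            then have Z: "improve a n k (r 8 - 1) X = X" by (auto simp: improve_def Y_def Let_def)
            define r3 where "r3 = r2(12 := 0)"
            have reg3: "regs_ok N n k r3" using reg2 by (simp add: regs_ok_def r3_def)
            have r38: "r3 8 = r 8" using r2 by (simp add: r3_def)
            have restore: "toggle_digits (Suc n) k (r3 8 - 1) Y = X"
              by (simp only: r38 Y_def toggle_digits_involution)
            have tog: "wp toggle_prog (\<lambda>t r' m'. Q (t1 + (t2 + (1 + (2 + (1 + t))))) r' m') r3 m1"
              apply (rule wp_toggle_prog[OF reg3 mem1])
              subgoal premises p3 for t3 r4 m4
                apply (rule Q)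
                subgoal using p1(1) p2(1) p3(1) r38 by simp
                subgoal using off p3(2) by (auto simp: eq_off_def r3_def)
                subgoal using eq_offD[OF p3(2), of 6] r2 by (simp add: Z[simplified] r3_def)
                subgoal using p3(3) restore by (simp add: Z[simplified])
                done
              done
            show ?thesis
            proof (cases "r2 15 = 0")
              case True
              then have "\<not> card_below n Y < card_below n X" using False p2(2) by simp
              then have "card_below n X - card_below n Y = 0" by simp
              then show ?thesis using True tog
                by (simp add: wp_simps r2 r3_def)
            next
              case False
              then show ?thesis using tog by (simp add: wp_simps r2 r3_def)
            qed
          qed
        qed
        done
    qed
    done
qed

section \<open>Passes over all exchanges\<close>

definition pass_prog :: prog where
  "pass_prog = block [Add 8 5 20, For 8 try_prog]"

text \<open>The bound of \<open>wp_For\<close> for \<open>Suc n ^ k\<close> rounds, with the largest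
  value of the counter inserted in the time of \<open>try_prog\<close>.\<close>

definition pass_time :: "nat \<Rightarrow> nat \<Rightarrow> nat" where
  "pass_time n k = Suc n ^ k * (2 * (k * (4 * Suc n ^ k + 10)) + n * (n * 14 + 12) + 18) + 2"

lemma wp_pass_prog:
  assumes r: "regs_ok N n k r" and m: "mem_ok a N n X m" and nN: "n * n \<le> N" and r6: "r 6 = card_below n X"
    and r5: "r 5 = Suc n ^ k"
    and Q: "\<And>t r' m'. t \<le> pass_time n k \<Longrightarrow>
      eq_off {6, 8, 9, 10, 11, 12, 13, 14, 15, 16, 17, 18, 19, 21, 22, 23, 24} r r' \<Longrightarrow>
      r' 6 = card_below n (improves a n k (Suc n ^ k) X) \<Longrightarrow>
      mem_ok a N n (improves a n k (Suc n ^ k) X) m' \<Longrightarrow> Q t r' m'"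
  shows "wp pass_prog Q r m"
proof -
  let ?A = "{6, 8, 9, 10, 11, 12, 13, 14, 15, 16, 17, 18, 19, 21, 22, 23, 24} :: nat set"
  define M where "M = Suc n ^ k"
  define I where "I j r' m' \<longleftrightarrow> eq_off ?A r r' \<and> r' 6 = card_below n (improves a n k j X) \<and>
    mem_ok a N n (improves a n k j X) m'" for j r' m'
  have r20: "r 20 = 0" using r by (simp add: regs_ok_def)
  show ?thesis
    unfolding pass_prog_def
    apply (simp add: wp_simps r20 r5)
    apply (rule wp_For[where N = M and I = I and
      T = "2 * (k * (4 * M + 10)) + n * (n * 14 + 12) + 16"])
    subgoal by (simp add: M_def)
    subgoal using m r6 by (simp add: I_def eq_off_def)
    subgoal premises p for j r' m'
    proof -
      have off: "eq_off ?A r r'" using p(3) by (simp add: I_def)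
      have reg: "regs_ok N n k r'" using r eq_offD[OF off] by (simp add: regs_ok_def)
      show ?thesis
        apply (rule wp_try_prog[OF reg _ nN, where a = a and X = "improves a n k j X"])
          apply (use p(3) in \<open>simp add: I_def\<close>)
         apply (use p(3) in \<open>simp add: I_def\<close>)
        subgoal premises p2 for t r2 m2
        proof -
          have "k * (4 * r' 8 + 10) \<le> k * (4 * M + 10)" using p(2) by (intro mult_le_mono2) simp
          then have "t \<le> 2 * (k * (4 * M + 10)) + n * (n * 14 + 12) + 16" using p2(1) by linarith
          moreover have "r2 8 = M - j" "r2 1 = 1"
            using eq_offD[OF p2(2)] p(2) reg by (simp_all add: regs_ok_def)
          \<comment> \<open>After \<open>j\<close> rounds the counter is \<open>M - j\<close>, so
            the code tried is the one that \<open>improves\<close> uses in its round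
            \<open>Suc j\<close>.\<close>
          moreover have "r' 8 - 1 = Suc n ^ k - Suc j" using p(2) by (simp add: M_def)
          moreover have "eq_off ?A r (r2(8 := M - Suc j))"
            using off p2(2) by (auto simp: eq_off_def)
          ultimately show ?thesis using p2(3,4) by (simp add: I_def)
        qed
        done
    qed
    subgoal premises p for t r' m'
      by (rule Q) (use p in \<open>simp_all add: I_def M_def pass_time_def algebra_simps\<close>)
    done
qed

definition passes_prog :: prog where
  "passes_prog = block [Add 7 3 1, For 7 pass_prog]"

lemma wp_passes_prog:
  assumes r: "regs_ok N n k r" and m: "mem_ok a N n {..<n} m" and nN: "n * n \<le> N" and r6: "r 6 = n"
    and r5: "r 5 = Suc n ^ k"
    and Q: "\<And>t r' m'. t \<le> Suc n * (pass_time n k + 2) + 2 \<Longrightarrow> regs_ok N n k r' \<Longrightarrow>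
      mem_ok a N n (local_search a n k) m' \<Longrightarrow> Q t r' m'"
  shows "wp passes_prog Q r m"
proof -
  define X where "X j = (improves a n k (Suc n ^ k) ^^ j) {..<n}" for j
  have XS: "X (Suc j) = improves a n k (Suc n ^ k) (X j)" for j by (simp add: X_def)
  define I where "I j r' m' \<longleftrightarrow> regs_ok N n k r' \<and> r' 5 = Suc n ^ k \<and> r' 6 = card_below n (X j) \<and>
    mem_ok a N n (X j) m'" for j r' m'
  have c: "r 3 = n" "r (Suc 0) = 1" using r by (simp_all add: regs_ok_def)
  show ?thesis
    unfolding passes_prog_def
    apply (simp add: wp_simps c)
    apply (rule wp_For[where N = "Suc n" and I = I and T = "pass_time n k"])
    subgoal by simp
    subgoal using r m r6 r5 by (simp add: I_def X_def regs_ok_def card_below_def)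
    subgoal premises p for j r' m'
    proof -
      have reg: "regs_ok N n k r'" using p(3) by (simp add: I_def)
      show ?thesis
        apply (rule wp_pass_prog[OF reg _ nN, where a = a and X = "X j"])
           apply (use p(3) in \<open>simp add: I_def\<close>)
          apply (use p(3) in \<open>simp add: I_def\<close>)
         apply (use p(3) in \<open>simp add: I_def\<close>)
        subgoal premises p2 for t r2 m2
        proof -
          have reg2: "regs_ok N n k r2" using reg eq_offD[OF p2(2)] by (simp add: regs_ok_def)
          moreover have "r2 7 = Suc n - j" "r2 5 = Suc n ^ k"
            using eq_offD[OF p2(2)] p(2,3) by (simp_all add: I_def)
          moreover have "regs_ok N n k (r2(7 := Suc n - Suc j))" using reg2 by (simp add: regs_ok_def)
          moreover have "r2 1 = 1" using reg2 by (simp add: regs_ok_def)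
          ultimately show ?thesis using p2(1,3,4) by (simp add: I_def XS)
        qed
        done
    qed
    subgoal premises p for t r' m'
      by (rule Q) (use p in \<open>simp_all add: I_def X_def local_search_def del: funpow.simps\<close>)
    done
qed

section \<open>Preparation, output and assembly\<close>

text \<open>The number of vertices is the integer square root of the length of the input.\<close>

definition size_prog :: prog where
  "size_prog = block [Const 3 0, Const 25 0, Add 7 0 20,
     For 7 (block [Add 12 25 3, Add 12 12 3, Add 12 12 1, Sub 13 12 0,
       Cond 13 Skip (block [Add 25 12 20, Add 3 3 1])])]"

text \<open>Squares are updated by \<open>(n + 1)^2 = n^2 + 2 * n + 1\<close>. The candidate grows
  in every round until the next square exceeds \<open>N\<close>, so \<open>N\<close> rounds are
  enough.\<close>

lemma wp_size_prog:
  assumes r: "r 0 = N" "r 1 = 1" "r 20 = 0"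
    and Q: "\<And>t r' n. t \<le> N * 9 + 4 \<Longrightarrow> r' 3 = n \<Longrightarrow> r' 25 = n * n \<Longrightarrow> n * n \<le> N \<Longrightarrow>
      N < Suc n * Suc n \<Longrightarrow> eq_off {3, 7, 12, 13, 25} r r' \<Longrightarrow> Q t r' m"
  shows "wp size_prog Q r m"
proof -
  define I where "I j r' m' \<longleftrightarrow> m' = m \<and> eq_off {3, 7, 12, 13, 25} r r' \<and>
    r' 25 = r' 3 * r' 3 \<and> r' 3 * r' 3 \<le> N \<and> (j \<le> r' 3 \<or> N < Suc (r' 3) * Suc (r' 3))"
    for j :: nat and r' m'
  show ?thesis
    unfolding size_prog_def
    apply (simp add: wp_simps r)
    apply (rule wp_For[where N = N and I = I and T = 7])
    subgoal by simp
    subgoal by (auto simp: I_def eq_off_def)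
    subgoal premises p for j r' m'
    proof -
      have off: "eq_off {3, 7, 12, 13, 25} r r'" using p(3) by (simp add: I_def)
      have c: "r' 0 = N" "r' (Suc 0) = 1" "r' 20 = 0" using eq_offD[OF off] r by simp_all
      have e: "r' 25 = r' 3 * r' 3" using p(3) by (simp add: I_def)
      show ?thesis
        using p off by (auto simp: wp_simps c e I_def eq_off_def)
    qed
    subgoal premises p for t r' m'
    proof -
      have "N < Suc (r' 3) * Suc (r' 3)"
      proof (cases "N \<le> r' 3")
        case True
        then have "Suc N * 1 \<le> Suc (r' 3) * Suc (r' 3)" by (intro mult_le_mono) auto
        then show ?thesis by simp
      qed (use p(3) in \<open>auto simp: I_def\<close>)
      moreover have "m' = m" using p(3) by (simp add: I_def)
      ultimately show ?thesis using p by (auto intro!: Q simp: I_def)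
    qed
    done
qed

text \<open>Each multiplication by \<open>Suc n\<close> is a loop of additions, whose length is the
  power computed so far.\<close>

definition power_prog :: prog where
  "power_prog = block [Const 5 1, Add 10 2 20,
     For 10 (block [Const 12 0, Add 9 5 20, For 9 (Add 12 12 4), Add 5 12 20])]"

lemma wp_power_prog:
  assumes r: "regs_ok N n k r"
    and Q: "\<And>t r'. t \<le> k * (Suc n ^ k * 3 + 6) + 3 \<Longrightarrow> r' 5 = Suc n ^ k \<Longrightarrow> regs_ok N n k r' \<Longrightarrow> Q t r' m"
  shows "wp power_prog Q r m"
proof -
  have Q2: "Q t r' m'" if "t \<le> k * (Suc n ^ k * 3 + 6) + 3" "m' = m" "r' 5 = Suc n ^ k" "regs_ok N n k r'"
    for t r' m'
    using Q that by simp
  define I where "I j r' m' \<longleftrightarrow> m' = m \<and> regs_ok N n k r' \<and> r' 5 = Suc n ^ j" for j :: nat and r' m'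
  have c: "r 2 = k" "r 20 = 0" using r by (simp_all add: regs_ok_def)
  show ?thesis
    unfolding power_prog_def
    apply (simp add: wp_simps c)
    apply (rule wp_For[where N = k and I = I and T = "Suc n ^ k * 3 + 4"])
    subgoal by simp
    subgoal using r by (simp add: I_def regs_ok_def)
    subgoal premises p for j r' m'
    proof -
      define b where "b = Suc n ^ j"
      define J where "J i r2 m2 \<longleftrightarrow> m2 = m \<and> regs_ok N n k r2 \<and> r2 12 = i * Suc n \<and> r2 10 = k - j"
        for i :: nat and r2 m2
      have reg: "regs_ok N n k r'" and m': "m' = m" and r5: "r' 5 = b"
        using p(3) by (simp_all add: I_def b_def)
      have "b \<le> Suc n ^ k" unfolding b_def using p(1) by (intro power_increasing) auto
      have c': "r' 20 = 0" using reg by (simp add: regs_ok_def)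
      show ?thesis
        unfolding m'
        apply (simp add: wp_simps c' r5)
        apply (rule wp_For[where N = b and I = J and T = 1])
        subgoal by simp
        subgoal using reg p(2) by (simp add: J_def regs_ok_def)
        subgoal by (simp add: wp_simps J_def regs_ok_def)
        subgoal premises p2 for t r2 m2
        proof -
          have "t \<le> Suc n ^ k * 3 + 1" using p2(1) \<open>b \<le> Suc n ^ k\<close> by simp
          then show ?thesis using p2(3) p(1)
            by (simp add: wp_simps J_def I_def regs_ok_def b_def)
        qed
        done
    qed
    subgoal premises p for t r' m'
      by (rule Q2) (use p in \<open>simp_all add: I_def algebra_simps\<close>)
    done
qed

definition init_prog :: prog where
  "init_prog = block [Add 9 3 20, For 9 (block [Sub 12 9 1, Add 13 12 0, Store 13 1])]"

lemma wp_init_prog: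
  assumes r: "regs_ok N n k r" and m: "mem_ok a N n {} m" and r5: "r 5 = M"
    and Q: "\<And>t r' m'. t \<le> n * 5 + 2 \<Longrightarrow> r' 5 = M \<Longrightarrow> regs_ok N n k r' \<Longrightarrow> mem_ok a N n {..<n} m' \<Longrightarrow> Q t r' m'"
  shows "wp init_prog Q r m"
proof -
  define I where "I j r' m' \<longleftrightarrow> regs_ok N n k r' \<and> r' 5 = M \<and> mem_ok a N n {n - j..<n} m'"
    for j :: nat and r' m'
  have c: "r 3 = n" "r 20 = 0" using r by (simp_all add: regs_ok_def)
  show ?thesis
    unfolding init_prog_def
    apply (simp add: wp_simps c)
    apply (rule wp_For[where N = n and I = I and T = 3])
    subgoal by simp
    subgoal using r m r5 by (simp add: I_def regs_ok_def)
    subgoal premises p for j r' m'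
    proof -
      define w where "w = n - Suc j"
      have w: "n - j = Suc w" "n - Suc j = w" "w < n" using p(1) by (auto simp: w_def)
      have reg: "regs_ok N n k r'" using p(3) by (simp add: I_def)
      have c': "r' 0 = N" "r' (Suc 0) = 1" using reg by (simp_all add: regs_ok_def)
      have "mem_ok a N n {w..<n} (m'(w + N := 1))"
        using p(3) w by (auto simp: I_def mem_ok_def)
      then show ?thesis
        using p(2,3) w(1,2) by (simp add: wp_simps I_def regs_ok_def)
    qed
    subgoal premises p for t r' m'
      using p by (auto intro!: Q simp: I_def atLeast0LessThan)
    done
qed

definition output_prog :: prog where
  "output_prog = block [Add 9 3 20,
     For 9 (block [Sub 12 9 1, Add 13 12 0, Load 14 13, Store 12 14]), Add 0 3 20]"

text \<open>Overwriting the matrix is safe at this point, and \<open>n \<le> N\<close> keeps the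
  target cells apart from the source cells.\<close>

lemma wp_output_prog:
  assumes r: "regs_ok N n k r" and m: "mem_ok a N n X m" and nN: "n \<le> N"
    and Q: "\<And>t r' m'. t \<le> n * 6 + 3 \<Longrightarrow> r' 0 = n \<Longrightarrow> (\<And>i. i < n \<Longrightarrow> m' i = of_bool (i \<in> X)) \<Longrightarrow> Q t r' m'"
  shows "wp output_prog Q r m"
proof -
  define I where "I j r' m' \<longleftrightarrow> regs_ok N n k r' \<and> (\<forall>i<n. m' (N + i) = of_bool (i \<in> X)) \<and>
    (\<forall>i<n. n - j \<le> i \<longrightarrow> m' i = of_bool (i \<in> X))"
    for j :: nat and r' and m' :: "nat \<Rightarrow> nat"
  have c: "r 3 = n" "r 20 = 0" using r by (simp_all add: regs_ok_def)
  show ?thesis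
    unfolding output_prog_def
    apply (simp add: wp_simps c)
    apply (rule wp_For[where N = n and I = I and T = 4])
    subgoal by simp
    subgoal using r m by (simp add: I_def regs_ok_def mem_ok_def)
    subgoal premises p for j r' m'
    proof -
      define w where "w = n - Suc j"
      have w: "n - j = Suc w" "n - Suc j = w" "w < n" using p(1) by (auto simp: w_def)
      have reg: "regs_ok N n k r'" using p(3) by (simp add: I_def)
      have c': "r' 0 = N" "r' (Suc 0) = 1" using reg by (simp_all add: regs_ok_def)
      have mw: "m' (w + N) = of_bool (w \<in> X)"
        using p(3) w(3) by (simp add: I_def add.commute[of w N])
      have I': "\<forall>i<n. Suc w \<le> i \<longrightarrow> m' i = of_bool (i \<in> X)" "\<forall>i<n. m' (N + i) = of_bool (i \<in> X)"
        using p(3) w(1) by (simp_all add: I_def)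
      have "\<forall>i<n. w \<le> i \<longrightarrow> (m'(w := of_bool (w \<in> X))) i = of_bool (i \<in> X)"
        using I'(1) by (auto simp: le_eq_less_or_eq)
      moreover have "\<forall>i<n. (m'(w := of_bool (w \<in> X))) (N + i) = of_bool (i \<in> X)"
        using I'(2) w(3) nN by simp
      ultimately have "I (Suc j) (r'(12 := w, 13 := w + N, 14 := of_bool (w \<in> X), 9 := w)) (m'(w := of_bool (w \<in> X)))"
        using reg by (simp add: I_def regs_ok_def w(2))
      then show ?thesis
        using p(2) w(1,2) by (simp add: wp_simps c' mw)
    qed
    subgoal premises p for t r' m'
    proof -
      have "r' 3 = n" "r' 20 = 0" using p(3) by (simp_all add: I_def regs_ok_def)
      then show ?thesis using p(1,3)
        by (simp add: wp_simps) (rule Q; simp add: I_def)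
    qed
    done
qed

definition search_prog :: prog where
  "search_prog = block [Const 1 1, size_prog, Add 4 3 1, power_prog, init_prog, Add 6 3 20,
     passes_prog, output_prog]"

definition mds_prog :: "nat \<Rightarrow> prog" where
  "mds_prog k = Seq (Const 2 k) search_prog"

text \<open>Expressed in the length \<open>N\<close> of the input, which bounds the number of
  vertices; a polynomial for each fixed \<open>k\<close>.\<close>

definition search_time :: "nat \<Rightarrow> nat \<Rightarrow> nat" where
  "search_time N k = N * 9 + k * (Suc N ^ k * 3 + 6) + N * 11 + Suc N * (pass_time N k + 2) + 22"

lemma pass_time_mono: "n \<le> N \<Longrightarrow> pass_time n k \<le> pass_time N k"
  unfolding pass_time_def by (intro add_mono mult_le_mono power_mono) auto

text \<open>\<open>N\<close> is not assumed to be a square because \<open>polynomial_time\<close>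
  speaks of all words; any word is treated as containing a matrix whose size is the integer square
  root of its length.\<close>

theorem wp_mds_prog:
  assumes r: "r = (\<lambda>_. 0)(0 := N)" and m: "\<And>i. N \<le> i \<Longrightarrow> m i = 0"
    and Q: "\<And>t r' m' n. n * n \<le> N \<Longrightarrow> N < Suc n * Suc n \<Longrightarrow> t \<le> search_time N k \<Longrightarrow> r' 0 = n \<Longrightarrow>
      (\<And>i. i < n \<Longrightarrow> m' i = of_bool (i \<in> local_search m n k)) \<Longrightarrow> Q t r' m'"
  shows "wp (mds_prog k) Q r m"
  unfolding mds_prog_def search_prog_def block.simps wp_Seq wp_Const
  apply (rule wp_size_prog[where N = N])
     apply (simp add: r)
    apply simp
   apply (simp add: r)
  subgoal premises p for t1 r1 n
  proof -
    have nN: "n \<le> N" using p(4) by (metis le_square le_trans)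
    have reg: "regs_ok N n k (r1(4 := Suc n))"
      using eq_offD[OF p(6)] p(2,3) by (simp add: regs_ok_def r)
    have c: "r1 3 = n" "r1 (Suc 0) = 1" using eq_offD[OF p(6)] p(2) by simp_all
    have mem: "mem_ok m N n {} m" using m by (simp add: mem_ok_def)
    show ?thesis
      unfolding wp_Add
      apply (simp add: c)
      apply (rule wp_power_prog[OF reg])
      subgoal premises p2 for t2 r2
        apply (rule wp_init_prog[OF p2(3) mem p2(2)])
        subgoal premises p3 for t3 r3 m3
        proof -
          have c3: "r3 3 = n" "r3 20 = 0" using p3(3) by (simp_all add: regs_ok_def)
          have reg3: "regs_ok N n k (r3(6 := n))" using p3(3) by (simp add: regs_ok_def)
          show ?thesis
            apply (simp add: c3)
            apply (rule wp_passes_prog[OF reg3 p3(4) p(4)])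
              apply simp
             apply (simp add: p3(2))
            subgoal premises p4 for t4 r4 m4
              apply (rule wp_output_prog[OF p4(2,3) nN])
              subgoal premises p5 for t5 r5 m5
              proof -
                have "Suc n ^ k \<le> Suc N ^ k" using nN by (intro power_mono) auto
                then have a: "k * (Suc n ^ k * 3 + 6) \<le> k * (Suc N ^ k * 3 + 6)"
                  by (intro mult_le_mono2) simp
                have b: "Suc n * (pass_time n k + 2) \<le> Suc N * (pass_time N k + 2)"
                  using nN pass_time_mono[OF nN] by (intro mult_le_mono) auto
                have "t1 + t2 + t3 + t4 + t5 + 6 \<le> search_time N k"
                  using p(1) p2(1) p3(1) p4(1) p5(1) a b nN unfolding search_time_def by linarith
                then show ?thesis
                  by (intro Q[where n = n, OF p(4,5)]) (simp_all add: p5(2,3))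
              qed
              done
            done
        qed
        done
      done
  qed
  done

section \<open>The uniformity program\<close>

primrec emits :: "bool list \<Rightarrow> prog" where
  "emits [] = Skip"
| "emits (b # bs) = Seq (block [Const 6 (of_bool b), Store 5 6, Add 5 5 1]) (emits bs)"

definition written :: "nat \<Rightarrow> bool list \<Rightarrow> (nat \<Rightarrow> nat) \<Rightarrow> (nat \<Rightarrow> nat) \<Rightarrow> bool" where
  "written l y r m \<longleftrightarrow> r 0 = l \<and> r 1 = 1 \<and> r 4 = 0 \<and> r 5 = length y \<and>
     (\<forall>i<length y. m i = of_bool (y ! i))"

lemma wp_emits:
  assumes "written l y r m"
    and "\<And>t r' m'. t \<le> 3 * length bs + 1 \<Longrightarrow> written l (y @ bs) r' m' \<Longrightarrow> eq_off {5, 6} r r' \<Longrightarrow> Q t r' m'"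
  shows "wp (emits bs) Q r m"
  using assms
proof (induction bs arbitrary: y r m Q)
  case Nil
  then show ?case by (simp add: wp_simps eq_off_refl)
next
  case (Cons b bs)
  have c: "r 5 = length y" "r (Suc 0) = 1" using Cons.prems(1) by (simp_all add: written_def)
  define r2 m2 where "r2 = r(6 := of_bool b, 5 := length y + 1)" and "m2 = m(length y := of_bool b)"
  have w: "written l (y @ [b]) r2 m2"
    using Cons.prems(1) by (auto simp: written_def r2_def m2_def nth_append less_Suc_eq)
  have "wp (emits bs) (\<lambda>t. Q (3 + t)) r2 m2"
  proof (rule Cons.IH[OF w])
    fix t r' m'
    assume *: "t \<le> 3 * length bs + 1" "written l ((y @ [b]) @ bs) r' m'" "eq_off {5, 6} r2 r'"
    show "Q (3 + t) r' m'"
      using * by (intro Cons.prems(2)) (auto simp: eq_off_def r2_def)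
  qed
  then show ?case by (simp add: wp_simps c r2_def m2_def numeral_3_eq_3)
qed

text \<open>Of the input only its length \<open>l\<close> is used. Two nested loops of
  \<open>l\<close> rounds print \<open>l * (l * K)\<close> ones, a constant in unary, between the
  hard-wired words \<open>u\<close> and \<open>v\<close>.\<close>

definition uniform_prog :: "nat \<Rightarrow> bool list \<Rightarrow> bool list \<Rightarrow> prog" where
  "uniform_prog K u v = block [Const 1 1, emits u, Add 7 0 4,
     For 7 (block [Add 8 0 4, For 8 (emits (replicate K True))]), emits v, Add 0 5 4]"

lemma wp_uniform_prog:
  assumes r: "r = (\<lambda>_. 0)(0 := l)"
    and Q: "\<And>t r' m'. r' 0 = length y \<Longrightarrow> (\<And>i. i < length y \<Longrightarrow> m' i = of_bool (y ! i)) \<Longrightarrow> Q t r' m'"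
    and y: "y = u @ replicate (l * (l * K)) True @ v"
  shows "wp (uniform_prog K u v) Q r m"
proof -
  define I where "I j r' m' \<longleftrightarrow> written l (u @ replicate (j * (l * K)) True) r' m'" for j r' m'
  have w: "written l [] (r(1 := 1)) m" by (simp add: written_def r)
  show ?thesis
    unfolding uniform_prog_def block.simps wp_Seq wp_Const
    apply (rule wp_emits[OF w])
    subgoal premises p1 for t1 r1 m1
    proof -
      have c1: "r1 0 = l" "r1 4 = 0" using p1(2) by (simp_all add: written_def)
      show ?thesis
        apply (simp add: wp_simps c1)
        apply (rule wp_For[where N = l and I = I and T = "l * (3 * K + 3) + 2"])
        subgoal by simp
        subgoal using p1(2) by (simp add: I_def written_def)
        subgoal premises p2 for j r2 m2
        proof -
          define J where "J i r3 m3 \<longleftrightarrow> r3 7 = l - j \<and>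
            written l (u @ replicate (j * (l * K) + i * K) True) r3 m3" for i r3 m3
          have c2: "r2 0 = l" "r2 4 = 0" using p2(3) by (simp_all add: I_def written_def)
          show ?thesis
            apply (simp add: wp_simps c2)
            apply (rule wp_For[where N = l and I = J and T = "3 * K + 1"])
            subgoal by simp
            subgoal using p2(2,3) by (simp add: J_def I_def written_def)
            subgoal premises p3 for i r3 m3
            proof -
              have w3: "written l (u @ replicate (j * (l * K) + i * K) True) r3 m3" "r3 7 = l - j"
                using p3(3) by (simp_all add: J_def)
              have e: "(u @ replicate (j * (l * K) + i * K) True) @ replicate K True =
                u @ replicate (j * (l * K) + Suc i * K) True"
                by (simp add: replicate_add[symmetric] add.commute add.left_commute)
              show ?thesis
                apply (rule wp_emits[OF w3(1)])
                subgoal premises p4 for t4 r4 m4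
                  using p4(1,2)[unfolded e] p3(2) w3(2) eq_offD[OF p4(3)]
                  by (simp add: J_def written_def)
                done
            qed
            subgoal premises p3 for t3 r3 m3
            proof -
              have "j * (l * K) + l * K = Suc j * (l * K)" by simp
              then show ?thesis using p3 p2(1,2) by (simp add: J_def I_def written_def algebra_simps)
            qed
            done
        qed
        subgoal premises p2 for t2 r2 m2
        proof -
          have w2: "written l (u @ replicate (l * (l * K)) True) r2 m2" using p2(3) by (simp add: I_def)
          show ?thesis
            apply (rule wp_emits[OF w2])
            subgoal premises p3 for t3 r3 m3
              using p3(2) by (simp add: wp_simps) (rule Q; simp add: written_def y)
            done
        qed
        done
    qed
    done
qed

section \<open>The approximation scheme\<close>

text \<open>\<open>search_time\<close> is rebuilt as a polynomial; \<open>k\<close> is a constant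
  and may stand in the exponent.\<close>

lemma polynomial_time_mds_prog: "polynomial_time (mds_prog k)"
proof -
  let ?X = "[:0, 1:] :: nat poly" and ?S = "[:1, 1:] :: nat poly"
  let ?P = "?S ^ k * ([:2:] * ([:k:] * ([:4:] * ?S ^ k + [:10:])) + ?X * (?X * [:14:] + [:12:]) + [:18:]) + [:2:]"
  define p where "p = ?X * [:9:] + [:k:] * (?S ^ k * [:3:] + [:6:]) + ?X * [:11:] + ?S * (?P + [:2:]) + [:22:]"
  have p: "poly p N = search_time N k" for N
    by (simp add: p_def search_time_def pass_time_def poly_power algebra_simps)
  have "\<exists>t s. exec (mds_prog k) (input_state w) t s \<and> t \<le> poly p (length w)" for w
  proof -
    define m :: "nat \<Rightarrow> nat" where "m i = (if i < length w then of_bool (w ! i) else 0)" for i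
    have "wp (mds_prog k) (\<lambda>t r' m'. t \<le> poly p (length w)) ((\<lambda>_. 0)(0 := length w)) m"
      by (rule wp_mds_prog) (simp_all add: m_def p)
    then show ?thesis unfolding wp_def input_state_def m_def by blast
  qed
  then show ?thesis unfolding polynomial_time_def by blast
qed

section \<open>Transfer from index sets to graphs\<close>

lemma nth_concat_map_uniform:
  assumes "\<And>x. x \<in> set xs \<Longrightarrow> length (f x) = n" "i < length xs" "j < n"
  shows "concat (map f xs) ! (i * n + j) = f (xs ! i) ! j"
  using assms
proof (induction xs arbitrary: i)
  case (Cons x xs)
  then show ?case
    by (cases i) (simp_all add: nth_append add.assoc)
qed simp

lemma length_graph_word: "length (graph_word vs G) = length vs * length vs"
  by (simp add: graph_word_def length_concat comp_def sum_list_triv)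

lemma nth_graph_word:
  assumes "i < length vs" "j < length vs"
  shows "graph_word vs G ! (i * length vs + j) \<longleftrightarrow> (vs ! i, vs ! j) \<in> parcs G"
  unfolding graph_word_def using assms by (subst nth_concat_map_uniform) auto

lemma dominating_set_iff_dominates: "dominating_set G X \<longleftrightarrow> dominates (parcs G) (pverts G) X"
  by (simp add: dominating_set_def dominates_def)

lemma mds_opt_attained:
  assumes "finite (pverts G)"
  shows "\<exists>X. dominating_set G X \<and> card X = mds_opt G"
    and "dominating_set G X \<Longrightarrow> mds_opt G \<le> card X"
proof -
  have fin: "finite {X. dominating_set G X}"
    using finite_subset[of "{X. dominating_set G X}" "Pow (pverts G)"] assms
    by (auto simp: dominating_set_def)
  have "dominating_set G (pverts G)" by (simp add: dominating_set_def)
  then have "card ` {X. dominating_set G X} \<noteq> {}" by blast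
  then have "Min (card ` {X. dominating_set G X}) \<in> card ` {X. dominating_set G X}"
    using fin by (intro Min_in) auto
  then show "\<exists>X. dominating_set G X \<and> card X = mds_opt G" unfolding mds_opt_def by force
  show "mds_opt G \<le> card X" if "dominating_set G X"
    unfolding mds_opt_def using fin that by (intro Min_le) auto
qed

text \<open>Domination, size and local optimality are carried over along \<open>(!) vs\<close>, a
  bijection from the indices below \<open>n\<close> to the vertices.\<close>

lemma mds_prog_computes:
  assumes vs: "distinct vs" "set vs = pverts G"
  shows "\<exists>X. computes (mds_prog k) (graph_word vs G) (set_word vs X) \<and> dominating_set G X \<and>
    (\<forall>Y. dominating_set G Y \<longrightarrow> card ((X - Y) \<union> (Y - X)) \<le> k \<longrightarrow> card X \<le> card Y)"
proof -
  define w where "w = graph_word vs G"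
  define n where "n = length vs"
  define m :: "nat \<Rightarrow> nat" where "m i = (if i < length w then of_bool (w ! i) else 0)" for i
  have lw: "length w = n * n" by (simp add: w_def n_def length_graph_word)
  have closed_nbr: "closed_nbr m n v u \<longleftrightarrow> v = u \<or> (vs ! v, vs ! u) \<in> parcs G" if "v < n" "u < n" for v u
  proof -
    have "v * n + u < Suc v * n" using that by simp
    also have "\<dots> \<le> n * n" using that by (intro mult_le_mono1) simp
    finally have "m (v * n + u) = of_bool ((vs ! v, vs ! u) \<in> parcs G)"
      using nth_graph_word[of v vs u G] that by (simp add: m_def w_def n_def length_graph_word)
    then show ?thesis by (simp add: closed_nbr_def)
  qed
  have inj: "inj_on ((!) vs) {..<n}" using vs(1) by (simp add: n_def inj_on_nth)
  have V: "pverts G = (!) vs ` {..<n}" using vs(2) by (auto simp: n_def set_conv_nth)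
  have dom: "dominates_below m n Z \<longleftrightarrow> dominating_set G ((!) vs ` (Z \<inter> {..<n}))" for Z
  proof
    assume Z: "dominates_below m n Z"
    show "dominating_set G ((!) vs ` (Z \<inter> {..<n}))"
      unfolding dominating_set_def
    proof (intro conjI ballI)
      show "(!) vs ` (Z \<inter> {..<n}) \<subseteq> pverts G" using V by blast
      fix x assume x: "x \<in> pverts G - (!) vs ` (Z \<inter> {..<n})"
      then obtain v where v: "v < n" "x = vs ! v" using V by auto
      then obtain u where u: "u < n" "u \<in> Z" "closed_nbr m n v u" using Z unfolding dominates_below_def by blast
      then have "v \<noteq> u" using x v by auto
      then have "(x, vs ! u) \<in> parcs G" using u v closed_nbr by auto
      then show "\<exists>w\<in>(!) vs ` (Z \<inter> {..<n}). (x, w) \<in> parcs G" using u by blast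
    qed
  next
    assume D: "dominating_set G ((!) vs ` (Z \<inter> {..<n}))"
    show "dominates_below m n Z"
      unfolding dominates_below_def
    proof (intro allI impI)
      fix v assume v: "v < n"
      show "\<exists>w<n. w \<in> Z \<and> closed_nbr m n v w"
      proof (cases "v \<in> Z")
        case True
        then show ?thesis using v by (auto simp: closed_nbr_def)
      next
        case False
        then have "vs ! v \<in> pverts G - (!) vs ` (Z \<inter> {..<n})"
          using v V inj by (auto simp: inj_on_def)
        then obtain u where "u \<in> Z" "u < n" "(vs ! v, vs ! u) \<in> parcs G"
          using D unfolding dominating_set_def by blast
        then show ?thesis using v closed_nbr by blast
      qed
    qed
  qed
  have cd: "card ((!) vs ` (Z \<inter> {..<n})) = card_below n Z" for Z
    unfolding card_below_def using inj by (intro card_image) (auto intro: inj_on_subset)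
  define S where "S = local_search m n k"
  define X where "X = (!) vs ` (S \<inter> {..<n})"
  have "dominating_set G X" using dominates_below_local_search[of m n k] dom unfolding X_def S_def by blast
  moreover have "card X \<le> card Y"
    if Y: "dominating_set G Y" "card ((X - Y) \<union> (Y - X)) \<le> k" for Y
  proof -
    define Z where "Z = {i. i < n \<and> vs ! i \<in> Y}"
    have YZ: "Y = (!) vs ` (Z \<inter> {..<n})"
      using Y(1) V unfolding dominating_set_def Z_def by auto
    have sub: "(!) vs ` (((S - Z) \<union> (Z - S)) \<inter> {..<n}) \<subseteq> (X - Y) \<union> (Y - X)"
      using inj by (auto simp: X_def Z_def inj_on_def)
    have "X \<union> Y \<subseteq> pverts G" using V YZ X_def by blast
    then have fin: "finite ((X - Y) \<union> (Y - X))" using V by (auto intro: finite_subset[of _ "X \<union> Y"] simp: X_def YZ)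
    have "card (((S - Z) \<union> (Z - S)) \<inter> {..<n}) = card ((!) vs ` (((S - Z) \<union> (Z - S)) \<inter> {..<n}))"
      using inj by (intro card_image[symmetric]) (auto intro: inj_on_subset)
    also have "\<dots> \<le> k" using card_mono[OF fin sub] Y(2) by linarith
    finally have "card_below n S \<le> card_below n Z"
      using local_search_optimal[of m n Z k] dom[of Z] Y(1) YZ unfolding S_def by simp
    then show ?thesis unfolding X_def YZ cd .
  qed
  moreover have "computes (mds_prog k) w (set_word vs X)"
  proof -
    have "wp (mds_prog k) (\<lambda>t r' m'. has_output (r', m') (set_word vs X))
      ((\<lambda>_. 0)(0 := length w)) m"
    proof (rule wp_mds_prog[where N = "length w"])
      show "m i = 0" if "length w \<le> i" for i using that by (simp add: m_def)
      fix t n' and r' m' :: "nat \<Rightarrow> nat"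
      assume n': "n' * n' \<le> length w" "length w < Suc n' * Suc n'"
        and out: "r' 0 = n'" "\<And>i. i < n' \<Longrightarrow> m' i = of_bool (i \<in> local_search m n' k)"
      \<comment> \<open>The input length is \<open>n * n\<close>, and its integer square root is
        unique.\<close>
      have "n' = n"
      proof (rule antisym)
        show "n' \<le> n" using n'(1) unfolding lw by (metis mult_le_mono not_le less_imp_le mult_strict_mono' zero_le leD)
        show "n \<le> n'" using n'(2) unfolding lw by (metis mult_le_mono not_less_eq_eq leD)
      qed
      have "i \<in> S \<longleftrightarrow> vs ! i \<in> X" if "i < n" for i
        using that inj by (auto simp: X_def inj_on_def)
      then show "has_output (r', m') (set_word vs X)"
        using out unfolding \<open>n' = n\<close>
        by (auto simp: has_output_def set_word_def n_def S_def)
    qed simp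
    then show ?thesis unfolding computes_def wp_def input_state_def m_def by blast
  qed
  ultimately show ?thesis unfolding w_def by blast
qed

text \<open>\<open>240 * (h + 1)^2\<close> is \<open>120 * c\<close>, so the exchange size is
  \<open>(120 * c * l)^2\<close> and \<open>20 * c / sqrt k = 1 / (6 * l)\<close>, just what
  \<open>near_optimal_ratio\<close> asks for with \<open>t = 1 / l\<close>. The lower bound of
  closeness follows from the minimality of \<open>mds_opt\<close>.\<close>

lemma mds_prog_solves:
  fixes h :: nat and C :: "'a pair_pre_digraph set"
  assumes graphs: "\<And>G. G \<in> C \<Longrightarrow> pair_graph G"
    and free: "\<And>G. G \<in> C \<Longrightarrow> \<not> has_clique_model (parcs G) (pverts G) h"
    and l: "1 \<le> \<epsilon> * real l" "1 \<le> l" and "0 < \<epsilon>"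
  shows "solves_mds_within \<epsilon> (mds_prog (l * (l * (240 * (h + 1)\<^sup>2)\<^sup>2))) C"
  unfolding solves_mds_within_def
proof (intro ballI allI impI)
  fix G vs assume G: "G \<in> C" and vs: "distinct vs \<and> set vs = pverts G"
  interpret G: pair_graph G by (rule graphs[OF G])
  define k where "k = l * (l * (240 * (h + 1)\<^sup>2)\<^sup>2)"
  define c where "c = 2 * (real h + 1)\<^sup>2"
  have c: "0 < c" by (simp add: c_def)
  have "real k = (120 * c * real l)\<^sup>2"
    by (simp add: k_def c_def power_mult_distrib power2_eq_square algebra_simps)
  then have sk: "sqrt k = 120 * c * real l" using c by (simp add: real_sqrt_mult)
  have lpos: "1 \<le> real l" using l(2) by simp
  have "20 * c \<le> 120 * c * real l" using c lpos by simp
  then have "(20 * c)\<^sup>2 \<le> (120 * c * real l)\<^sup>2" using c by (intro power_mono) auto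
  then have k400: "400 * c\<^sup>2 \<le> real k" using \<open>real k = _\<close> by (simp add: power_mult_distrib)
  obtain X where X: "computes (mds_prog k) (graph_word vs G) (set_word vs X)" "dominating_set G X"
    and opt: "\<And>Y. dominating_set G Y \<Longrightarrow> card ((X - Y) \<union> (Y - X)) \<le> k \<Longrightarrow> card X \<le> card Y"
    using mds_prog_computes[of vs G k] vs by blast
  obtain Y where Y: "dominating_set G Y" "card Y = mds_opt G"
    using mds_opt_attained(1)[OF G.pair_finite_verts] by blast
  have "sym (parcs G)" using G.arcs_symmetric by (auto simp: sym_def)
  then have "real (card X) \<le> card Y + 40 * c / sqrt k * (card X + card Y)"
    using local_optimum_dominating[OF G.pair_finite_verts _ free[OF G] _ _ _ opt[unfolded dominating_set_iff_dominates],
        where X = Y] k400 X(2) Y(1) unfolding c_def dominating_set_iff_dominates by simp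
  then have "real (card X) \<le> card Y + 2 * (20 * c / sqrt k) * (real (card X) + card Y)" by simp
  moreover have "6 * (20 * c / sqrt k) = 1 / real l"
    unfolding sk using c lpos by (simp add: field_simps)
  ultimately have "real (card X) \<le> (1 + 1 / real l) * card Y"
    using c lpos by (intro near_optimal_ratio[where d = "20 * c / sqrt k"]) auto
  also have "\<dots> \<le> (1 + \<epsilon>) * card Y"
    using l(1) lpos by (intro mult_right_mono) (simp_all add: field_simps)
  finally have upper: "real (card X) \<le> (1 + \<epsilon>) * mds_opt G" unfolding Y(2) .
  have "(1 - \<epsilon>) * mds_opt G \<le> 1 * real (mds_opt G)" using assms(5) by (intro mult_right_mono) auto
  also have "\<dots> \<le> card X" using mds_opt_attained(2)[OF G.pair_finite_verts X(2)] by simp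
  finally show "\<exists>X. mds_close \<epsilon> G X \<and>
      computes (mds_prog (l * (l * (240 * (h + 1)\<^sup>2)\<^sup>2))) (graph_word vs G) (set_word vs X)"
    using upper X unfolding mds_close_def k_def by blast
qed

text \<open>Only the operand of the first instruction varies, so the code is a fixed prefix, a block
  of ones and a fixed rest. The word given for \<open>p\<close> and \<open>q\<close> has length
  \<open>p + q + 2\<close>, which is the value of \<open>l\<close>.\<close>

lemma uniform_family_mds_prog:
  assumes "\<And>p q :: nat. 0 < p \<Longrightarrow> 0 < q \<Longrightarrow> coprime p q \<Longrightarrow> l (real p / real q) = p + q + 2"
  shows "uniform_family (\<lambda>\<epsilon>. mds_prog (l \<epsilon> * (l \<epsilon> * K)))"
proof -
  \<comment> \<open>\<open>u\<close> encodes \<open>Seq\<close>, \<open>Const\<close> and register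
    2; the \<open>False\<close> in front of \<open>v\<close> ends the unary constant.\<close>
  define u v where "u = nat_word 6 @ nat_word 1 @ nat_word 2" and "v = False # prog_word search_prog"
  have "computes (uniform_prog K u v) (nat_word p @ nat_word q)
      (prog_word (mds_prog (l (real p / real q) * (l (real p / real q) * K))))"
    if pq: "0 < p" "0 < q" "coprime p q" for p q
  proof -
    let ?w = "nat_word p @ nat_word q"
    let ?l = "l (real p / real q)"
    have "length ?w = ?l" using assms[OF pq] by (simp add: nat_word_def)
    moreover define m :: "nat \<Rightarrow> nat" where "m i = (if i < length ?w then of_bool (?w ! i) else 0)" for i
    moreover define y where "y = prog_word (mds_prog (?l * (?l * K)))"
    moreover have "y = u @ replicate (?l * (?l * K)) True @ v"
      by (simp add: y_def mds_prog_def u_def v_def nat_word_def)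
    ultimately have "wp (uniform_prog K u v) (\<lambda>t r' m'. has_output (r', m') y)
        ((\<lambda>_. 0)(0 := length ?w)) m"
      by (intro wp_uniform_prog[where l = "length ?w" and y = y]) (auto simp: has_output_def)
    then show ?thesis unfolding computes_def wp_def input_state_def m_def y_def by blast
  qed
  then show ?thesis unfolding uniform_family_def by blast
qed

text \<open>Reduced fractions are unique, so the prescribed value is consistent, and
  \<open>\<epsilon> * q = p \<ge> 1\<close> makes it large enough. For irrational
  \<open>\<epsilon>\<close> any \<open>l\<close> above \<open>1 / \<epsilon>\<close> serves.\<close>

lemma accuracy_level:
  fixes \<epsilon> :: real
  assumes "0 < \<epsilon>"
  shows "\<exists>l. 1 \<le> \<epsilon> * real l \<and> 1 \<le> l \<and>
    (\<forall>p q. 0 < p \<longrightarrow> 0 < q \<longrightarrow> coprime p q \<longrightarrow> \<epsilon> = real p / real q \<longrightarrow> l = p + q + 2)"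
proof (cases "\<exists>p q. 0 < p \<and> 0 < q \<and> coprime p q \<and> \<epsilon> = real p / real q")
  case True
  then obtain p q where pq: "0 < p" "0 < q" "coprime p q" "\<epsilon> = real p / real q" by blast
  have "p = p' \<and> q = q'" if "0 < p'" "0 < q'" "coprime p' q'" "\<epsilon> = real p' / real q'" for p' q'
  proof -
    have "real (p * q') = real (p' * q)" using that pq by (simp add: field_simps)
    then have "p * q' = p' * q" by linarith
    then show ?thesis using coprime_crossproduct_nat[of p q p' q'] pq that by simp
  qed
  moreover have "1 \<le> \<epsilon> * real (p + q + 2)"
  proof -
    have "1 \<le> real p / real q * real q" using pq(1,2) by simp
    also have "\<dots> \<le> real p / real q * real (p + q + 2)"
      by (intro mult_left_mono) auto
    finally show ?thesis unfolding pq(4) .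
  qed
  ultimately show ?thesis by (intro exI[of _ "p + q + 2"]) auto
next
  case False
  define l where "l = nat \<lceil>1 / \<epsilon>\<rceil> + 1"
  have "1 / \<epsilon> \<le> real l" by (simp add: l_def) linarith
  then have "1 \<le> \<epsilon> * real l" using assms by (simp add: field_simps)
  moreover have "1 \<le> l" by (simp add: l_def)
  ultimately show ?thesis using False by blast
qed

theorem theorem5p5:
  fixes C :: "'a pair_pre_digraph set"
  assumes "\<And>G. G \<in> C \<Longrightarrow> pair_graph G"
    and "has_excluded_minor C"
  shows "mds_has_ptas C"
proof -
  obtain H :: "nat pair_pre_digraph" where H: "pair_graph H" "\<forall>G\<in>C. \<not> is_minor H G"
    using assms(2) unfolding has_excluded_minor_def by blast
  define h where "h = card (pverts H)"
  have free: "\<not> has_clique_model (parcs G) (pverts G) h" if "G \<in> C" for G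
    using is_minor_of_clique_model[OF assms(1)[OF that] H(1)] H(2) that unfolding h_def by blast
  \<comment> \<open>A pointwise choice: uniformity constrains \<open>l\<close> only at positive
    rationals, where its value is forced.\<close>
  obtain l where l: "\<And>\<epsilon> :: real. 0 < \<epsilon> \<Longrightarrow> 1 \<le> \<epsilon> * real (l \<epsilon>) \<and> 1 \<le> l \<epsilon> \<and>
    (\<forall>p q. 0 < p \<longrightarrow> 0 < q \<longrightarrow> coprime p q \<longrightarrow> \<epsilon> = real p / real q \<longrightarrow> l \<epsilon> = p + q + 2)"
    using accuracy_level by metis
  define A where "A \<epsilon> = mds_prog (l \<epsilon> * (l \<epsilon> * (240 * (h + 1)\<^sup>2)\<^sup>2))" for \<epsilon>
  have "uniform_family A"
    unfolding A_def
  proof (rule uniform_family_mds_prog)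
    fix p q :: nat assume pq: "0 < p" "0 < q" "coprime p q"
    then have "0 < real p / real q" by simp
    from l[OF this] pq show "l (real p / real q) = p + q + 2" by blast
  qed
  moreover have "polynomial_time (A \<epsilon>)" for \<epsilon>
    unfolding A_def by (rule polynomial_time_mds_prog)
  moreover have "solves_mds_within \<epsilon> (A \<epsilon>) C" if "0 < \<epsilon>" for \<epsilon>
    unfolding A_def using mds_prog_solves[OF assms(1) free] l[OF that] that by blast
  ultimately show ?thesis unfolding mds_has_ptas_def by blast
qed

end
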